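(* For integers $N\ge1$, $K\ge1$, let $V^{N,K}$ be the value function of the control problem described in the context, with $N$ units and at most $K$ servers (with the same $T,\pi,\lambda,e$ for all $N,K$). Let $\Delta_i^{N,K}(t):=V^{N,K}(t,i)-V^{N,K}(t,i-1)$ for $i=1,\ldots,N$, let $\mathcal I_t^{N,K}:=\{i\in\{1,\ldots,N\}:\Delta_i^{N,K}(t)>e(t)\}$, and let $i_{N,K}^{\min}(t):=\min\mathcal I_t^{N,K}$, with $i_{N,K}^{\min}(t):=N+1$ if $\mathcal I_t^{N,K}=\emptyset$. Then, for every $t\in[0,T]$: 1. For every fixed $K$ and every $N\ge1$, $i_{N+1,K}^{\min}(t)\ge i_{N,K}^{\min}(t)$. 2. For every fixed $N$ and every $K\ge1$, $i_{N,K+1}^{\min}(t)\ge i_{N,K}^{\min}(t)$.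
   Context: Let $T\in(0,\infty)$ and $\pi>0$; write $a\wedge b=\min\{a,b\}$. The functions $\lambda,e:[0,T]\to(0,\infty)$ are deterministic, bounded, right-continuous, continuously differentiable except at finitely many time points, with $\inf_{t\in[0,T]}\lambda(t)>0$ and $\inf_{t\in[0,T]}e(t)>0$ (they may have jumps at the exceptional points). For integers $N\ge1$, $K\ge1$, the control problem with capacities $N,K$ is as follows. The state $I(t)\in\{0,1,\ldots,N\}$ is the number of depleted units. When $I(t)=i$ the feasible actions are $\mathcal U(i)=\{0,1,\ldots,i\wedge K\}$. Under action $u$ at time $t$, the state jumps from $i$ to $i+1$ at rate $\lambda(t)$ if $i<N$, and from $i$ to $i-1$ at rate $u$; in state $N$ arrivals (at rate $\lambda(t)$) are lost and leave the state unchanged. The cost rate is $c(t,i,u)=e(t)u+\pi\lambda(t)\mathbf 1_{\{i=N\}}$. A control $u=\{u(t)\}$ is admissible if it is non-anticipative and $u(t)\in\mathcal U(I(t))$ at all times. The cost-to-go is $J^u(t,i)=\mathbb E\left[\int_t^T c(s,I(s),u(s))\,ds\,\middle|\,I(t)=i\right]$, and the value function is $V^{N,K}(t,i)=\inf_u J^u(t,i)$ for $t\in[0,T]$, $i\in\{0,\ldots,N\}$, with $V^{N,K}(T,i)=0$. *)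

theory Defs
  imports "HOL-Probability.Probability"
begin

(* The finite exceptional set S may contain the end points 0 and T, so the values of f outside
   [0,T] are irrelevant. *)
definition regular_coefficient :: "real \<Rightarrow> (real \<Rightarrow> real) \<Rightarrow> bool" where
  "regular_coefficient T f \<longleftrightarrow>
     (\<forall>t\<in>{0..T}. f t > 0) \<and>
     bounded (f ` {0..T}) \<and>
     (\<forall>t\<in>{0..<T}. continuous (at_right t) f) \<and>
     (\<exists>S. finite S \<and> f C1_differentiable_on ({0..T} - S)) \<and>
     (INF t\<in>{0..T}. f t) > 0"

definition feasible_actions :: "nat \<Rightarrow> nat \<Rightarrow> nat set" where
  "feasible_actions K i = {0..min i K}"

(* Rate of the transition from i to j (j different from i) at time t under action u.
   Arrivals in state N are lost and hence do not appear. *)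
definition jump_rate :: "(real \<Rightarrow> real) \<Rightarrow> nat \<Rightarrow> real \<Rightarrow> nat \<Rightarrow> nat \<Rightarrow> nat \<Rightarrow> real" where
  "jump_rate lam N t u i j =
     (if j = Suc i \<and> i < N then lam t
      else if i = Suc j then real u
      else 0)"

definition generator ::
  "(real \<Rightarrow> real) \<Rightarrow> nat \<Rightarrow> real \<Rightarrow> nat \<Rightarrow> (nat \<Rightarrow> real) \<Rightarrow> nat \<Rightarrow> real" where
  "generator lam N t u f i = (\<Sum>j\<le>N. jump_rate lam N t u i j * (f j - f i))"

definition cost_rate ::
  "(real \<Rightarrow> real) \<Rightarrow> (real \<Rightarrow> real) \<Rightarrow> real \<Rightarrow> nat \<Rightarrow> real \<Rightarrow> nat \<Rightarrow> nat \<Rightarrow> real" where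
  "cost_rate lam e p N t i u = e t * real u + p * lam t * (if i = N then 1 else 0)"

(* An admissible control of the system started in state i at time t, in the weak formulation:
   a filtered probability space carrying a state process I with right-continuous paths with left
   limits (for the discrete topology of nat) and an action process u, such that
   - u is non-anticipative, i.e. progressively measurable with respect to F,
   - u takes feasible actions at all times,
   - given F, the state jumps with the rates jump_rate: for every function f of the state,
     f (I s) minus the time integral of the generator applied to f is an F-martingale.
   The last condition is stated for increments. *)
definition controlled_system ::
  "real \<Rightarrow> (real \<Rightarrow> real) \<Rightarrow> nat \<Rightarrow> nat \<Rightarrow> real \<Rightarrow> nat \<Rightarrow>
   'w measure \<Rightarrow> (real \<Rightarrow> 'w measure) \<Rightarrow> (real \<Rightarrow> 'w \<Rightarrow> nat) \<Rightarrow> (real \<Rightarrow> 'w \<Rightarrow> nat) \<Rightarrow> bool" where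
  "controlled_system T lam N K t i M F I u \<longleftrightarrow>
     prob_space M \<and>
     filtration (space M) F \<and> (\<forall>s\<in>{t..T}. subalgebra M (F s)) \<and>
     (\<forall>s\<in>{t..T}. I s \<in> F s \<rightarrow>\<^sub>M count_space UNIV) \<and>
     (\<forall>s\<in>{t..T}. (\<lambda>(r, \<omega>). u r \<omega>) \<in> restrict_space borel {t..s} \<Otimes>\<^sub>M F s \<rightarrow>\<^sub>M count_space UNIV) \<and>
     (\<forall>\<omega>\<in>space M.
        I t \<omega> = i \<and>
        (\<forall>s\<in>{t..T}. I s \<omega> \<in> {0..N} \<and> u s \<omega> \<in> feasible_actions K (I s \<omega>)) \<and>
        (\<forall>s\<in>{t..<T}. continuous (at_right s) (\<lambda>r. I r \<omega>)) \<and>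
        (\<forall>s\<in>{t<..T}. \<exists>l. ((\<lambda>r. I r \<omega>) \<longlongrightarrow> l) (at_left s))) \<and>
     (\<forall>f :: nat \<Rightarrow> real. \<forall>r s. t \<le> r \<and> r \<le> s \<and> s \<le> T \<longrightarrow>
        (AE \<omega> in M.
           real_cond_exp M (F r)
             (\<lambda>\<omega>. f (I s \<omega>) - f (I r \<omega>)
                   - (LBINT q:{r..s}. generator lam N q (u q \<omega>) f (I q \<omega>))) \<omega> = 0))"

definition cost_to_go ::
  "real \<Rightarrow> (real \<Rightarrow> real) \<Rightarrow> (real \<Rightarrow> real) \<Rightarrow> real \<Rightarrow> nat \<Rightarrow> real \<Rightarrow>
   'w measure \<Rightarrow> (real \<Rightarrow> 'w \<Rightarrow> nat) \<Rightarrow> (real \<Rightarrow> 'w \<Rightarrow> nat) \<Rightarrow> real" where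
  "cost_to_go T lam e p N t M I u =
     (\<integral>\<omega>. (LBINT s:{t..T}. cost_rate lam e p N s (I s \<omega>) (u s \<omega>)) \<partial>M)"

(* HOL cannot quantify over all sample spaces inside a definition. Measures on the type
   nat => real realise every standard Borel probability space up to isomorphism, in particular
   the space of right-continuous state paths with left limits. Costs are nonnegative, so the
   infimum is taken over a set of reals bounded below by 0. *)
definition value_function ::
  "real \<Rightarrow> (real \<Rightarrow> real) \<Rightarrow> (real \<Rightarrow> real) \<Rightarrow> real \<Rightarrow> nat \<Rightarrow> nat \<Rightarrow> real \<Rightarrow> nat \<Rightarrow> real" where
  "value_function T lam e p N K t i =
     Inf {cost_to_go T lam e p N t M I u | (M :: (nat \<Rightarrow> real) measure) F I u.
            controlled_system T lam N K t i M F I u}"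

definition marginal_value ::
  "real \<Rightarrow> (real \<Rightarrow> real) \<Rightarrow> (real \<Rightarrow> real) \<Rightarrow> real \<Rightarrow> nat \<Rightarrow> nat \<Rightarrow> real \<Rightarrow> nat \<Rightarrow> real" where
  "marginal_value T lam e p N K t i =
     value_function T lam e p N K t i - value_function T lam e p N K t (i - 1)"

definition active_states ::
  "real \<Rightarrow> (real \<Rightarrow> real) \<Rightarrow> (real \<Rightarrow> real) \<Rightarrow> real \<Rightarrow> nat \<Rightarrow> nat \<Rightarrow> real \<Rightarrow> nat set" where
  "active_states T lam e p N K t = {i \<in> {1..N}. marginal_value T lam e p N K t i > e t}"

definition i_min ::
  "real \<Rightarrow> (real \<Rightarrow> real) \<Rightarrow> (real \<Rightarrow> real) \<Rightarrow> real \<Rightarrow> nat \<Rightarrow> nat \<Rightarrow> real \<Rightarrow> nat" where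
  "i_min T lam e p N K t =
     (if active_states T lam e p N K t = {} then N + 1
      else Min (active_states T lam e p N K t))"

end

theory Submission
  imports Defs
begin

text \<open>
  The value function solves the Hamilton-Jacobi-Bellman equation. Its increments
  \<open>D i = V t i - V t (i - 1)\<close> therefore solve, backwards in time, with \<open>D i = 0\<close> at \<open>T\<close>, with
  \<open>D (N + 1) = p\<close> and with \<open>k i = min i K\<close>, the system
  \<open>- D i' = lam * (D (i + 1) - D i) - k i * (D i - e)\<^sup>+ + k (i - 1) * (D (i - 1) - e)\<^sup>+\<close>.
  Its right-hand side is nondecreasing in every \<open>D j\<close> with \<open>j \<noteq> i\<close>, so a comparison principle
  holds (\<open>mild_comparison\<close>), and four comparisons settle the theorem.

  The constant \<open>p\<close> is a supersolution, so \<open>D i \<le> p\<close> (\<open>marginals_le_penalty\<close>). Hence the system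
  with \<open>N + 1\<close> units, read on the indices up to \<open>N\<close>, is the system with \<open>N\<close> units whose boundary
  value \<open>p\<close> is lowered, and the increments decrease in \<open>N\<close>. One more server changes the right-hand
  side by \<open>- d i * (D i - e)\<^sup>+ + d (i - 1) * (D (i - 1) - e)\<^sup>+\<close>, where \<open>d i\<close> is \<open>1\<close> for \<open>i > K\<close>
  and \<open>0\<close> otherwise; this is at most \<open>0\<close> if \<open>D\<close> is nondecreasing in \<open>i\<close>, that is, if the value
  function is convex in the state. Convexity is a comparison for the second differences and rests
  on the concavity of \<open>i \<mapsto> min i K\<close> (\<open>marginals_mono\<close>). So the increments decrease in \<open>K\<close> as well,
  and the lowest state where an increment exceeds \<open>e\<close> can only move up.

  The equation is tied to the stochastic control problem in two steps. The martingale property of a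
  controlled system shows that its cost is the solution of the equation plus the expected integral
  of a nonnegative defect, which vanishes for the feedback rule that serves at full capacity exactly
  where the increment exceeds \<open>e\<close> (\<open>cost_to_go_decomposition\<close>). A system governed by this rule is
  constructed by thinning a Poisson clock of rate \<open>L\<close> (\<open>feedback_controlled_system\<close>).

  The coefficients may jump, so differential equations are written as integral
  equations. With the integrating factor \<open>exp (- L * q)\<close> they become fixed point equations with the
  kernel \<open>L * exp (- L * x)\<close>, the density of the waiting time for the Poisson clock, whose mass on an
  interval of length at most \<open>T\<close> is at most \<open>1 - exp (- L * T) < 1\<close>. This contraction yields the
  solution of the equation, the divergence of the clock and the martingale property of the
  constructed system.
\<close>

section \<open>Integral equations on an interval and a comparison principle\<close>

lemma bounded_borel_set_integrable:
  fixes f :: "real \<Rightarrow> real"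
  assumes [measurable]: "f \<in> borel_measurable borel"
    and "\<And>x. x \<in> {a..b} \<Longrightarrow> \<bar>f x\<bar> \<le> B"
  shows "set_integrable lborel {a..b} f"
  unfolding set_integrable_def
proof (rule integrableI_bounded_set[where A="{a..b}" and B=B])
  show "AE x in lborel. x \<in> {a..b} \<longrightarrow> norm (indicat_real {a..b} x *\<^sub>R f x) \<le> B"
    using assms(2) by (auto simp: indicator_def)
qed (auto simp: emeasure_lborel_Icc_eq)

text \<open>
  Fubini's theorem on the triangle \<open>a \<le> s \<le> q \<le> b\<close>. It replaces integration by parts and the
  product rule for functions that are known only as integrals of bounded Borel functions.
\<close>

lemma set_integral_triangle_swap:
  fixes g w :: "real \<Rightarrow> real"
  assumes [measurable]: "g \<in> borel_measurable borel" "w \<in> borel_measurable borel"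
    and g: "\<And>x. x \<in> {a..b} \<Longrightarrow> \<bar>g x\<bar> \<le> G" and w: "\<And>x. x \<in> {a..b} \<Longrightarrow> \<bar>w x\<bar> \<le> W"
  shows "(LBINT s:{a..b}. g s * (LBINT q:{s..b}. w q)) = (LBINT q:{a..b}. (LBINT s:{a..q}. g s) * w q)"
proof (cases "a \<le> b")
  case False
  then show ?thesis by (simp add: set_lebesgue_integral_def)
next
  case ab: True
  define f where "f s q = indicator {a..b} s * (indicator {a..b} q * (if s \<le> q then g s * w q else 0))" for s q :: real
  have fm: "(\<lambda>(s,q). f s q) \<in> borel_measurable (lborel \<Otimes>\<^sub>M lborel)"
    unfolding f_def by measurable
  have bd: "\<bar>f s q\<bar> \<le> G * W" for s q
  proof (cases "s \<in> {a..b} \<and> q \<in> {a..b} \<and> s \<le> q")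
    case True
    then show ?thesis using g[of s] w[of q] by (auto simp: f_def abs_mult intro!: mult_mono)
  next
    case False
    have "0 \<le> G" "0 \<le> W" using g[of a] w[of a] ab by auto
    then have "0 \<le> G * W" by simp
    with False show ?thesis by (auto simp: f_def indicator_def)
  qed
  have int: "integrable (lborel \<Otimes>\<^sub>M lborel) (\<lambda>(s,q). f s q)"
  proof (rule integrableI_bounded_set[where A="{a..b} \<times> {a..b}" and B="G * W"])
    show "emeasure (lborel \<Otimes>\<^sub>M lborel) ({a..b} \<times> {a..b}) < \<infinity>"
      by (subst lborel.emeasure_pair_measure_Times) (auto simp: emeasure_lborel_Icc_eq ennreal_mult_less_top)
    show "AE x in lborel \<Otimes>\<^sub>M lborel. x \<in> {a..b} \<times> {a..b} \<longrightarrow> norm (case x of (s, q) \<Rightarrow> f s q) \<le> G * W"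
      using bd by (auto intro!: AE_I2)
  qed (use fm in \<open>auto simp: f_def indicator_def\<close>)
  have "(LBINT s:{a..b}. g s * (LBINT q:{s..b}. w q)) = (LBINT s. LBINT q. f s q)"
    unfolding set_lebesgue_integral_def
  proof (rule Bochner_Integration.integral_cong[OF refl])
    fix s :: real
    show "indicat_real {a..b} s *\<^sub>R (g s * (LBINT q. indicat_real {s..b} q *\<^sub>R w q)) = (LBINT q. f s q)"
    proof (cases "s \<in> {a..b}")
      case True
      have "f s q = g s * (indicat_real {s..b} q *\<^sub>R w q)" for q
        using True by (auto simp: f_def indicator_def)
      with True show ?thesis by simp
    qed (auto simp: f_def)
  qed
  also have "\<dots> = (LBINT q. LBINT s. f s q)"
    using lborel_pair.Fubini_integral[OF int] by simp
  also have "\<dots> = (LBINT q:{a..b}. (LBINT s:{a..q}. g s) * w q)"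
    unfolding set_lebesgue_integral_def
  proof (rule Bochner_Integration.integral_cong[OF refl])
    fix q :: real
    show "(LBINT s. f s q) = indicat_real {a..b} q *\<^sub>R ((LBINT s. indicat_real {a..q} s *\<^sub>R g s) * w q)"
    proof (cases "q \<in> {a..b}")
      case True
      have "f s q = (indicat_real {a..q} s *\<^sub>R g s) * w q" for s
        using True by (auto simp: f_def indicator_def)
      with True show ?thesis by simp
    qed (auto simp: f_def)
  qed
  finally show ?thesis .
qed

lemma set_integral_exp:
  fixes c s t :: real
  assumes "s \<le> t"
  shows "(LBINT q:{s..t}. c * exp (c * (q - a))) = exp (c * (t - a)) - exp (c * (s - a))"
proof -
  have "(LBINT q. (c * exp (c * (q - a))) * indicator {s..t} q) = exp (c * (t - a)) - exp (c * (s - a))"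
    by (rule integral_FTC_Icc_real[OF assms, where F="\<lambda>q. exp (c * (q - a))"])
       (auto intro!: derivative_eq_intros continuous_intros)
  moreover have "(LBINT q:{s..t}. c * exp (c * (q - a))) = (LBINT q. (c * exp (c * (q - a))) * indicator {s..t} q)"
    unfolding set_lebesgue_integral_def by (rule Bochner_Integration.integral_cong) auto
  ultimately show ?thesis by simp
qed

text \<open>
  For continuous \<open>b\<close> the hypothesis says \<open>y' = L * y - b\<close> with \<open>y T = 0\<close>, and the claim is this equation
  integrated. For Borel \<open>b\<close> the two are related by exchanging the order of integration.
\<close>

lemma mild_to_integral_equation:
  fixes b y :: "real \<Rightarrow> real"
  assumes [measurable]: "b \<in> borel_measurable borel" "y \<in> borel_measurable borel"
    and B: "\<And>x. x \<in> {s..T} \<Longrightarrow> \<bar>b x\<bar> \<le> B" and Y: "\<And>x. x \<in> {s..T} \<Longrightarrow> \<bar>y x\<bar> \<le> Y"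
    and L: "0 < L" and sT: "s \<le> T"
    and mild: "\<And>r. r \<in> {s..T} \<Longrightarrow> y r = (LBINT q:{r..T}. exp (- L * (q - r)) * b q)"
  shows "y s = (LBINT q:{s..T}. b q - L * y q)"
proof -
  have eb: "\<bar>exp (- L * (q - s)) * b q\<bar> \<le> B" if "q \<in> {s..T}" for q
  proof -
    have "exp (- L * (q - s)) * \<bar>b q\<bar> \<le> 1 * B"
      using that L B[of q] by (intro mult_mono) auto
    then show ?thesis by (simp add: abs_mult)
  qed
  have "(LBINT q:{s..T}. L * y q) = (LBINT q:{s..T}. (L * exp (L * (q - s))) * (LBINT x:{q..T}. exp (- L * (x - s)) * b x))"
  proof (rule set_lebesgue_integral_cong)
    show "\<forall>q. q \<in> {s..T} \<longrightarrow> L * y q = L * exp (L * (q - s)) * (LBINT x:{q..T}. exp (- L * (x - s)) * b x)"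
    proof safe
      fix q assume q: "q \<in> {s..T}"
      have "exp (L * (q - s)) * (exp (- L * (x - s)) * b x) = exp (- L * (x - q)) * b x" for x
      proof -
        have "L * (q - s) + - L * (x - s) = - L * (x - q)" by (simp add: algebra_simps)
        then have "exp (L * (q - s)) * exp (- L * (x - s)) = exp (- L * (x - q))"
          by (simp add: exp_add[symmetric])
        then show ?thesis by (simp add: mult.assoc[symmetric])
      qed
      then have "exp (L * (q - s)) * (LBINT x:{q..T}. exp (- L * (x - s)) * b x) = y q"
        unfolding mild[OF q] by (subst set_integral_mult_right[symmetric]) (simp only:)
      then show "L * y q = L * exp (L * (q - s)) * (LBINT x:{q..T}. exp (- L * (x - s)) * b x)"
        by (simp add: mult.assoc)
    qed
  qed simp
  also have "\<dots> = (LBINT x:{s..T}. (LBINT q:{s..x}. L * exp (L * (q - s))) * (exp (- L * (x - s)) * b x))"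
  proof (rule set_integral_triangle_swap[where G="L * exp (L * (T - s))" and W=B])
    show "\<bar>exp (- L * (x - s)) * b x\<bar> \<le> B" if "x \<in> {s..T}" for x using eb[OF that] .
    show "\<bar>L * exp (L * (q - s))\<bar> \<le> L * exp (L * (T - s))" if "q \<in> {s..T}" for q
      using that L by (simp add: abs_mult)
  qed measurable
  also have "\<dots> = (LBINT x:{s..T}. b x - exp (- L * (x - s)) * b x)"
  proof (rule set_lebesgue_integral_cong)
    show "\<forall>x. x \<in> {s..T} \<longrightarrow> (LBINT q:{s..x}. L * exp (L * (q - s))) * (exp (- L * (x - s)) * b x) = b x - exp (- L * (x - s)) * b x"
    proof safe
      fix x assume "x \<in> {s..T}"
      then have "(LBINT q:{s..x}. L * exp (L * (q - s))) = exp (L * (x - s)) - 1"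
        by (subst set_integral_exp) auto
      then show "(LBINT q:{s..x}. L * exp (L * (q - s))) * (exp (- L * (x - s)) * b x) = b x - exp (- L * (x - s)) * b x"
        by (simp add: left_diff_distrib mult.assoc[symmetric] exp_add[symmetric])
    qed
  qed simp
  also have "\<dots> = (LBINT x:{s..T}. b x) - y s"
  proof (subst set_integral_diff)
    show "set_integrable lborel {s..T} b" by (rule bounded_borel_set_integrable[OF _ B]) auto
    show "set_integrable lborel {s..T} (\<lambda>x. exp (- L * (x - s)) * b x)"
      by (rule bounded_borel_set_integrable[OF _ eb]) auto
    show "(LBINT x:{s..T}. b x) - (LBINT x:{s..T}. exp (- L * (x - s)) * b x) = (LBINT x:{s..T}. b x) - y s"
      using mild[of s] sT by (simp del: mult_minus_left)
  qed
  finally have "y s = (LBINT x:{s..T}. b x) - (LBINT q:{s..T}. L * y q)" by simp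
  also have "\<dots> = (LBINT q:{s..T}. b q - L * y q)"
  proof (rule set_integral_diff(2)[symmetric])
    show "set_integrable lborel {s..T} b" by (rule bounded_borel_set_integrable[OF _ B]) auto
    show "set_integrable lborel {s..T} (\<lambda>q. L * y q)"
      using Y L by (intro bounded_borel_set_integrable[where B="L * Y"]) (auto simp: abs_mult)
  qed
  finally show ?thesis .
qed

text \<open>
  The hypothesis \<open>step\<close>, used with the supremum of \<open>f\<close> as \<open>m\<close>, forbids a positive supremum. In
  the applications \<open>f\<close> measures by how much a solution of a fixed point equation misses the claim, and
  \<open>\<theta>\<close> bounds the possibly weighted mass of the kernel.
\<close>

lemma contraction_nonpos:
  fixes f :: "'a \<Rightarrow> real"
  assumes bdd: "\<And>x. x \<in> X \<Longrightarrow> f x \<le> B" and \<theta>: "\<theta> < 1"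
    and step: "\<And>m x. 0 \<le> m \<Longrightarrow> (\<And>y. y \<in> X \<Longrightarrow> f y \<le> m) \<Longrightarrow> x \<in> X \<Longrightarrow> f x \<le> \<theta> * m"
    and x: "x \<in> X"
  shows "f x \<le> 0"
proof (rule ccontr)
  assume pos: "\<not> f x \<le> 0"
  define m where "m = (SUP y\<in>X. f y)"
  have bd: "bdd_above (f ` X)" using bdd by (auto simp: bdd_above_def)
  have le: "f y \<le> m" if "y \<in> X" for y unfolding m_def by (rule cSUP_upper[OF that bd])
  have m: "0 < m" using le[OF x] pos by simp
  have "m \<le> \<theta> * m" unfolding m_def
    by (rule cSUP_least) (use x step[of m] le m in \<open>auto simp: m_def\<close>)
  with \<theta> m show False by simp
qed

text \<open>
  The comparison principle for cooperative systems. The equations enter as inequalities, so that \<open>y\<close>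
  may be a supersolution, and \<open>coop\<close> is what monotonicity of the right-hand sides gives: a lower
  bound \<open>- m\<close> for all components bounds each right-hand side below by \<open>- L * m\<close>. Measured with the weight
  \<open>exp (2 * L * (T - s))\<close>, one integration halves every lower bound.
\<close>

lemma mild_comparison:
  fixes y b :: "'i \<Rightarrow> real \<Rightarrow> real"
  assumes int: "\<And>i s. i \<in> J \<Longrightarrow> s \<in> {0..T} \<Longrightarrow> set_integrable lborel {s..T} (\<lambda>q. exp (- \<Lambda> * (q - s)) * b i q)"
    and yb: "\<And>i q. i \<in> J \<Longrightarrow> q \<in> {0..T} \<Longrightarrow> - Y \<le> y i q"
    and L: "0 < L" and \<Lambda>: "0 \<le> \<Lambda>"
    and mild: "\<And>i s. i \<in> J \<Longrightarrow> s \<in> {0..T} \<Longrightarrow> (LBINT q:{s..T}. exp (- \<Lambda> * (q - s)) * b i q) \<le> y i s"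
    and coop: "\<And>m i q. 0 \<le> m \<Longrightarrow> q \<in> {0..T} \<Longrightarrow> (\<And>j. j \<in> J \<Longrightarrow> - m \<le> y j q) \<Longrightarrow> i \<in> J \<Longrightarrow> - L * m \<le> b i q"
    and i: "i \<in> J" and s: "s \<in> {0..T}"
  shows "0 \<le> y i s"
proof -
  \<comment> \<open>The weight has to decay at twice the rate \<open>L\<close> for a contraction factor \<open>1/2\<close>.\<close>
  define C where "C = 2 * L"
  define X where "X = J \<times> {0..T}"
  define f where "f = (\<lambda>(i, s). - y i s * exp (- C * (T - s)))"
  have C: "0 < C" using L by (simp add: C_def)
  have "f (i, s) \<le> 0"
  proof (rule contraction_nonpos[where X=X and \<theta>="1/2" and B="\<bar>Y\<bar>"])
    fix x assume "x \<in> X"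
    then obtain i s where x: "x = (i, s)" "i \<in> J" "s \<in> {0..T}" by (auto simp: X_def)
    have "- y i s * exp (- C * (T - s)) \<le> \<bar>Y\<bar> * exp (- C * (T - s))"
      using yb[OF x(2,3)] by (intro mult_right_mono) auto
    also have "\<dots> \<le> \<bar>Y\<bar> * 1" using C x(3) by (intro mult_left_mono) auto
    finally show "f x \<le> \<bar>Y\<bar>" by (simp add: x f_def)
  next
    fix m x assume m: "0 \<le> m" and le: "\<And>y. y \<in> X \<Longrightarrow> f y \<le> m" and "x \<in> X"
    then obtain i s where x: "x = (i, s)" "i \<in> J" "s \<in> {0..T}" by (auto simp: X_def)
    have lower: "- (m * exp (C * (T - q))) \<le> y j q" if "j \<in> J" "q \<in> {0..T}" for j q
    proof -
      have "- y j q * exp (- C * (T - q)) \<le> m" using le[of "(j, q)"] that by (simp add: X_def f_def)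
      then have "- y j q * exp (- C * (T - q)) * exp (C * (T - q)) \<le> m * exp (C * (T - q))"
        by (intro mult_right_mono) auto
      then show ?thesis by (simp add: mult.assoc exp_add[symmetric])
    qed
    have pt: "(m/2) * (- C * exp (- C * (q - T))) \<le> exp (- \<Lambda> * (q - s)) * b i q" if q: "q \<in> {s..T}" for q
    proof -
      have "- L * (m * exp (C * (T - q))) \<le> b i q"
        using coop[of "m * exp (C * (T - q))" q i] lower[of _ q] m x q by auto
      moreover have "C * (T - q) = - C * (q - T)" by (simp add: algebra_simps)
      ultimately have "- (L * (m * exp (- C * (q - T)))) * exp (- \<Lambda> * (q - s)) \<le> b i q * exp (- \<Lambda> * (q - s))"
        by (intro mult_right_mono) auto
      moreover have "L * (m * exp (- C * (q - T))) * exp (- \<Lambda> * (q - s)) \<le> L * (m * exp (- C * (q - T))) * 1"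
        using L m \<Lambda> q by (intro mult_left_mono) auto
      ultimately show ?thesis by (simp add: C_def algebra_simps)
    qed
    have "(m/2) * (1 - exp (- C * (s - T))) = (LBINT q:{s..T}. (m/2) * (- C * exp (- C * (q - T))))"
      using x(3) set_integral_exp[of s T "- C" T] by (subst set_integral_mult_right) auto
    also have "\<dots> \<le> (LBINT q:{s..T}. exp (- \<Lambda> * (q - s)) * b i q)"
    proof (rule set_integral_mono)
      show "set_integrable lborel {s..T} (\<lambda>q. (m/2) * (- C * exp (- C * (q - T))))"
        by (rule borel_integrable_atLeastAtMost') (intro continuous_intros)
    qed (use pt int x in auto)
    also have "\<dots> \<le> y i s" using mild x by simp
    finally have "- y i s \<le> (m/2) * (exp (- C * (s - T)) - 1)" by (simp add: algebra_simps)
    also have "\<dots> = (m/2) * (exp (C * (T - s)) - 1)" by (simp add: algebra_simps)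
    also have "\<dots> \<le> (m/2) * exp (C * (T - s))" using m by (intro mult_left_mono) auto
    finally have "- y i s * exp (- C * (T - s)) \<le> (m/2) * exp (C * (T - s)) * exp (- C * (T - s))"
      by (intro mult_right_mono) auto
    then show "f x \<le> 1 / 2 * m" by (simp add: x f_def mult.assoc exp_add[symmetric])
  qed (use i s in \<open>auto simp: X_def\<close>)
  then show ?thesis by (simp add: f_def zero_le_mult_iff)
qed

section \<open>The Hamilton-Jacobi-Bellman equation\<close>

text \<open>
  The minimum over the feasible actions of the cost rate plus the generator applied to \<open>w\<close>. The
  expression minimised is affine in the action with slope \<open>e q - (w i - w (i - 1))\<close>, so the
  minimum is attained at \<open>0\<close> or at \<open>min i K\<close>; this is the positive part. The states above \<open>N\<close> get
  the boundary form of state \<open>N\<close>, which makes the equation meaningful on all of \<open>nat\<close>.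
\<close>

definition hjb_rhs :: "(real \<Rightarrow> real) \<Rightarrow> (real \<Rightarrow> real) \<Rightarrow> real \<Rightarrow> nat \<Rightarrow> nat \<Rightarrow> real \<Rightarrow> (nat \<Rightarrow> real) \<Rightarrow> nat \<Rightarrow> real" where
  "hjb_rhs lam e p N K q w i =
     (if N \<le> i then p * lam q else lam q * (w (Suc i) - w i))
       - real (min i K) * max 0 (w i - w (i - 1) - e q)"

text \<open>
  The difference quotient of the positive part lies between \<open>0\<close> and \<open>1\<close>. Unlike a Lipschitz
  estimate, this keeps the sign of the difference.
\<close>

lemma max_diff_factor:
  fixes x y :: real
  obtains a where "0 \<le> a" "a \<le> 1" "max 0 x - max 0 y = a * (x - y)"
proof (cases "x = y")
  case False
  show ?thesis
  proof (rule that[of "(max 0 x - max 0 y) / (x - y)"])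
  qed (use False in \<open>auto simp: divide_simps max_def\<close>)
qed (use that[of 0] in auto)

text \<open>
  If \<open>L\<close> dominates the total jump rate, the difference is a combination of the differences of \<open>w\<close>
  and \<open>w'\<close> at \<open>i\<close>, \<open>i + 1\<close> and \<open>i - 1\<close> with nonnegative coefficients. Their sum is \<open>L\<close>, and
  the kernel \<open>exp (- L * x)\<close> of the fixed point equation has a mass below \<open>1 / L\<close>.
\<close>

lemma hjb_rhs_lipschitz:
  assumes lam: "0 \<le> lam q" "lam q + real K \<le> L" and m: "\<And>j. \<bar>w j - w' j\<bar> \<le> m"
  shows "\<bar>(L * w i + hjb_rhs lam e p N K q w i) - (L * w' i + hjb_rhs lam e p N K q w' i)\<bar> \<le> L * m"
proof -
  define l where "l = (if N \<le> i then 0 else lam q)"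
  define k where "k = real (min i K)"
  define d where "d j = w j - w' j" for j
  obtain a where a: "0 \<le> a" "a \<le> 1"
    and eq: "max 0 (w i - w (i - 1) - e q) - max 0 (w' i - w' (i - 1) - e q)
             = a * ((w i - w (i - 1) - e q) - (w' i - w' (i - 1) - e q))"
    using max_diff_factor by blast
  have k: "0 \<le> k" "k \<le> real K" by (auto simp: k_def)
  have l: "0 \<le> l" "l \<le> lam q" using lam by (auto simp: l_def)
  have ka: "0 \<le> k * a" "k * a \<le> real K" using k a mult_mono[of k "real K" a 1] by auto
  have "(L * w i + hjb_rhs lam e p N K q w i) - (L * w' i + hjb_rhs lam e p N K q w' i)
      = L * d i + l * (d (Suc i) - d i) - k * (max 0 (w i - w (i - 1) - e q) - max 0 (w' i - w' (i - 1) - e q))"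
    unfolding hjb_rhs_def l_def k_def d_def by (simp add: algebra_simps)
  also have "\<dots> = (L - l - k * a) * d i + l * d (Suc i) + (k * a) * d (i - 1)"
    unfolding eq d_def by (simp add: algebra_simps)
  also have "\<bar>\<dots>\<bar> \<le> (L - l - k * a) * m + l * m + (k * a) * m"
  proof -
    have *: "\<bar>c * d j\<bar> \<le> c * m" if "0 \<le> c" for c j
      using that m[of j] by (auto simp: abs_mult d_def intro!: mult_left_mono)
    have "0 \<le> L - l - k * a" using l ka lam by linarith
    from *[OF this, of i] *[OF l(1), of "Suc i"] *[OF ka(1), of "i - 1"] show ?thesis by linarith
  qed
  also have "\<dots> = L * m" by (simp add: algebra_simps)
  finally show ?thesis .
qed

lemma hjb_rhs_bound:
  assumes lam: "0 \<le> lam q" "lam q + real K \<le> L" and e: "\<bar>e q\<bar> \<le> E" and m: "\<And>j. \<bar>w j\<bar> \<le> m"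
  shows "\<bar>hjb_rhs lam e p N K q w i\<bar> \<le> L * (\<bar>p\<bar> + 4 * m + E)"
proof -
  have L: "0 \<le> L" "real K \<le> L" "lam q \<le> L" using lam by auto
  have m0: "0 \<le> m" using m[of 0] by linarith
  have E0: "0 \<le> E" using e by linarith
  have "\<bar>if N \<le> i then p * lam q else lam q * (w (Suc i) - w i)\<bar> \<le> L * (\<bar>p\<bar> + 2 * m)"
  proof -
    have "\<bar>p * lam q\<bar> \<le> L * (\<bar>p\<bar> + 2 * m)"
      using lam L m0 mult_mono[of "lam q" L "\<bar>p\<bar>" "\<bar>p\<bar> + 2 * m"] by (simp add: abs_mult mult.commute)
    moreover have "\<bar>lam q * (w (Suc i) - w i)\<bar> \<le> L * (\<bar>p\<bar> + 2 * m)"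
      unfolding abs_mult using lam L m[of i] m[of "Suc i"] by (intro mult_mono) auto
    ultimately show ?thesis by simp
  qed
  moreover have "\<bar>real (min i K) * max 0 (w i - w (i - 1) - e q)\<bar> \<le> L * (2 * m + E)"
    unfolding abs_mult using L m[of i] m[of "i - 1"] e m0 E0 by (intro mult_mono) auto
  ultimately show ?thesis unfolding hjb_rhs_def distrib_left by linarith
qed

lemma borel_measurable_hjb_rhs [measurable (raw)]:
  assumes [measurable]: "lam \<in> borel_measurable borel" "e \<in> borel_measurable borel"
    "f \<in> borel_measurable M" "\<And>i. (\<lambda>x. w x i) \<in> borel_measurable M"
  shows "(\<lambda>x. hjb_rhs lam e p N K (f x) (w x) i) \<in> borel_measurable M"
  unfolding hjb_rhs_def by measurable

lemma continuous_on_discrete_snd: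
  fixes f :: "'a::topological_space \<times> 'b discrete \<Rightarrow> 'c::topological_space"
  assumes "\<And>i. continuous_on UNIV (\<lambda>s. f (s, i))"
  shows "continuous_on UNIV f"
proof -
  have "continuous_on (\<Union>i. UNIV \<times> {i}) f"
  proof (rule continuous_on_open_UN)
    fix i :: "'b discrete"
    show "open (UNIV \<times> {i} :: ('a \<times> 'b discrete) set)" by (rule open_Times[OF open_UNIV open_discrete])
    have "continuous_on (UNIV \<times> {i}) ((\<lambda>s. f (s, i)) \<circ> fst)"
      by (intro continuous_on_compose continuous_intros continuous_on_subset[OF assms]) auto
    then show "continuous_on (UNIV \<times> {i}) f"
      by (rule continuous_on_cong[THEN iffD1, rotated -1]) auto
  qed
  also have "(\<Union>i. UNIV \<times> {i}) = UNIV" by auto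
  finally show ?thesis .
qed

lemma continuous_on_mild_integral:
  fixes b :: "real \<Rightarrow> real"
  assumes [measurable]: "b \<in> borel_measurable borel" and B: "\<And>q. q \<in> {0..T} \<Longrightarrow> \<bar>b q\<bar> \<le> B" and T: "0 \<le> T"
    and L: "0 \<le> L"
  shows "continuous_on UNIV (\<lambda>s. LBINT q:{max 0 (min T s)..T}. exp (- L * (q - max 0 (min T s))) * b q)"
proof -
  \<comment> \<open>Splitting the kernel isolates the dependence on \<open>s\<close> in a factor and in the lower limit.\<close>
  define h where "h q = exp (- L * q) * b q" for q
  have hB: "\<bar>h q\<bar> \<le> B" if "q \<in> {0..T}" for q
  proof -
    have "exp (- L * q) * \<bar>b q\<bar> \<le> 1 * B" using that B[OF that] L by (intro mult_mono) auto
    then show ?thesis by (simp add: h_def abs_mult)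
  qed
  have hm: "h \<in> borel_measurable borel" unfolding h_def by measurable
  have int: "set_integrable lborel {s..T} h" if "0 \<le> s" for s
    using that by (intro bounded_borel_set_integrable[OF hm, where B=B] hB) auto
  have eq: "(LBINT q:{s..T}. exp (- L * (q - s)) * b q) = exp (L * s) * integral {s..T} h" if "0 \<le> s" for s
  proof -
    have "exp (- L * (q - s)) * b q = exp (L * s) * h q" for q
    proof -
      have "- L * (q - s) = L * s + - L * q" by (simp add: algebra_simps)
      then show ?thesis unfolding h_def by (simp only: exp_add mult.assoc)
    qed
    then show ?thesis
      using set_borel_integral_eq_integral(2)[OF int[OF that]] by simp
  qed
  have "continuous_on {0..T} (\<lambda>x. integral {x..T} h)"
    by (rule indefinite_integral_continuous_1') (use set_borel_integral_eq_integral(1)[OF int[of 0]] in simp)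
  then have "continuous_on UNIV (\<lambda>s. integral {max 0 (min T s)..T} h)"
    by (rule continuous_on_compose2[of _ "\<lambda>x. integral {x..T} h"]) (use T in \<open>auto intro!: continuous_intros\<close>)
  then have "continuous_on UNIV (\<lambda>s. exp (L * max 0 (min T s)) * integral {max 0 (min T s)..T} h)"
    by (intro continuous_intros)
  then show ?thesis by (subst eq) auto
qed

text \<open>
  Coefficients prescribed on \<open>{0..T}\<close> enter here after extension by zero to the whole line.
\<close>

locale bounded_rates =
  fixes T p Bl Be :: real and lam e :: "real \<Rightarrow> real"
  assumes T: "0 < T" and p: "0 \<le> p"
    and lam_measurable[measurable]: "lam \<in> borel_measurable borel"
    and e_measurable[measurable]: "e \<in> borel_measurable borel"
    and lam: "\<And>q. 0 \<le> lam q" "\<And>q. lam q \<le> Bl"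
    and e: "\<And>q. \<bar>e q\<bar> \<le> Be"
begin

text \<open>
  The equation \<open>- v' = hjb_rhs v\<close> with \<open>v = 0\<close> at time \<open>T\<close>, integrated with the integrating factor
  \<open>exp (- L * q)\<close>. The rate \<open>L\<close> is a free parameter, so that solutions for different numbers of
  units and servers can be compared through equations with the same kernel.
\<close>

definition hjb_solution :: "nat \<Rightarrow> nat \<Rightarrow> real \<Rightarrow> (real \<Rightarrow> nat \<Rightarrow> real) \<Rightarrow> bool" where
  "hjb_solution N K L v \<longleftrightarrow>
     (\<forall>i. continuous_on UNIV (\<lambda>s. v s i)) \<and> (\<exists>B. \<forall>s i. \<bar>v s i\<bar> \<le> B) \<and>
     (\<forall>s\<in>{0..T}. \<forall>i. v s i = (LBINT q:{s..T}. exp (- L * (q - s)) * (L * v q i + hjb_rhs lam e p N K q (v q) i)))"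

text \<open>
  Banach's fixed point theorem. Times and states are combined into one argument, the states with the
  discrete metric, so that all components together form one bounded continuous function; the
  sup norm contracts by the factor \<open>1 - exp (- L * T)\<close>.
\<close>

lemma hjb_solution_exists:
  assumes L: "0 < L" "Bl + real K \<le> L"
  shows "\<exists>v. hjb_solution N K L v"
proof -
  have lam': "0 \<le> lam q" "lam q + real K \<le> L" for q using lam[of q] L by auto
  \<comment> \<open>Bounded continuous functions live on the whole line, so times are clamped to \<open>{0..T}\<close>.\<close>
  define c where "c s = max 0 (min T s)" for s
  have c: "c s \<in> {0..T}" for s using T by (auto simp: c_def)
  define b where "b w i q = L * w (q, discrete i) + hjb_rhs lam e p N K q (\<lambda>j. w (q, discrete j)) i"
    for w :: "real \<times> nat discrete \<Rightarrow> real" and i q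
  define \<Phi> where "\<Phi> w = (\<lambda>(s, i). LBINT q:{c s..T}. exp (- L * (q - c s)) * b w (of_discrete i) q)"
    for w :: "real \<times> nat discrete \<Rightarrow> real"
  have wm[measurable]: "(\<lambda>q. apply_bcontfun w (q, discrete i)) \<in> borel_measurable borel" for w :: "(real \<times> nat discrete) \<Rightarrow>\<^sub>C real" and i
    by (intro borel_measurable_continuous_onI continuous_on_compose2[OF continuous_on_apply_bcontfun[of UNIV w]] continuous_intros) auto
  have bm[measurable]: "b (apply_bcontfun w) i \<in> borel_measurable borel" for w :: "(real \<times> nat discrete) \<Rightarrow>\<^sub>C real" and i
    unfolding b_def by measurable
  have bB: "\<bar>b (apply_bcontfun w) i q\<bar> \<le> L * norm w + L * (\<bar>p\<bar> + 4 * norm w + Be)" for w i q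
  proof -
    have "\<bar>L * w (q, discrete i)\<bar> \<le> L * norm w"
      using L norm_bounded[of w "(q, discrete i)"] by (auto simp: abs_mult intro!: mult_left_mono)
    moreover have "\<bar>hjb_rhs lam e p N K q (\<lambda>j. w (q, discrete j)) i\<bar> \<le> L * (\<bar>p\<bar> + 4 * norm w + Be)"
      using norm_bounded[of w] by (intro hjb_rhs_bound lam' e) auto
    ultimately show ?thesis unfolding b_def by linarith
  qed
  have int: "set_integrable lborel {c s..T} (\<lambda>q. exp (- L * (q - c s)) * b (apply_bcontfun w) i q)" for s w i
  proof (rule bounded_borel_set_integrable)
    fix q assume "q \<in> {c s..T}"
    then have "exp (- L * (q - c s)) * \<bar>b (apply_bcontfun w) i q\<bar> \<le> 1 * (L * norm w + L * (\<bar>p\<bar> + 4 * norm w + Be))"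
      using L bB by (intro mult_mono) auto
    then show "\<bar>exp (- L * (q - c s)) * b (apply_bcontfun w) i q\<bar> \<le> 1 * (L * norm w + L * (\<bar>p\<bar> + 4 * norm w + Be))"
      by (simp add: abs_mult)
  qed measurable
  have kernel: "(LBINT q:{c s..T}. exp (- L * (q - c s)) * (L * m)) = m * (1 - exp (- L * (T - c s)))" for s m
  proof -
    have "(LBINT q:{c s..T}. exp (- L * (q - c s)) * (L * m)) = (LBINT q:{c s..T}. - m * ((- L) * exp (- L * (q - c s))))"
      by (simp add: mult_ac)
    also have "\<dots> = - m * (LBINT q:{c s..T}. (- L) * exp (- L * (q - c s)))"
      by (rule set_integral_mult_right)
    also have "\<dots> = m * (1 - exp (- L * (T - c s)))"
      using c[of s] by (subst set_integral_exp) (auto simp: algebra_simps)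
    finally show ?thesis .
  qed
  have kint: "set_integrable lborel {c s..T} (\<lambda>q. exp (- L * (q - c s)) * m)" for s m
    by (rule borel_integrable_atLeastAtMost') (intro continuous_intros)
  have absint: "\<bar>LBINT q:{c s..T}. exp (- L * (q - c s)) * f q\<bar> \<le> m * (1 - exp (- L * (T - c s)))"
    if f: "\<And>q. \<bar>f q\<bar> \<le> L * m" "set_integrable lborel {c s..T} (\<lambda>q. exp (- L * (q - c s)) * f q)" for f s m
  proof -
    have le: "(LBINT q:{c s..T}. exp (- L * (q - c s)) * f q) \<le> (LBINT q:{c s..T}. exp (- L * (q - c s)) * (L * m))"
      using f(1) by (intro set_integral_mono f kint mult_left_mono) (auto simp: abs_le_iff)
    have "(LBINT q:{c s..T}. exp (- L * (q - c s)) * (L * (- m))) \<le> (LBINT q:{c s..T}. exp (- L * (q - c s)) * f q)"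
    proof (intro set_integral_mono f kint mult_left_mono)
      show "L * - m \<le> f q" for q using f(1)[of q] by (simp add: abs_le_iff)
    qed auto
    with le show ?thesis unfolding kernel by (simp add: abs_le_iff)
  qed
  have \<Phi>C: "\<Phi> (apply_bcontfun w) \<in> bcontfun" for w
  proof (rule bcontfun_normI)
    show "continuous_on UNIV (\<Phi> (apply_bcontfun w))"
      unfolding \<Phi>_def c_def
      by (rule continuous_on_discrete_snd, unfold split_conv, rule continuous_on_mild_integral[OF bm bB]) (use T L in auto)
    fix x :: "real \<times> nat discrete"
    obtain s i where x: "x = (s, i)" by fastforce
    define m where "m = norm w + (\<bar>p\<bar> + 4 * norm w + Be)"
    have "\<bar>\<Phi> (apply_bcontfun w) x\<bar> \<le> m * (1 - exp (- L * (T - c s)))"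
      unfolding x \<Phi>_def split_conv
      by (rule absint[OF _ int]) (use bB[of w "of_discrete i"] in \<open>simp add: m_def algebra_simps\<close>)
    also have "\<dots> \<le> m * 1"
      using e[of 0] by (intro mult_left_mono) (auto simp: m_def)
    finally show "norm (\<Phi> (apply_bcontfun w) x) \<le> m" by simp
  qed
  define \<Psi> where "\<Psi> w = Bcontfun (\<Phi> (apply_bcontfun w))" for w
  have \<Psi>: "apply_bcontfun (\<Psi> w) = \<Phi> (apply_bcontfun w)" for w
    unfolding \<Psi>_def using \<Phi>C by (simp add: Bcontfun_inverse)
  have contr: "dist (\<Psi> w) (\<Psi> w') \<le> (1 - exp (- L * T)) * dist w w'" for w w'
  proof (rule dist_bound)
    fix x :: "real \<times> nat discrete"
    obtain s i where x: "x = (s, i)" by fastforce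
    have "\<Psi> w x - \<Psi> w' x = (LBINT q:{c s..T}. exp (- L * (q - c s)) * (b w (of_discrete i) q - b w' (of_discrete i) q))"
      unfolding \<Psi> \<Phi>_def x split_conv by (subst set_integral_diff(2)[symmetric, OF int int]) (simp add: right_diff_distrib)
    also have "\<bar>\<dots>\<bar> \<le> dist w w' * (1 - exp (- L * (T - c s)))"
    proof (rule absint)
      show "\<bar>b w (of_discrete i) q - b w' (of_discrete i) q\<bar> \<le> L * dist w w'" for q
        unfolding b_def using dist_bounded[of w _ w'] by (intro hjb_rhs_lipschitz lam') (simp add: dist_real_def)
      show "set_integrable lborel {c s..T} (\<lambda>q. exp (- L * (q - c s)) * (b w (of_discrete i) q - b w' (of_discrete i) q))"
        using set_integral_diff(1)[OF int[of s w "of_discrete i"] int[of s w' "of_discrete i"]] by (simp add: right_diff_distrib)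
    qed
    also have "\<dots> \<le> dist w w' * (1 - exp (- L * T))"
      using c[of s] L by (intro mult_left_mono) auto
    finally show "dist (\<Psi> w x) (\<Psi> w' x) \<le> (1 - exp (- L * T)) * dist w w'"
      by (simp add: dist_real_def mult.commute)
  qed
  obtain w where w: "\<Psi> w = w"
    using banach_fix_type[of "1 - exp (- L * T)" \<Psi>] contr L T by auto
  show ?thesis
  proof (intro exI[of _ "\<lambda>s i. apply_bcontfun w (s, discrete i)"], unfold hjb_solution_def, intro conjI allI ballI)
    show "continuous_on UNIV (\<lambda>s. w (s, discrete i))" for i
      by (intro continuous_on_compose2[OF continuous_on_apply_bcontfun[of UNIV w]] continuous_intros) auto
    show "\<exists>B. \<forall>s i. \<bar>w (s, discrete i)\<bar> \<le> B" using norm_bounded[of w] by (metis real_norm_def)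
    fix s i assume "s \<in> {0..T}"
    then have "c s = s" by (auto simp: c_def)
    then show "w (s, discrete i) = (LBINT q:{s..T}. exp (- L * (q - s)) * (L * w (q, discrete i) + hjb_rhs lam e p N K q (\<lambda>j. w (q, discrete j)) i))"
      using \<Psi>[of w, unfolded w, THEN fun_cong, of "(s, discrete i)"] unfolding \<Phi>_def b_def by (simp add: discrete_inverse)
  qed
qed

end

section \<open>Shape and monotonicity of the marginal values\<close>

text \<open>
  The function \<open>\<lambda>x. c * x - k * max 0 (x - e)\<close> has the slopes \<open>c\<close> and \<open>c - k\<close>, so it is nondecreasing
  and grows by at most \<open>c * m\<close> on an interval of length \<open>m\<close>.
\<close>

lemma thinned_mono_shift:
  fixes x y :: real
  assumes "0 \<le> k" "k \<le> c" "0 \<le> m" "x \<le> y + m"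
  shows "c * x - k * max 0 (x - e) \<le> c * y - k * max 0 (y - e) + c * m"
proof -
  have "c * x - k * max 0 (x - e) \<le> c * (y + m) - k * max 0 (y + m - e)"
  proof -
    obtain a where a: "0 \<le> a" "a \<le> 1" "max 0 (y + m - e) - max 0 (x - e) = a * ((y + m - e) - (x - e))"
      using max_diff_factor by blast
    have "k * a \<le> c" using mult_mono[of k c a 1] assms a by auto
    then have "k * a * (y + m - x) \<le> c * (y + m - x)" using assms by (intro mult_right_mono) auto
    moreover have "k * (max 0 (y + m - e) - max 0 (x - e)) = k * a * (y + m - x)" using a(3) by simp
    ultimately show ?thesis by (simp add: algebra_simps)
  qed
  moreover have "k * max 0 (y - e) \<le> k * max 0 (y + m - e)"
    using assms by (intro mult_left_mono) auto
  ultimately show ?thesis by (simp add: algebra_simps)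
qed

context bounded_rates
begin

lemma hjb_solutionD:
  assumes "hjb_solution N K L v"
  shows hjb_solution_measurable: "(\<lambda>s. v s i) \<in> borel_measurable borel"
    and hjb_solution_bounded: "\<exists>B. \<forall>s i. \<bar>v s i\<bar> \<le> B"
    and hjb_solution_mild: "s \<in> {0..T} \<Longrightarrow>
      v s i = (LBINT q:{s..T}. exp (- L * (q - s)) * (L * v q i + hjb_rhs lam e p N K q (v q) i))"
  using assms by (auto simp: hjb_solution_def intro: borel_measurable_continuous_onI)

lemma hjb_rhs_solution_bounded:
  assumes v: "hjb_solution N K L v" and L: "Bl + real K \<le> L"
  shows "\<exists>B. \<forall>q i. \<bar>hjb_rhs lam e p N K q (v q) i\<bar> \<le> B"
proof -
  obtain B where B: "\<And>s i. \<bar>v s i\<bar> \<le> B" using hjb_solution_bounded[OF v] by auto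
  have "\<bar>hjb_rhs lam e p N K q (v q) i\<bar> \<le> L * (\<bar>p\<bar> + 4 * B + Be)" for q i
    using lam(2)[of q] L by (intro hjb_rhs_bound lam e B) auto
  then show ?thesis by blast
qed

lemma hjb_solution_mild_integrable:
  assumes v: "hjb_solution N K L v" and L: "0 < L" "Bl + real K \<le> L"
  shows "set_integrable lborel {s..T} (\<lambda>q. exp (- L * (q - s)) * (L * v q i + hjb_rhs lam e p N K q (v q) i))"
proof -
  note [measurable] = hjb_solution_measurable[OF v]
  obtain B where B: "\<And>s i. \<bar>v s i\<bar> \<le> B" using hjb_solution_bounded[OF v] by auto
  obtain B' where B': "\<And>s i. \<bar>hjb_rhs lam e p N K s (v s) i\<bar> \<le> B'" using hjb_rhs_solution_bounded[OF v L(2)] by auto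
  show ?thesis
  proof (rule bounded_borel_set_integrable[where B="1 * (L * B + B')"])
    fix q assume q: "q \<in> {s..T}"
    have "\<bar>L * v q i\<bar> \<le> L * B" using B[of q i] L by (simp add: abs_mult)
    then have "\<bar>L * v q i + hjb_rhs lam e p N K q (v q) i\<bar> \<le> L * B + B'"
      using B'[of q i] by linarith
    then show "\<bar>exp (- L * (q - s)) * (L * v q i + hjb_rhs lam e p N K q (v q) i)\<bar> \<le> 1 * (L * B + B')"
      unfolding abs_mult using q L by (intro mult_mono) auto
  qed measurable
qed

lemma hjb_solution_integral_eq:
  assumes v: "hjb_solution N K L v" and L: "0 < L" "Bl + real K \<le> L" and s: "s \<in> {0..T}"
  shows "v s i = (LBINT q:{s..T}. hjb_rhs lam e p N K q (v q) i)"
proof -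
  note [measurable] = hjb_solution_measurable[OF v]
  obtain B where B: "\<And>s i. \<bar>v s i\<bar> \<le> B" using hjb_solution_bounded[OF v] by auto
  obtain B' where B': "\<And>s i. \<bar>hjb_rhs lam e p N K s (v s) i\<bar> \<le> B'" using hjb_rhs_solution_bounded[OF v L(2)] by auto
  have "v s i = (LBINT q:{s..T}. (L * v q i + hjb_rhs lam e p N K q (v q) i) - L * v q i)"
  proof (rule mild_to_integral_equation[where B="L * B + B'" and Y=B])
    show "\<bar>L * v q i + hjb_rhs lam e p N K q (v q) i\<bar> \<le> L * B + B'" for q
    proof -
      have "\<bar>L * v q i\<bar> \<le> L * B" using B[of q i] L by (simp add: abs_mult)
      with B'[of q i] show ?thesis by linarith
    qed
    show "v r i = (LBINT q:{r..T}. exp (- L * (q - r)) * (L * v q i + hjb_rhs lam e p N K q (v q) i))" if "r \<in> {s..T}" for r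
      using that s by (intro hjb_solution_mild[OF v]) auto
  qed (use B L s in auto)
  then show ?thesis by simp
qed

text \<open>
  The value \<open>p\<close> beyond \<open>N\<close> is the boundary condition: an arrival in state \<open>N\<close> costs \<open>p\<close>, as if the
  state moved to \<open>N + 1\<close> at this price.
\<close>

definition marginals :: "nat \<Rightarrow> (nat \<Rightarrow> real) \<Rightarrow> nat \<Rightarrow> real" where
  "marginals N w i = (if N < i then p else w i - w (i - 1))"

text \<open>
  The integrand of the mild equation for the increments \<open>z\<close>. It is nondecreasing in \<open>z (Suc i)\<close> and
  \<open>z (i - 1)\<close>, and, once \<open>L\<close> dominates \<open>lam q + K\<close>, also in \<open>z i\<close>.
\<close>

definition marginal_drift :: "real \<Rightarrow> nat \<Rightarrow> real \<Rightarrow> (nat \<Rightarrow> real) \<Rightarrow> nat \<Rightarrow> real" where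
  "marginal_drift L K q z i =
     (L - lam q) * z i - real (min i K) * max 0 (z i - e q)
       + lam q * z (Suc i) + real (min (i - 1) K) * max 0 (z (i - 1) - e q)"

lemma hjb_rhs_diff_marginals:
  assumes "1 \<le> i" "i \<le> N"
  shows "(L * w i + hjb_rhs lam e p N K q w i) - (L * w (i - 1) + hjb_rhs lam e p N K q w (i - 1))
    = marginal_drift L K q (marginals N w) i"
proof -
  obtain j where j: "i = Suc j" using assms by (cases i) auto
  consider "j = 0" | "j > 0" by auto
  then show ?thesis
    using assms unfolding j hjb_rhs_def marginal_drift_def marginals_def
    by cases (auto simp: algebra_simps)
qed

lemma marginals_mild:
  assumes v: "hjb_solution N K L v" and L: "0 < L" "Bl + real K \<le> L" and i: "1 \<le> i" "i \<le> N"
  shows marginals_mild_integrable: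
      "set_integrable lborel {s..T} (\<lambda>q. exp (- L * (q - s)) * marginal_drift L K q (marginals N (v q)) i)"
    and marginals_mild_eq: "s \<in> {0..T} \<Longrightarrow> marginals N (v s) i
      = (LBINT q:{s..T}. exp (- L * (q - s)) * marginal_drift L K q (marginals N (v q)) i)"
proof -
  have eq: "exp (- L * (q - s)) * marginal_drift L K q (marginals N (v q)) i =
     exp (- L * (q - s)) * (L * v q i + hjb_rhs lam e p N K q (v q) i) -
     exp (- L * (q - s)) * (L * v q (i - 1) + hjb_rhs lam e p N K q (v q) (i - 1))" for q s
    unfolding hjb_rhs_diff_marginals[OF i, symmetric] by (simp add: algebra_simps)
  note int = hjb_solution_mild_integrable[OF v L]
  show "set_integrable lborel {s..T} (\<lambda>q. exp (- L * (q - s)) * marginal_drift L K q (marginals N (v q)) i)"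
    unfolding eq by (intro set_integral_diff int)
  show "marginals N (v s) i
      = (LBINT q:{s..T}. exp (- L * (q - s)) * marginal_drift L K q (marginals N (v q)) i)" if "s \<in> {0..T}"
    unfolding eq set_integral_diff(2)[OF int int]
    using i hjb_solution_mild[OF v that] by (simp add: marginals_def)
qed

lemma marginals_bounded:
  assumes v: "hjb_solution N K L v"
  shows "\<exists>B. \<forall>s i. \<bar>marginals N (v s) i\<bar> \<le> B"
proof -
  obtain B where B: "\<And>s i. \<bar>v s i\<bar> \<le> B" using hjb_solution_bounded[OF v] by auto
  have "\<bar>marginals N (v s) i\<bar> \<le> 2 * B + p" for s i
    using B[of s i] B[of s "i - 1"] p by (auto simp: marginals_def)
  then show ?thesis by blast
qed

text \<open>
  The neighbour \<open>i - 1\<close> matters only if \<open>1 < i\<close>: for \<open>i = 1\<close> its coefficient \<open>min (i - 1) K\<close> is \<open>0\<close>, so the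
  system of increments is closed on the indices from \<open>1\<close> on.
\<close>

lemma marginal_drift_mono_shift:
  assumes L: "Bl + real K \<le> L" and m: "0 \<le> m"
    and le: "z i \<le> z' i + m" "z (Suc i) \<le> z' (Suc i) + m" "1 < i \<Longrightarrow> z (i - 1) \<le> z' (i - 1) + m"
  shows "marginal_drift L K q z i \<le> marginal_drift L K q z' i + (L + real K) * m"
proof -
  have k: "real (min i K) \<le> L - lam q" using lam(2)[of q] L by auto
  have "(L - lam q) * z i - real (min i K) * max 0 (z i - e q)
      \<le> (L - lam q) * z' i - real (min i K) * max 0 (z' i - e q) + (L - lam q) * m"
    by (rule thinned_mono_shift) (use k m le in auto)
  moreover have "lam q * z (Suc i) \<le> lam q * (z' (Suc i) + m)"
    using le lam by (intro mult_left_mono) auto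
  moreover have "real (min (i - 1) K) * max 0 (z (i - 1) - e q)
     \<le> real (min (i - 1) K) * max 0 (z' (i - 1) - e q) + real K * m"
  proof (cases "1 < i")
    case True
    have "real (min (i - 1) K) * max 0 (z (i - 1) - e q) \<le> real (min (i - 1) K) * (max 0 (z' (i - 1) - e q) + m)"
      using le(3)[OF True] m by (intro mult_left_mono) auto
    moreover have "real (min (i - 1) K) * m \<le> real K * m" using m by (intro mult_right_mono) auto
    ultimately show ?thesis by (simp add: algebra_simps)
  next
    case False
    then have "min (i - 1) K = 0" by auto
    then show ?thesis using m by simp
  qed
  ultimately show ?thesis unfolding marginal_drift_def by (simp add: algebra_simps)
qed

text \<open>
  The constant \<open>p\<close> is a supersolution because \<open>min i K\<close> is nondecreasing in \<open>i\<close>.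
\<close>

lemma marginals_le_penalty:
  assumes v: "hjb_solution N K L v" and L: "0 < L" "Bl + real K \<le> L" and i: "1 \<le> i" and s: "s \<in> {0..T}"
  shows "marginals N (v s) i \<le> p"
proof (cases "i \<le> N")
  case True
  obtain B where B: "\<And>s i. \<bar>marginals N (v s) i\<bar> \<le> B" using marginals_bounded[OF v] by auto
  have kint: "set_integrable lborel {s..T} (\<lambda>q. exp (- L * (q - s)) * (L * p))" for s
    by (rule borel_integrable_atLeastAtMost') (intro continuous_intros)
  have "0 \<le> p - marginals N (v s) i"
  proof (rule mild_comparison[where J="{1..N}" and \<Lambda>=L and L="L + real K" and Y="B" and T=T
        and y="\<lambda>i s. p - marginals N (v s) i"
        and b="\<lambda>i q. L * p - marginal_drift L K q (marginals N (v q)) i"])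
    fix i s assume i: "i \<in> {1..N}" and s: "s \<in> {0..T}"
    then have i': "1 \<le> i" "i \<le> N" by auto
    note int = marginals_mild_integrable[OF v L i', of s]
    show "set_integrable lborel {s..T} (\<lambda>q. exp (- L * (q - s)) * (L * p - marginal_drift L K q (marginals N (v q)) i))"
      using set_integral_diff(1)[OF kint[of s] int] by (simp add: right_diff_distrib)
    have "(LBINT q:{s..T}. exp (- L * (q - s)) * (L * p)) = (LBINT q:{s..T}. - p * ((- L) * exp (- L * (q - s))))"
      by (simp add: mult_ac)
    also have "\<dots> = - p * (LBINT q:{s..T}. (- L) * exp (- L * (q - s)))"
      by (rule set_integral_mult_right)
    also have "\<dots> = p * (1 - exp (- L * (T - s)))"
      using s by (subst set_integral_exp) (auto simp: algebra_simps)
    also have "\<dots> \<le> p * 1" using p by (intro mult_left_mono) auto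
    finally have "(LBINT q:{s..T}. exp (- L * (q - s)) * (L * p)) \<le> p" by simp
    moreover have "(LBINT q:{s..T}. exp (- L * (q - s)) * (L * p - marginal_drift L K q (marginals N (v q)) i))
      = (LBINT q:{s..T}. exp (- L * (q - s)) * (L * p)) - marginals N (v s) i"
      unfolding marginals_mild_eq[OF v L i' s] right_diff_distrib[of "exp x" for x] by (rule set_integral_diff(2)[OF kint int])
    ultimately show "(LBINT q:{s..T}. exp (- L * (q - s)) * (L * p - marginal_drift L K q (marginals N (v q)) i))
      \<le> p - marginals N (v s) i" by simp
    show "- B \<le> p - marginals N (v s) i" using B[of s i] p by linarith
  next
    fix m i q assume m: "0 \<le> m" and i: "i \<in> {1..N}"
      and le: "\<And>j. j \<in> {1..N} \<Longrightarrow> - m \<le> p - marginals N (v q) j"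
    have le': "marginals N (v q) j \<le> p + m" if "1 \<le> j" for j
    proof (cases "j \<le> N")
      case True
      then show ?thesis using le[of j] that by auto
    qed (use m in \<open>simp add: marginals_def\<close>)
    have "marginal_drift L K q (marginals N (v q)) i \<le> marginal_drift L K q (\<lambda>_. p) i + (L + real K) * m"
      by (rule marginal_drift_mono_shift) (use L m le' i in auto)
    also have "marginal_drift L K q (\<lambda>_. p) i \<le> L * p"
    proof -
      have "real (min (i - 1) K) * max 0 (p - e q) \<le> real (min i K) * max 0 (p - e q)"
        by (intro mult_right_mono) auto
      then show ?thesis unfolding marginal_drift_def by (simp add: algebra_simps)
    qed
    finally show "- (L + real K) * m \<le> L * p - marginal_drift L K q (marginals N (v q)) i"
      by (simp add: algebra_simps)
  qed (use L True i s in auto)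
  then show ?thesis by simp
qed (simp add: marginals_def)

text \<open>
  Convexity of the value function in the state. With \<open>g j = (z j - e)\<^sup>+\<close> and \<open>k j = min j K\<close>, the
  right-hand side for the difference \<open>z (i + 1) - z i\<close> contains
  \<open>- k (i + 1) * (g (i + 1) - g i) + k (i - 1) * (g i - g (i - 1)) + (2 * k i - k (i + 1) - k (i - 1)) * g i\<close>.
  The first two terms fit a cooperative system for the differences and the last one is nonnegative
  because \<open>k\<close> is concave. The last difference is controlled by \<open>marginals_le_penalty\<close>.
\<close>

lemma marginals_mono:
  assumes v: "hjb_solution N K L v" and L: "0 < L" "Bl + real K \<le> L" and i: "1 \<le> i" and s: "s \<in> {0..T}"
  shows "marginals N (v s) i \<le> marginals N (v s) (Suc i)"
proof (cases "i < N")
  case True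
  obtain B where B: "\<And>s i. \<bar>marginals N (v s) i\<bar> \<le> B" using marginals_bounded[OF v] by auto
  define z where "z q = marginals N (v q)" for q
  have "0 \<le> z s (Suc i) - z s i"
  proof (rule mild_comparison[where J="{1..<N}" and \<Lambda>=L and L="L + real K" and Y="2 * B" and T=T
        and y="\<lambda>i s. z s (Suc i) - z s i"
        and b="\<lambda>i q. marginal_drift L K q (z q) (Suc i) - marginal_drift L K q (z q) i"])
    fix i s assume i: "i \<in> {1..<N}" and s: "s \<in> {0..T}"
    then have i': "1 \<le> i" "i \<le> N" "1 \<le> Suc i" "Suc i \<le> N" by auto
    note int = marginals_mild_integrable[OF v L, of _ s, folded z_def]
    show "set_integrable lborel {s..T} (\<lambda>q. exp (- L * (q - s)) * (marginal_drift L K q (z q) (Suc i) - marginal_drift L K q (z q) i))"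
      unfolding right_diff_distrib[of "exp x" for x] by (intro set_integral_diff(1) int i')
    show "(LBINT q:{s..T}. exp (- L * (q - s)) * (marginal_drift L K q (z q) (Suc i) - marginal_drift L K q (z q) i))
      \<le> z s (Suc i) - z s i"
      unfolding right_diff_distrib[of "exp x" for x] set_integral_diff(2)[OF int[OF i'(3,4)] int[OF i'(1,2)]]
      using marginals_mild_eq[OF v L i'(1,2) s] marginals_mild_eq[OF v L i'(3,4) s] by (simp add: z_def)
    show "- (2 * B) \<le> z s (Suc i) - z s i" using B[of s i] B[of s "Suc i"] unfolding z_def by linarith
  next
    fix m i q assume m: "0 \<le> m" and i: "i \<in> {1..<N}" and q: "q \<in> {0..T}"
      and le: "\<And>j. j \<in> {1..<N} \<Longrightarrow> - m \<le> z q (Suc j) - z q j"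
    have le': "z q j \<le> z q (Suc j) + m" if "1 \<le> j" "j \<le> N" for j
    proof (cases "j < N")
      case True
      then show ?thesis using le[of j] that by auto
    next
      case False
      then have "z q (Suc j) = p" using that by (simp add: marginals_def z_def)
      then show ?thesis using marginals_le_penalty[OF v L that(1) q] m by (simp add: z_def)
    qed
    define g where "g j = max 0 (z q j - e q)" for j
    define k where "k j = real (min j K)" for j
    have k1: "k (Suc i) \<le> L - lam q" using lam(2)[of q] L by (auto simp: k_def)
    \<comment> \<open>Both sides carry the coefficient \<open>k (Suc i)\<close>; the mismatch with \<open>k i\<close> goes into the concavity term \<open>4\<close>.\<close>
    have 1: "(L - lam q) * z q i - k (Suc i) * g i \<le> (L - lam q) * z q (Suc i) - k (Suc i) * g (Suc i) + (L - lam q) * m"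
      unfolding g_def by (rule thinned_mono_shift) (use k1 m le'[of i] i in \<open>auto simp: k_def\<close>)
    have 2: "lam q * z q (Suc i) \<le> lam q * (z q (Suc (Suc i)) + m)"
      using le'[of "Suc i"] lam i by (intro mult_left_mono) auto
    have 3: "k (i - 1) * g (i - 1) \<le> k (i - 1) * g i + real K * m"
    proof (cases "1 < i")
      case True
      then have "Suc (i - 1) = i" by simp
      then have "z q (i - 1) \<le> z q i + m" using le'[of "i - 1"] i True by auto
      then have "k (i - 1) * g (i - 1) \<le> k (i - 1) * (g i + m)"
        using m by (intro mult_left_mono) (auto simp: g_def k_def)
      moreover have "k (i - 1) * m \<le> real K * m" using m by (intro mult_right_mono) (auto simp: k_def)
      ultimately show ?thesis by (simp add: algebra_simps)
    next
      case False
      then have "k (i - 1) = 0" by (auto simp: k_def)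
      then show ?thesis using m by simp
    qed
    have "k (Suc i) + k (i - 1) \<le> 2 * k i" using i by (auto simp: k_def min_def)
    then have 4: "(k (Suc i) + k (i - 1)) * g i \<le> (2 * k i) * g i"
      by (intro mult_right_mono) (auto simp: g_def)
    have "marginal_drift L K q (z q) (Suc i) - marginal_drift L K q (z q) i =
      ((L - lam q) * z q (Suc i) - k (Suc i) * g (Suc i) + lam q * z q (Suc (Suc i)) + k i * g i)
      - ((L - lam q) * z q i - k i * g i + lam q * z q (Suc i) + k (i - 1) * g (i - 1))"
      unfolding marginal_drift_def g_def k_def by simp
    with 1 2 3 4 show "- (L + real K) * m \<le> marginal_drift L K q (z q) (Suc i) - marginal_drift L K q (z q) i"
      by (simp add: algebra_simps)
  qed (use L True i s in auto)
  then show ?thesis by (simp add: z_def)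
next
  case False
  then have "marginals N (v s) (Suc i) = p" by (simp add: marginals_def)
  then show ?thesis using marginals_le_penalty[OF v L i s] by simp
qed

text \<open>
  The hypothesis \<open>dom\<close> makes the increments of \<open>v\<close> a supersolution of the system solved by the
  increments of \<open>v'\<close> on the indices up to \<open>N\<close>. At the boundary index \<open>N + 1\<close> the former have the value
  \<open>p\<close>, which no increment exceeds.
\<close>

lemma marginals_compare:
  assumes v: "hjb_solution N K L v" and L: "0 < L" "Bl + real K \<le> L"
    and v': "hjb_solution N' K' L v'" and L': "Bl + real K' \<le> L" and N: "N \<le> N'"
    and dom: "\<And>q i. q \<in> {0..T} \<Longrightarrow> 1 \<le> i \<Longrightarrow>
      marginal_drift L K' q (marginals N (v q)) i \<le> marginal_drift L K q (marginals N (v q)) i"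
    and i: "1 \<le> i" and s: "s \<in> {0..T}"
  shows "marginals N' (v' s) i \<le> marginals N (v s) i"
proof (cases "i \<le> N")
  case True
  obtain B where B: "\<And>s i. \<bar>marginals N (v s) i\<bar> \<le> B" using marginals_bounded[OF v] by auto
  obtain B' where B': "\<And>s i. \<bar>marginals N' (v' s) i\<bar> \<le> B'" using marginals_bounded[OF v'] by auto
  define z where "z q = marginals N (v q)" for q
  define z' where "z' q = marginals N' (v' q)" for q
  have "0 \<le> z s i - z' s i"
  proof (rule mild_comparison[where J="{1..N}" and \<Lambda>=L and L="L + real K'" and Y="B + B'" and T=T
        and y="\<lambda>i s. z s i - z' s i"
        and b="\<lambda>i q. marginal_drift L K q (z q) i - marginal_drift L K' q (z' q) i"])
    fix i s assume i: "i \<in> {1..N}" and s: "s \<in> {0..T}"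
    then have i': "1 \<le> i" "i \<le> N" "i \<le> N'" using N by auto
    note int = marginals_mild_integrable[OF v L i'(1,2), of s, folded z_def]
    note int' = marginals_mild_integrable[OF v' L(1) L' i'(1,3), of s, folded z'_def]
    show "set_integrable lborel {s..T} (\<lambda>q. exp (- L * (q - s)) * (marginal_drift L K q (z q) i - marginal_drift L K' q (z' q) i))"
      unfolding right_diff_distrib[of "exp x" for x] by (intro set_integral_diff(1) int int')
    show "(LBINT q:{s..T}. exp (- L * (q - s)) * (marginal_drift L K q (z q) i - marginal_drift L K' q (z' q) i))
      \<le> z s i - z' s i"
      unfolding right_diff_distrib[of "exp x" for x] set_integral_diff(2)[OF int int']
      using marginals_mild_eq[OF v L i'(1,2) s] marginals_mild_eq[OF v' L(1) L' i'(1,3) s] by (simp add: z_def z'_def)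
    show "- (B + B') \<le> z s i - z' s i" using B[of s i] B'[of s i] unfolding z_def z'_def by linarith
  next
    fix m i q assume m: "0 \<le> m" and i: "i \<in> {1..N}" and q: "q \<in> {0..T}"
      and le: "\<And>j. j \<in> {1..N} \<Longrightarrow> - m \<le> z q j - z' q j"
    have le': "z' q j \<le> z q j + m" if "1 \<le> j" for j
    proof (cases "j \<le> N")
      case True
      then show ?thesis using le[of j] that by auto
    next
      case False
      then have "z q j = p" by (simp add: marginals_def z_def)
      then show ?thesis using marginals_le_penalty[OF v' L(1) L' that q] m by (simp add: z'_def)
    qed
    have "marginal_drift L K' q (z' q) i \<le> marginal_drift L K' q (z q) i + (L + real K') * m"
      by (rule marginal_drift_mono_shift) (use L' m le' i in auto)
    also have "marginal_drift L K' q (z q) i \<le> marginal_drift L K q (z q) i"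
      using dom[OF q, of i] i by (simp add: z_def)
    finally show "- (L + real K') * m \<le> marginal_drift L K q (z q) i - marginal_drift L K' q (z' q) i"
      by (simp add: algebra_simps)
  qed (use L True i s in auto)
  then show ?thesis by (simp add: z_def z'_def)
next
  case False
  then have "marginals N (v s) i = p" by (simp add: marginals_def)
  then show ?thesis using marginals_le_penalty[OF v' L(1) L' i s] by simp
qed

lemma marginals_antimono_units:
  assumes v: "hjb_solution N K L v" and v': "hjb_solution (Suc N) K L v'"
    and L: "0 < L" "Bl + real K \<le> L" and "1 \<le> i" "s \<in> {0..T}"
  shows "marginals (Suc N) (v' s) i \<le> marginals N (v s) i"
  using assms by (intro marginals_compare[OF v L v' L(2)]) auto

text \<open>
  An additional server changes the coefficients \<open>min j K\<close> only for \<open>j > K\<close>. If this affects both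
  \<open>i - 1\<close> and \<open>i\<close>, the two changes of the drift have opposite signs and convexity decides which one
  prevails; if it affects only \<open>i\<close>, the drift cannot increase anyway.
\<close>

lemma marginals_antimono_servers:
  assumes v: "hjb_solution N K L v" and v': "hjb_solution N (Suc K) L v'"
    and L: "0 < L" "Bl + real (Suc K) \<le> L" and i: "1 \<le> i" "s \<in> {0..T}"
  shows "marginals N (v' s) i \<le> marginals N (v s) i"
proof (rule marginals_compare[OF v L(1) _ v' L(2) order_refl _ i])
  show L': "Bl + real K \<le> L" using L by simp
  fix q and i :: nat assume q: "q \<in> {0..T}" and i: "1 \<le> i"
  define z where "z = marginals N (v q)"
  show "marginal_drift L (Suc K) q (marginals N (v q)) i \<le> marginal_drift L K q (marginals N (v q)) i"
  proof (cases "Suc K \<le> i - 1")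
    case True
    then have "z (i - 1) \<le> z i"
      using marginals_mono[OF v L(1) L' _ q, of "i - 1"] by (simp add: z_def)
    then have "max 0 (z (i - 1) - e q) \<le> max 0 (z i - e q)" by auto
    with True i show ?thesis unfolding z_def[symmetric] marginal_drift_def by (auto simp: min_def algebra_simps)
  next
    case False
    then have "min (i - 1) (Suc K) = min (i - 1) K" by auto
    moreover have "real (min i K) * max 0 (z i - e q) \<le> real (min i (Suc K)) * max 0 (z i - e q)"
      by (intro mult_right_mono) auto
    ultimately show ?thesis unfolding z_def[symmetric] marginal_drift_def by simp
  qed
qed

end

section \<open>Verification: the Hamilton-Jacobi-Bellman solution bounds every cost\<close>

text \<open>
  The process is approximated by its value at the next grid point strictly to the right, or at the
  end point \<open>s\<close>. The grid times take countably many values, and in a discrete space convergence from the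
  right means that the approximations are eventually equal to the limit.
\<close>

lemma right_continuous_jointly_measurable:
  fixes X :: "real \<Rightarrow> 'w \<Rightarrow> nat"
  assumes ts: "t \<le> s"
    and adapted: "\<And>r. r \<in> {t..s} \<Longrightarrow> X r \<in> F \<rightarrow>\<^sub>M count_space UNIV"
    and rc: "\<And>\<omega> r. \<omega> \<in> space F \<Longrightarrow> r \<in> {t..<s} \<Longrightarrow> continuous (at_right r) (\<lambda>r. X r \<omega>)"
  shows "(\<lambda>(r, \<omega>). X r \<omega>) \<in> restrict_space borel {t..s} \<Otimes>\<^sub>M F \<rightarrow>\<^sub>M count_space UNIV"
proof -
  define P where "P = restrict_space (borel :: real measure) {t..s} \<Otimes>\<^sub>M F"
  define g :: "nat \<Rightarrow> int \<Rightarrow> real" where "g n k = max t (min s (t + (real_of_int k + 1) / real (Suc n)))" for n k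
  define \<rho> where "\<rho> n r = g n \<lfloor>(r - t) * real (Suc n)\<rfloor>" for n r
  have g: "g n k \<in> {t..s}" for n k using ts by (auto simp: g_def)
  have [measurable]: "(\<lambda>x. fst x) \<in> borel_measurable P"
    unfolding P_def by (rule measurable_compose[OF measurable_fst]) (rule measurable_restrict_space1, simp)
  have Xg: "(\<lambda>x. X (g n k) (snd x)) \<in> P \<rightarrow>\<^sub>M count_space UNIV" for n k
    unfolding P_def by (rule measurable_compose[OF measurable_snd adapted[OF g]])
  have Xr: "(\<lambda>x. X (\<rho> n (fst x)) (snd x)) \<in> P \<rightarrow>\<^sub>M count_space UNIV" for n
    unfolding \<rho>_def
    by (rule measurable_compose_countable[where f="\<lambda>k x. X (g n k) (snd x)", OF Xg])
       (rule measurable_compose[OF _ measurable_real_floor], measurable)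
  have lim: "\<forall>\<^sub>F n in sequentially. X (\<rho> n r) \<omega> = X r \<omega>" if r: "r \<in> {t..s}" and \<omega>: "\<omega> \<in> space F" for r \<omega>
  proof (cases "r < s")
    case False
    then have "r = s" using r by simp
    have "\<rho> n s = s" for n
    proof -
      have "(s - t) * real (Suc n) \<le> real_of_int \<lfloor>(s - t) * real (Suc n)\<rfloor> + 1" by linarith
      then have "s \<le> t + (real_of_int \<lfloor>(s - t) * real (Suc n)\<rfloor> + 1) / real (Suc n)"
        by (simp add: field_simps)
      then show ?thesis using ts by (simp add: \<rho>_def g_def)
    qed
    with \<open>r = s\<close> show ?thesis by simp
  next
    case True
    have low: "r < \<rho> n r" for n
    proof -
      have "(r - t) * real (Suc n) < real_of_int \<lfloor>(r - t) * real (Suc n)\<rfloor> + 1" by linarith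
      then have "r < t + (real_of_int \<lfloor>(r - t) * real (Suc n)\<rfloor> + 1) / real (Suc n)"
        by (simp add: field_simps)
      then show ?thesis using True by (simp add: \<rho>_def g_def)
    qed
    have up: "\<rho> n r \<le> r + 1 / real (Suc n)" for n
    proof -
      have "real_of_int \<lfloor>(r - t) * real (Suc n)\<rfloor> + 1 \<le> (r - t) * real (Suc n) + 1" by linarith
      then have "(real_of_int \<lfloor>(r - t) * real (Suc n)\<rfloor> + 1) / real (Suc n) \<le> ((r - t) * real (Suc n) + 1) / real (Suc n)"
        by (rule divide_right_mono) simp
      then have "t + (real_of_int \<lfloor>(r - t) * real (Suc n)\<rfloor> + 1) / real (Suc n) \<le> r + 1 / real (Suc n)"
        by (simp add: add_divide_distrib)
      moreover have "t \<le> r + 1 / real (Suc n)" using r by (simp add: add_increasing2)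
      ultimately show ?thesis by (simp add: \<rho>_def g_def min_le_iff_disj)
    qed
    have "(\<lambda>n. \<rho> n r) \<longlonglongrightarrow> r"
    proof (rule tendsto_sandwich[where f="\<lambda>_. r" and h="\<lambda>n. r + 1 / real (Suc n)"])
      show "(\<lambda>n. r + 1 / real (Suc n)) \<longlonglongrightarrow> r"
        using tendsto_add[OF tendsto_const[of r] LIMSEQ_Suc[OF lim_1_over_n]] by simp
    qed (use low up in \<open>auto intro!: always_eventually less_imp_le\<close>)
    then have "filterlim (\<lambda>n. \<rho> n r) (at_right r) sequentially"
      using low by (auto simp: filterlim_at less_imp_neq[THEN not_sym] intro!: always_eventually)
    then have "(\<lambda>n. X (\<rho> n r) \<omega>) \<longlonglongrightarrow> X r \<omega>"
      using rc[OF \<omega>, of r] True r unfolding continuous_within by (auto intro: filterlim_compose)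
    then show ?thesis by (simp add: tendsto_discrete)
  qed
  have eq: "X (fst x) (snd x) = j \<longleftrightarrow> (\<exists>n0. \<forall>n\<ge>n0. X (\<rho> n (fst x)) (snd x) = j)" if "x \<in> space P" for x j
  proof -
    have "fst x \<in> {t..s}" "snd x \<in> space F" using that by (auto simp: P_def space_pair_measure space_restrict_space)
    from lim[OF this] obtain n0 where n0: "\<And>n. n \<ge> n0 \<Longrightarrow> X (\<rho> n (fst x)) (snd x) = X (fst x) (snd x)"
      unfolding eventually_sequentially by auto
    then show ?thesis by (metis linear)
  qed
  have "(\<lambda>x. X (fst x) (snd x)) \<in> P \<rightarrow>\<^sub>M count_space UNIV"
  proof (subst measurable_count_space_eq_countable)
    have "(\<lambda>x. X (fst x) (snd x)) -` {j} \<inter> space P \<in> sets P" for j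
    proof -
      have "(\<lambda>x. X (fst x) (snd x)) -` {j} \<inter> space P = {x \<in> space P. \<exists>n0. \<forall>n\<ge>n0. X (\<rho> n (fst x)) (snd x) = j}"
      proof (rule set_eqI)
        fix x
        show "x \<in> (\<lambda>x. X (fst x) (snd x)) -` {j} \<inter> space P \<longleftrightarrow>
          x \<in> {x \<in> space P. \<exists>n0. \<forall>n\<ge>n0. X (\<rho> n (fst x)) (snd x) = j}"
          unfolding vimage_def mem_Collect_eq Int_iff singleton_iff using eq[of x j] by blast
      qed
      also have "\<dots> \<in> sets P" using Xr by measurable
      finally show ?thesis .
    qed
    then show "(\<lambda>x. X (fst x) (snd x)) \<in> space P \<rightarrow> UNIV \<and> (\<forall>a\<in>UNIV. (\<lambda>x. X (fst x) (snd x)) -` {a} \<inter> space P \<in> sets P)"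
      by auto
  qed simp
  then show ?thesis by (simp add: P_def split_beta')
qed

lemma bounded_Fubini:
  fixes g :: "real \<Rightarrow> 'w \<Rightarrow> real"
  assumes M: "prob_space M" and gm: "(\<lambda>(q, \<omega>). g q \<omega>) \<in> borel_measurable (borel \<Otimes>\<^sub>M M)"
    and B: "\<And>q \<omega>. q \<in> {a..b} \<Longrightarrow> \<omega> \<in> space M \<Longrightarrow> \<bar>g q \<omega>\<bar> \<le> B"
  shows bounded_Fubini_eq: "(\<integral>\<omega>. (LBINT q:{a..b}. g q \<omega>) \<partial>M) = (LBINT q:{a..b}. (\<integral>\<omega>. g q \<omega> \<partial>M))"
    and bounded_Fubini_integrable: "integrable M (\<lambda>\<omega>. LBINT q:{a..b}. g q \<omega>)"
proof -
  interpret prob_space M by fact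
  interpret pair_sigma_finite lborel M ..
  have [measurable]: "(\<lambda>(q, \<omega>). g q \<omega>) \<in> borel_measurable (lborel \<Otimes>\<^sub>M M)"
    using gm by (simp cong: measurable_cong_sets sets_pair_measure_cong)
  have int: "integrable (lborel \<Otimes>\<^sub>M M) (\<lambda>(q, \<omega>). indicat_real {a..b} q *\<^sub>R g q \<omega>)"
  proof (rule integrableI_bounded_set[where A="{a..b} \<times> space M" and B=B])
    show "emeasure (lborel \<Otimes>\<^sub>M M) ({a..b} \<times> space M) < \<infinity>"
      by (subst sigma_finite_measure.emeasure_pair_measure_Times[OF prob_space_imp_sigma_finite[OF M]]) (auto simp: emeasure_lborel_Icc_eq emeasure_space_1)
    show "AE x in lborel \<Otimes>\<^sub>M M. x \<in> {a..b} \<times> space M \<longrightarrow> norm (case x of (q, \<omega>) \<Rightarrow> indicat_real {a..b} q *\<^sub>R g q \<omega>) \<le> B"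
      using B by (auto intro!: AE_I2)
  qed (auto simp: indicator_def space_pair_measure)
  show "(\<integral>\<omega>. (LBINT q:{a..b}. g q \<omega>) \<partial>M) = (LBINT q:{a..b}. (\<integral>\<omega>. g q \<omega> \<partial>M))"
    using Fubini_integral[OF int] unfolding set_lebesgue_integral_def by simp
  show "integrable M (\<lambda>\<omega>. LBINT q:{a..b}. g q \<omega>)"
    using integrable_snd[OF int] unfolding set_lebesgue_integral_def by simp
qed

lemma generator_eq:
  assumes "i \<le> N" "u \<le> i"
  shows "generator lam N q u f i = (if i < N then lam q * (f (Suc i) - f i) else 0) + real u * (f (i - 1) - f i)"
proof -
  have "generator lam N q u f i = (\<Sum>j\<le>N. (if j = Suc i \<and> i < N then lam q * (f (Suc i) - f i) else 0)
     + (if i = Suc j then real u * (f (i - 1) - f i) else 0))"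
    unfolding generator_def jump_rate_def by (intro sum.cong) auto
  also have "\<dots> = (\<Sum>j\<le>N. if j = Suc i then (if i < N then lam q * (f (Suc i) - f i) else 0) else 0)
     + (\<Sum>j\<le>N. if i = Suc j then real u * (f (i - 1) - f i) else 0)"
    unfolding sum.distrib by (intro arg_cong2[where f="(+)"] sum.cong) auto
  also have "(\<Sum>j\<le>N. if j = Suc i then (if i < N then lam q * (f (Suc i) - f i) else 0) else 0)
      = (if i < N then lam q * (f (Suc i) - f i) else 0)"
    by (subst sum.delta) auto
  also have "(\<Sum>j\<le>N. if i = Suc j then real u * (f (i - 1) - f i) else 0) = real u * (f (i - 1) - f i)"
  proof (cases i)
    case 0
    then show ?thesis using assms by simp
  next
    case (Suc k)
    have "(\<Sum>j\<le>N. if i = Suc j then real u * (f (i - 1) - f i) else 0)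
       = (\<Sum>j\<le>N. if j = k then real u * (f (i - 1) - f i) else 0)"
      unfolding Suc by (intro sum.cong) auto
    also have "\<dots> = real u * (f (i - 1) - f i)" using assms Suc by (subst sum.delta) auto
    finally show ?thesis .
  qed
  finally show ?thesis .
qed

text \<open>
  By linearity of the generator, the martingale property for indicators of single states
  determines its effect on every function, in particular on functions that vary with time.
\<close>

lemma generator_expand:
  assumes "i \<le> N"
  shows "generator lam N q u f i = (\<Sum>j\<le>N. f j * generator lam N q u (\<lambda>k. if k = j then 1 else 0) i)"
proof -
  have "(\<Sum>j\<le>N. f j * generator lam N q u (\<lambda>k. if k = j then 1 else 0) i)
     = (\<Sum>k\<le>N. \<Sum>j\<le>N. f j * (jump_rate lam N q u i k * ((if k = j then 1 else 0) - (if i = j then 1 else 0))))"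
    unfolding generator_def sum_distrib_left by (rule sum.swap)
  also have "\<dots> = (\<Sum>k\<le>N. jump_rate lam N q u i k * (f k - f i))"
  proof (rule sum.cong[OF refl])
    fix k assume k: "k \<in> {..N}"
    have "(\<Sum>j\<le>N. f j * (jump_rate lam N q u i k * ((if k = j then 1 else 0) - (if i = j then 1 else 0))))
       = jump_rate lam N q u i k * ((\<Sum>j\<le>N. if k = j then f j else 0) - (\<Sum>j\<le>N. if i = j then f j else 0))"
      unfolding sum_subtractf[symmetric] sum_distrib_left by (intro sum.cong) auto
    then show "(\<Sum>j\<le>N. f j * (jump_rate lam N q u i k * ((if k = j then 1 else 0) - (if i = j then 1 else 0))))
       = jump_rate lam N q u i k * (f k - f i)"
      using k assms by (simp add: sum.delta)
  qed
  finally show ?thesis unfolding generator_def by simp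
qed

lemma borel_measurable_generator:
  assumes [measurable]: "lam \<in> borel_measurable borel" "\<tau> \<in> borel_measurable M"
    "u \<in> M \<rightarrow>\<^sub>M count_space UNIV" "X \<in> M \<rightarrow>\<^sub>M count_space UNIV"
    and f: "\<And>j. (\<lambda>x. f x j) \<in> borel_measurable M"
  shows "(\<lambda>x. generator lam N (\<tau> x) (u x) (f x) (X x)) \<in> borel_measurable M"
proof (rule measurable_compose_countable[where f="\<lambda>i x. generator lam N (\<tau> x) (u x) (f x) i" and g=X])
  note [measurable] = f
  show "(\<lambda>x. generator lam N (\<tau> x) (u x) (f x) i) \<in> borel_measurable M" for i
    unfolding generator_def jump_rate_def by measurable
qed measurable

context bounded_rates
begin

lemma generator_bounded:
  assumes "i \<le> N" "u \<le> min i K" and f: "\<And>j. \<bar>f j\<bar> \<le> B"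
  shows "\<bar>generator lam N q u f i\<bar> \<le> (Bl + real K) * (2 * B)"
proof -
  have "\<bar>if i < N then lam q * (f (Suc i) - f i) else 0\<bar> \<le> Bl * (2 * B)"
  proof -
    have "\<bar>lam q * (f (Suc i) - f i)\<bar> \<le> Bl * (2 * B)"
      unfolding abs_mult using lam[of q] f[of i] f[of "Suc i"] by (intro mult_mono) auto
    moreover have "0 \<le> Bl * (2 * B)" using lam[of q] f[of 0] by (intro mult_nonneg_nonneg) auto
    ultimately show ?thesis by simp
  qed
  moreover have "\<bar>f (i - 1) - f i\<bar> \<le> 2 * B" using f[of i] f[of "i - 1"] by linarith
  then have "\<bar>real u * (f (i - 1) - f i)\<bar> \<le> real K * (2 * B)"
    unfolding abs_mult using assms(2) by (intro mult_mono) auto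
  ultimately show ?thesis using assms by (simp add: generator_eq distrib_right)
qed

lemma hjb_inequality:
  assumes "i \<le> N" "u \<in> feasible_actions K i"
  shows "hjb_rhs lam e p N K q w i \<le> cost_rate lam e p N q i u + generator lam N q u w i"
proof -
  have u: "u \<le> min i K" using assms by (auto simp: feasible_actions_def)
  have "real u * (w i - w (i - 1) - e q) \<le> real u * max 0 (w i - w (i - 1) - e q)"
    by (intro mult_left_mono) auto
  also have "\<dots> \<le> real (min i K) * max 0 (w i - w (i - 1) - e q)"
    using u by (intro mult_right_mono) auto
  finally show ?thesis
    using assms(1) u unfolding hjb_rhs_def cost_rate_def
    by (subst generator_eq) (auto simp: algebra_simps)
qed

lemma hjb_equality:
  assumes "i \<le> N" "u = (if w i - w (i - 1) > e q then min i K else 0)"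
  shows "hjb_rhs lam e p N K q w i = cost_rate lam e p N q i u + generator lam N q u w i"
proof -
  have "u \<le> i" using assms by auto
  then show ?thesis
    using assms unfolding hjb_rhs_def cost_rate_def
    by (subst generator_eq) (auto simp: algebra_simps max_def)
qed


text \<open>
  Dynkin's formula for the function \<open>v\<close>, which depends on time, although the martingale property
  speaks of functions of the state only. Applied to the indicators of the states it shows that the occupation
  probabilities \<open>P j s\<close> are integrals of the expected generators \<open>\<gamma> j\<close>. As \<open>v s j\<close> is an integral
  over \<open>{s..T}\<close>, \<open>set_integral_triangle_swap\<close> plays the role of the product rule for \<open>P j s * v s j\<close>,
  and summation over \<open>j\<close> gives the claim.
\<close>

lemma cost_to_go_decomposition:
  fixes M :: "'w measure"
  assumes sys: "controlled_system T lam N K t i M F I u" and t: "t \<in> {0..T}"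
    and v: "hjb_solution N K L v" and L: "0 < L" "Bl + real K \<le> L"
  shows "cost_to_go T lam e p N t M I u = v t i + (\<integral>\<omega>. (LBINT s:{t..T}. cost_rate lam e p N s (I s \<omega>) (u s \<omega>)
            + generator lam N s (u s \<omega>) (v s) (I s \<omega>) - hjb_rhs lam e p N K s (v s) (I s \<omega>)) \<partial>M)"
proof -
  have prob: "prob_space M" and filt: "filtration (space M) F"
    and sub: "\<And>s. s \<in> {t..T} \<Longrightarrow> subalgebra M (F s)"
    and adI: "\<And>s. s \<in> {t..T} \<Longrightarrow> I s \<in> F s \<rightarrow>\<^sub>M count_space UNIV"
    and prog: "\<And>s. s \<in> {t..T} \<Longrightarrow> (\<lambda>(r, \<omega>). u r \<omega>) \<in> restrict_space borel {t..s} \<Otimes>\<^sub>M F s \<rightarrow>\<^sub>M count_space UNIV"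
    and start: "\<And>\<omega>. \<omega> \<in> space M \<Longrightarrow> I t \<omega> = i"
    and IN: "\<And>s \<omega>. \<omega> \<in> space M \<Longrightarrow> s \<in> {t..T} \<Longrightarrow> I s \<omega> \<le> N"
    and feas: "\<And>s \<omega>. \<omega> \<in> space M \<Longrightarrow> s \<in> {t..T} \<Longrightarrow> u s \<omega> \<in> feasible_actions K (I s \<omega>)"
    and rc: "\<And>s \<omega>. \<omega> \<in> space M \<Longrightarrow> s \<in> {t..<T} \<Longrightarrow> continuous (at_right s) (\<lambda>r. I r \<omega>)"
    and mart: "\<And>(f :: nat \<Rightarrow> real) r s. t \<le> r \<Longrightarrow> r \<le> s \<Longrightarrow> s \<le> T \<Longrightarrow>
        (AE \<omega> in M. real_cond_exp M (F r)
             (\<lambda>\<omega>. f (I s \<omega>) - f (I r \<omega>) - (LBINT q:{r..s}. generator lam N q (u q \<omega>) f (I q \<omega>))) \<omega> = 0)"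
    using sys unfolding controlled_system_def by auto
  interpret prob_space M by fact
  have tT: "t \<le> T" using t by auto
  \<comment> \<open>Clamping times to \<open>{t..T}\<close> extends the processes to the whole line, where Fubini applies.\<close>
  define c where "c s = max t (min T s)" for s
  have c: "c s \<in> {t..T}" for s using tT by (auto simp: c_def)
  have c_id: "c s = s" if "s \<in> {t..T}" for s using that by (auto simp: c_def)
  have cm[measurable]: "c \<in> borel_measurable borel" unfolding c_def by measurable
  define X where "X s \<omega> = I (c s) \<omega>" for s \<omega>
  define U where "U s \<omega> = u (c s) \<omega>" for s \<omega>
  have spF: "space (F T) = space M" using sub[of T] tT by (auto simp: subalgebra_def)
  have clamp: "(\<lambda>(q, \<omega>). (c q, \<omega>)) \<in> borel \<Otimes>\<^sub>M M \<rightarrow>\<^sub>M restrict_space borel {t..T} \<Otimes>\<^sub>M F T"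
  proof -
    have 1: "(\<lambda>x. c (fst x)) \<in> borel \<Otimes>\<^sub>M M \<rightarrow>\<^sub>M restrict_space borel {t..T}"
      by (rule measurable_restrict_space2) (use c in auto)
    have "(\<lambda>\<omega>. \<omega>) \<in> M \<rightarrow>\<^sub>M F T"
      using sub[of T] tT by (auto simp: subalgebra_def measurable_def)
    then have 2: "(\<lambda>x. snd x) \<in> borel \<Otimes>\<^sub>M M \<rightarrow>\<^sub>M F T"
      by (rule measurable_compose[OF measurable_snd])
    show ?thesis using measurable_Pair[OF 1 2] by (simp add: split_beta')
  qed
  have "(\<lambda>(r, \<omega>). I r \<omega>) \<in> restrict_space borel {t..T} \<Otimes>\<^sub>M F T \<rightarrow>\<^sub>M count_space UNIV"
  proof (rule right_continuous_jointly_measurable[OF tT])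
    fix r assume r: "r \<in> {t..T}"
    have "sets (F r) \<subseteq> sets (F T)" "space (F r) = space (F T)"
      using filt r sub[OF r] spF by (auto simp: filtration_def subalgebra_def)
    then show "I r \<in> F T \<rightarrow>\<^sub>M count_space UNIV"
      using adI[OF r] by (auto simp: measurable_def)
  qed (use rc spF in auto)
  from measurable_compose[OF clamp this]
  have Xm[measurable]: "(\<lambda>x. X (fst x) (snd x)) \<in> borel \<Otimes>\<^sub>M M \<rightarrow>\<^sub>M count_space UNIV"
    by (simp add: X_def split_beta')
  from measurable_compose[OF clamp prog[of T]] tT
  have Um[measurable]: "(\<lambda>x. U (fst x) (snd x)) \<in> borel \<Otimes>\<^sub>M M \<rightarrow>\<^sub>M count_space UNIV"
    by (simp add: U_def split_beta')
  have XN: "X s \<omega> \<le> N" and UX: "U s \<omega> \<in> feasible_actions K (X s \<omega>)"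
    if "\<omega> \<in> space M" for s \<omega> using IN[OF that c] feas[OF that c] by (auto simp: X_def U_def)
  have U: "U s \<omega> \<le> min (X s \<omega>) K" if "\<omega> \<in> space M" for s \<omega>
    using UX[OF that] by (auto simp: feasible_actions_def)
  note [measurable] = hjb_solution_measurable[OF v]
  obtain B where B: "\<And>s i. \<bar>v s i\<bar> \<le> B" using hjb_solution_bounded[OF v] by auto
  define h where "h j s = hjb_rhs lam e p N K s (v s) j" for s j
  obtain H where H: "\<And>s i. \<bar>h i s\<bar> \<le> H"
    using hjb_rhs_solution_bounded[OF v L(2)] unfolding h_def by auto
  have hm[measurable]: "h j \<in> borel_measurable borel" for j unfolding h_def by measurable
  define G where "G f s \<omega> = generator lam N s (U s \<omega>) f (X s \<omega>)" for f s \<omega>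
  have Gm: "(\<lambda>(s, \<omega>). G f s \<omega>) \<in> borel_measurable (borel \<Otimes>\<^sub>M M)" for f
    unfolding G_def split_beta' by (rule borel_measurable_generator) measurable
  define \<delta> :: "nat \<Rightarrow> nat \<Rightarrow> real" where "\<delta> j k = (if k = j then 1 else 0)" for j k
  have \<delta>1: "\<bar>\<delta> j k\<bar> \<le> 1" for j k by (simp add: \<delta>_def)
  have GB: "\<bar>G (\<delta> j) s \<omega>\<bar> \<le> (Bl + real K) * (2 * 1)" if "\<omega> \<in> space M" for j s \<omega>
    unfolding G_def using XN[OF that] U[OF that] \<delta>1 by (intro generator_bounded) auto
  define \<gamma> where "\<gamma> j s = (\<integral>\<omega>. G (\<delta> j) s \<omega> \<partial>M)" for j s
  define P where "P j s = (\<integral>\<omega>. \<delta> j (X s \<omega>) \<partial>M)" for j s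
  have \<gamma>m[measurable]: "\<gamma> j \<in> borel_measurable borel" for j
    unfolding \<gamma>_def by (rule borel_measurable_lebesgue_integral) (use Gm in simp)
  have \<gamma>B: "\<bar>\<gamma> j s\<bar> \<le> (Bl + real K) * (2 * 1)" for j s
  proof -
    have "(\<lambda>\<omega>. G (\<delta> j) s \<omega>) \<in> borel_measurable M"
      using measurable_compose[OF measurable_Pair1' Gm, of s] by simp
    then have int: "integrable M (\<lambda>\<omega>. G (\<delta> j) s \<omega>)"
      using GB by (intro integrable_const_bound[where B="(Bl + real K) * (2 * 1)"]) auto
    have "\<bar>\<gamma> j s\<bar> \<le> (\<integral>\<omega>. \<bar>G (\<delta> j) s \<omega>\<bar> \<partial>M)" unfolding \<gamma>_def by (rule integral_abs_bound)
    also have "\<dots> \<le> (\<integral>\<omega>. (Bl + real K) * (2 * 1) \<partial>M)"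
      using GB int by (intro integral_mono) auto
    finally show ?thesis by (simp add: prob_space)
  qed
  have Xs: "(\<lambda>\<omega>. X s \<omega>) \<in> M \<rightarrow>\<^sub>M count_space UNIV" for s
    using measurable_compose[OF measurable_Pair1' Xm, of s] by simp
  \<comment> \<open>The forward equation, from the martingale property at the deterministic start.\<close>
  have forward: "P j s = \<delta> j i + (LBINT q:{t..s}. \<gamma> j q)" if s: "s \<in> {t..T}" for j s
  proof -
    have sub_t: "subalgebra M (F t)" using sub[of t] tT by simp
    then have "finite_measure_subalgebra M (F t)" by unfold_locales
    then interpret sa: finite_measure_subalgebra M "F t" .
    define D where "D \<omega> = \<delta> j (I s \<omega>) - \<delta> j (I t \<omega>) - (LBINT q:{t..s}. generator lam N q (u q \<omega>) (\<delta> j) (I q \<omega>))" for \<omega>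
    have "D \<omega> = \<delta> j (X s \<omega>) - \<delta> j i - (LBINT q:{t..s}. G (\<delta> j) q \<omega>)" if "\<omega> \<in> space M" for \<omega>
    proof -
      have "(LBINT q:{t..s}. generator lam N q (u q \<omega>) (\<delta> j) (I q \<omega>)) = (LBINT q:{t..s}. G (\<delta> j) q \<omega>)"
        using s by (intro set_lebesgue_integral_cong) (auto simp: G_def X_def U_def c_id)
      then show ?thesis using s start[OF that] by (simp add: D_def X_def c_id)
    qed
    then have D: "integrable M D \<longleftrightarrow> integrable M (\<lambda>\<omega>. \<delta> j (X s \<omega>) - \<delta> j i - (LBINT q:{t..s}. G (\<delta> j) q \<omega>))"
      "(\<integral>\<omega>. D \<omega> \<partial>M) = (\<integral>\<omega>. \<delta> j (X s \<omega>) - \<delta> j i - (LBINT q:{t..s}. G (\<delta> j) q \<omega>) \<partial>M)"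
      by (auto intro!: Bochner_Integration.integral_cong Bochner_Integration.integrable_cong)
    have i1: "integrable M (\<lambda>\<omega>. \<delta> j (X s \<omega>))"
      using \<delta>1 Xs by (intro integrable_const_bound[where B=1]) auto
    have i2: "integrable M (\<lambda>\<omega>. LBINT q:{t..s}. G (\<delta> j) q \<omega>)"
      by (rule bounded_Fubini_integrable[OF prob Gm GB])
    have "(\<integral>\<omega>. D \<omega> \<partial>M) = (\<integral>\<omega>. real_cond_exp M (F t) D \<omega> \<partial>M)"
      by (rule sa.real_cond_exp_int(2)[symmetric]) (use D i1 i2 in auto)
    also have "\<dots> = (\<integral>\<omega>. 0 \<partial>M)"
      by (rule integral_cong_AE) (use mart[of t s "\<delta> j"] s in \<open>auto simp: D_def[abs_def]\<close>)
    finally have "(\<integral>\<omega>. D \<omega> \<partial>M) = 0" by simp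
    moreover have "(\<integral>\<omega>. D \<omega> \<partial>M) = P j s - \<delta> j i - (\<integral>\<omega>. (LBINT q:{t..s}. G (\<delta> j) q \<omega>) \<partial>M)"
      unfolding D(2) P_def using i1 i2 by (simp add: prob_space)
    moreover have "(\<integral>\<omega>. (LBINT q:{t..s}. G (\<delta> j) q \<omega>) \<partial>M) = (LBINT q:{t..s}. (\<integral>\<omega>. G (\<delta> j) q \<omega> \<partial>M))"
      by (rule bounded_Fubini_eq[OF prob Gm GB])
    ultimately show ?thesis by (simp add: \<gamma>_def)
  qed
  have PB: "\<bar>P j s\<bar> \<le> 1" for j s
  proof -
    have int: "integrable M (\<lambda>\<omega>. \<delta> j (X s \<omega>))"
      using \<delta>1 Xs by (intro integrable_const_bound[where B=1]) auto
    have "\<bar>P j s\<bar> \<le> (\<integral>\<omega>. \<bar>\<delta> j (X s \<omega>)\<bar> \<partial>M)" unfolding P_def by (rule integral_abs_bound)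
    also have "\<dots> \<le> (\<integral>\<omega>. 1 \<partial>M)"
      using int \<delta>1 by (intro integral_mono) auto
    finally show ?thesis by (simp add: prob_space)
  qed
  have Pm[measurable]: "P j \<in> borel_measurable borel" for j
    unfolding P_def \<delta>_def by measurable
  have PhB: "\<bar>P j q * h j q\<bar> \<le> 1 * H" for j q
    unfolding abs_mult by (rule mult_mono'[OF PB H]) auto
  \<comment> \<open>Integration by parts in \<open>P j s * v s j\<close>.\<close>
  have parts: "(LBINT s:{t..T}. \<gamma> j s * v s j) = (LBINT q:{t..T}. P j q * h j q) - \<delta> j i * v t j" for j
  proof -
    have "(LBINT s:{t..T}. \<gamma> j s * v s j) = (LBINT s:{t..T}. \<gamma> j s * (LBINT q:{s..T}. h j q))"
      using t by (intro set_lebesgue_integral_cong) (auto simp: h_def intro!: hjb_solution_integral_eq[OF v L])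
    also have "\<dots> = (LBINT q:{t..T}. (LBINT s:{t..q}. \<gamma> j s) * h j q)"
      by (rule set_integral_triangle_swap[OF _ _ \<gamma>B H]) measurable
    also have "\<dots> = (LBINT q:{t..T}. P j q * h j q - \<delta> j i * h j q)"
    proof (rule set_lebesgue_integral_cong, simp, safe)
      fix q assume q: "q \<in> {t..T}"
      show "(LBINT s:{t..q}. \<gamma> j s) * h j q = P j q * h j q - \<delta> j i * h j q"
        unfolding forward[OF q] by (simp add: algebra_simps)
    qed
    also have "\<dots> = (LBINT q:{t..T}. P j q * h j q) - (LBINT q:{t..T}. \<delta> j i * h j q)"
    proof (rule set_integral_diff)
      show "set_integrable lborel {t..T} (\<lambda>q. P j q * h j q)"
        by (rule bounded_borel_set_integrable[OF _ PhB]) measurable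
      show "set_integrable lborel {t..T} (\<lambda>q. \<delta> j i * h j q)"
        by (intro set_integrable_mult_right bounded_borel_set_integrable[where B=H] H) auto
    qed
    also have "(LBINT q:{t..T}. \<delta> j i * h j q) = \<delta> j i * v t j"
      unfolding hjb_solution_integral_eq[OF v L t] h_def by simp
    finally show ?thesis .
  qed
  define A where "A s \<omega> = G (v s) s \<omega> - h (X s \<omega>) s" for s \<omega>
  have GvE: "G (v s) s \<omega> = (\<Sum>j\<le>N. v s j * G (\<delta> j) s \<omega>)" if "\<omega> \<in> space M" for s \<omega>
    using generator_expand[OF XN[OF that, of s], of lam s "U s \<omega>" "v s"] by (simp add: G_def \<delta>_def[abs_def])
  have hE: "h (X s \<omega>) s = (\<Sum>j\<le>N. h j s * \<delta> j (X s \<omega>))" if "\<omega> \<in> space M" for s \<omega>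
    using XN[OF that, of s] by (simp add: \<delta>_def sum.delta' if_distrib cong: if_cong)
  have EA: "(\<integral>\<omega>. A s \<omega> \<partial>M) = (\<Sum>j\<le>N. \<gamma> j s * v s j - P j s * h j s)" for s
  proof -
    have i1: "integrable M (\<lambda>\<omega>. \<delta> j (X s \<omega>))" for j
      using \<delta>1 Xs by (intro integrable_const_bound[where B=1]) auto
    have "(\<lambda>\<omega>. G (\<delta> j) s \<omega>) \<in> borel_measurable M" for j
      using measurable_compose[OF measurable_Pair1' Gm, of s] by simp
    then have i2: "integrable M (\<lambda>\<omega>. G (\<delta> j) s \<omega>)" for j
      using GB by (intro integrable_const_bound[where B="(Bl + real K) * (2 * 1)"]) auto
    have "(\<integral>\<omega>. A s \<omega> \<partial>M) = (\<integral>\<omega>. (\<Sum>j\<le>N. v s j * G (\<delta> j) s \<omega> - h j s * \<delta> j (X s \<omega>)) \<partial>M)"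
      by (intro Bochner_Integration.integral_cong) (auto simp: A_def GvE hE sum_subtractf)
    also have "\<dots> = (\<Sum>j\<le>N. \<gamma> j s * v s j - P j s * h j s)"
      using i1 i2 by (simp add: \<gamma>_def P_def mult.commute)
    finally show ?thesis .
  qed
  have "(LBINT s:{t..T}. (\<integral>\<omega>. A s \<omega> \<partial>M)) = (\<Sum>j\<le>N. (LBINT s:{t..T}. \<gamma> j s * v s j - P j s * h j s))"
    unfolding EA set_lebesgue_integral_def scaleR_sum_right
  proof (rule Bochner_Integration.integral_sum)
    show "integrable lborel (\<lambda>s. indicat_real {t..T} s *\<^sub>R (\<gamma> j s * v s j - P j s * h j s))" for j
      unfolding set_integrable_def[symmetric]
    proof (rule set_integral_diff)
      show "set_integrable lborel {t..T} (\<lambda>s. \<gamma> j s * v s j)"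
      proof (rule bounded_borel_set_integrable)
        show "\<bar>\<gamma> j s * v s j\<bar> \<le> ((Bl + real K) * (2 * 1)) * B" for s
          unfolding abs_mult by (rule mult_mono'[OF \<gamma>B B]) auto
      qed measurable
      show "set_integrable lborel {t..T} (\<lambda>q. P j q * h j q)"
        by (rule bounded_borel_set_integrable[OF _ PhB]) measurable
    qed
  qed
  also have "\<dots> = (\<Sum>j\<le>N. - (\<delta> j i * v t j))"
  proof (rule sum.cong[OF refl])
    fix j
    have "(LBINT s:{t..T}. \<gamma> j s * v s j - P j s * h j s) = (LBINT s:{t..T}. \<gamma> j s * v s j) - (LBINT s:{t..T}. P j s * h j s)"
    proof (rule set_integral_diff)
      show "set_integrable lborel {t..T} (\<lambda>s. \<gamma> j s * v s j)"
      proof (rule bounded_borel_set_integrable)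
        show "\<bar>\<gamma> j s * v s j\<bar> \<le> ((Bl + real K) * (2 * 1)) * B" for s
          unfolding abs_mult by (rule mult_mono'[OF \<gamma>B B]) auto
      qed measurable
      show "set_integrable lborel {t..T} (\<lambda>q. P j q * h j q)"
        by (rule bounded_borel_set_integrable[OF _ PhB]) measurable
    qed
    then show "(LBINT s:{t..T}. \<gamma> j s * v s j - P j s * h j s) = - (\<delta> j i * v t j)" using parts by simp
  qed
  also have "\<dots> = - v t i"
  proof -
    obtain \<omega> where \<omega>: "\<omega> \<in> space M" using not_empty by auto
    have "i \<le> N" using start[OF \<omega>] IN[OF \<omega>, of t] tT by auto
    have "(\<Sum>j\<le>N. - (\<delta> j i * v t j)) = (\<Sum>j\<le>N. if i = j then - v t j else 0)"
      by (intro sum.cong) (auto simp: \<delta>_def)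
    then show ?thesis using \<open>i \<le> N\<close> by simp
  qed
  finally have EAv: "(LBINT s:{t..T}. (\<integral>\<omega>. A s \<omega> \<partial>M)) = - v t i" .
  define C where "C s \<omega> = cost_rate lam e p N s (X s \<omega>) (U s \<omega>)" for s \<omega>
  have Cm: "(\<lambda>(s, \<omega>). C s \<omega>) \<in> borel_measurable (borel \<Otimes>\<^sub>M M)"
    unfolding C_def cost_rate_def split_beta' by measurable
  have CB: "\<bar>C s \<omega>\<bar> \<le> Be * real K + p * Bl" if "\<omega> \<in> space M" for s \<omega>
  proof -
    have "\<bar>e s * real (U s \<omega>)\<bar> \<le> Be * real K"
      unfolding abs_mult using e[of s] U[OF that, of s] by (intro mult_mono) auto
    moreover have "\<bar>p * lam s * (if X s \<omega> = N then 1 else 0)\<bar> \<le> p * Bl"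
      using p lam[of s] order_trans[OF lam(1)[of s] lam(2)[of s]] by (auto simp: abs_mult mult_left_mono)
    ultimately show ?thesis unfolding C_def cost_rate_def by linarith
  qed
  have Am: "(\<lambda>(s, \<omega>). A s \<omega>) \<in> borel_measurable (borel \<Otimes>\<^sub>M M)"
  proof -
    have 1: "(\<lambda>x. G (v (fst x)) (fst x) (snd x)) \<in> borel_measurable (borel \<Otimes>\<^sub>M M)"
      unfolding G_def by (rule borel_measurable_generator) measurable
    have 2: "(\<lambda>x. h (X (fst x) (snd x)) (fst x)) \<in> borel_measurable (borel \<Otimes>\<^sub>M M)"
      by (rule measurable_compose_countable[where f="\<lambda>k x. h k (fst x)"]) measurable
    show ?thesis unfolding A_def split_beta' using 1 2 by measurable
  qed
  have AB: "\<bar>A s \<omega>\<bar> \<le> (Bl + real K) * (2 * B) + H" if "\<omega> \<in> space M" for s \<omega>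
  proof -
    have "\<bar>G (v s) s \<omega>\<bar> \<le> (Bl + real K) * (2 * B)"
      unfolding G_def using XN[OF that] U[OF that] B by (intro generator_bounded) auto
    with H[of "X s \<omega>" s] show ?thesis unfolding A_def by linarith
  qed
  have orig: "(LBINT s:{t..T}. cost_rate lam e p N s (I s \<omega>) (u s \<omega>) + generator lam N s (u s \<omega>) (v s) (I s \<omega>)
        - hjb_rhs lam e p N K s (v s) (I s \<omega>)) = (LBINT s:{t..T}. C s \<omega> + A s \<omega>)" for \<omega>
    by (intro set_lebesgue_integral_cong) (auto simp: C_def A_def G_def h_def X_def U_def c_id)
  have origC: "(LBINT s:{t..T}. cost_rate lam e p N s (I s \<omega>) (u s \<omega>)) = (LBINT s:{t..T}. C s \<omega>)" for \<omega>
    by (intro set_lebesgue_integral_cong) (auto simp: C_def X_def U_def c_id)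
  have split: "(LBINT s:{t..T}. C s \<omega> + A s \<omega>) = (LBINT s:{t..T}. C s \<omega>) + (LBINT s:{t..T}. A s \<omega>)"
    if \<omega>: "\<omega> \<in> space M" for \<omega>
  proof (rule set_integral_add)
    show "set_integrable lborel {t..T} (\<lambda>s. C s \<omega>)"
      by (rule bounded_borel_set_integrable[OF _ CB[OF \<omega>]]) (use measurable_compose[OF measurable_Pair2'[OF \<omega>] Cm] in simp)
    show "set_integrable lborel {t..T} (\<lambda>s. A s \<omega>)"
      by (rule bounded_borel_set_integrable[OF _ AB[OF \<omega>]]) (use measurable_compose[OF measurable_Pair2'[OF \<omega>] Am] in simp)
  qed
  note iC = bounded_Fubini_integrable[OF prob Cm CB, of t T] and iA = bounded_Fubini_integrable[OF prob Am AB, of t T]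
  have "(\<integral>\<omega>. (LBINT s:{t..T}. C s \<omega> + A s \<omega>) \<partial>M)
     = (\<integral>\<omega>. (LBINT s:{t..T}. C s \<omega>) + (LBINT s:{t..T}. A s \<omega>) \<partial>M)"
    by (rule Bochner_Integration.integral_cong[OF refl split])
  also have "\<dots> = (\<integral>\<omega>. (LBINT s:{t..T}. C s \<omega>) \<partial>M) + (\<integral>\<omega>. (LBINT s:{t..T}. A s \<omega>) \<partial>M)"
    by (rule Bochner_Integration.integral_add[OF iC iA])
  also have "(\<integral>\<omega>. (LBINT s:{t..T}. A s \<omega>) \<partial>M) = - v t i"
    using bounded_Fubini_eq[OF prob Am AB, of t T] EAv by simp
  finally show "cost_to_go T lam e p N t M I u = v t i + (\<integral>\<omega>. (LBINT s:{t..T}. cost_rate lam e p N s (I s \<omega>) (u s \<omega>)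
            + generator lam N s (u s \<omega>) (v s) (I s \<omega>) - hjb_rhs lam e p N K s (v s) (I s \<omega>)) \<partial>M)"
    unfolding cost_to_go_def orig origC by simp
qed

lemma cost_to_go_ge_hjb_solution:
  assumes sys: "controlled_system T lam N K t i M F I u" and t: "t \<in> {0..T}"
    and v: "hjb_solution N K L v" and L: "0 < L" "Bl + real K \<le> L"
  shows "v t i \<le> cost_to_go T lam e p N t M I u"
proof -
  have "0 \<le> (\<integral>\<omega>. (LBINT s:{t..T}. cost_rate lam e p N s (I s \<omega>) (u s \<omega>)
            + generator lam N s (u s \<omega>) (v s) (I s \<omega>) - hjb_rhs lam e p N K s (v s) (I s \<omega>)) \<partial>M)"
  proof (rule Bochner_Integration.integral_nonneg_AE, rule AE_I2)
    fix \<omega> assume \<omega>: "\<omega> \<in> space M"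
    have "0 \<le> indicat_real {t..T} s *\<^sub>R (cost_rate lam e p N s (I s \<omega>) (u s \<omega>)
            + generator lam N s (u s \<omega>) (v s) (I s \<omega>) - hjb_rhs lam e p N K s (v s) (I s \<omega>))" for s
    proof (cases "s \<in> {t..T}")
      case True
      have "I s \<omega> \<le> N" "u s \<omega> \<in> feasible_actions K (I s \<omega>)"
        using sys \<omega> True unfolding controlled_system_def by auto
      from hjb_inequality[OF this, of s "v s"] show ?thesis by simp
    qed simp
    then show "0 \<le> (LBINT s:{t..T}. cost_rate lam e p N s (I s \<omega>) (u s \<omega>)
            + generator lam N s (u s \<omega>) (v s) (I s \<omega>) - hjb_rhs lam e p N K s (v s) (I s \<omega>))"
      unfolding set_lebesgue_integral_def by (intro Bochner_Integration.integral_nonneg)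
  qed
  then show ?thesis using cost_to_go_decomposition[OF assms] by simp
qed

lemma cost_to_go_feedback:
  assumes sys: "controlled_system T lam N K t i M F I u" and t: "t \<in> {0..T}"
    and v: "hjb_solution N K L v" and L: "0 < L" "Bl + real K \<le> L"
    and u: "\<And>s \<omega>. \<omega> \<in> space M \<Longrightarrow> s \<in> {t..T} \<Longrightarrow>
      u s \<omega> = (if v s (I s \<omega>) - v s (I s \<omega> - 1) > e s then min (I s \<omega>) K else 0)"
  shows "cost_to_go T lam e p N t M I u = v t i"
proof -
  have "(\<integral>\<omega>. (LBINT s:{t..T}. cost_rate lam e p N s (I s \<omega>) (u s \<omega>)
            + generator lam N s (u s \<omega>) (v s) (I s \<omega>) - hjb_rhs lam e p N K s (v s) (I s \<omega>)) \<partial>M) = (\<integral>\<omega>. 0 \<partial>M)"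
  proof (rule Bochner_Integration.integral_cong[OF refl])
    fix \<omega> assume \<omega>: "\<omega> \<in> space M"
    have "(LBINT s:{t..T}. cost_rate lam e p N s (I s \<omega>) (u s \<omega>)
            + generator lam N s (u s \<omega>) (v s) (I s \<omega>) - hjb_rhs lam e p N K s (v s) (I s \<omega>)) = (LBINT s:{t..T}. 0)"
    proof (rule set_lebesgue_integral_cong, simp, safe)
      fix s assume s: "s \<in> {t..T}"
      have "I s \<omega> \<le> N" using sys \<omega> s unfolding controlled_system_def by auto
      from hjb_equality[OF this u[OF \<omega> s]]
      show "cost_rate lam e p N s (I s \<omega>) (u s \<omega>)
            + generator lam N s (u s \<omega>) (v s) (I s \<omega>) - hjb_rhs lam e p N K s (v s) (I s \<omega>) = 0" by simp
    qed
    then show "(LBINT s:{t..T}. cost_rate lam e p N s (I s \<omega>) (u s \<omega>)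
            + generator lam N s (u s \<omega>) (v s) (I s \<omega>) - hjb_rhs lam e p N K s (v s) (I s \<omega>)) = 0" by simp
  qed
  then show ?thesis using cost_to_go_decomposition[OF sys t v L] by simp
qed

end

section \<open>A driven chain under a feedback rule\<close>

text \<open>
  Uniformization: potential jumps occur at the times of a Poisson process of rate \<open>L\<close>, which
  dominates the total jump rate. A potential jump at time \<open>q\<close> in state \<open>i\<close> is an arrival with
  probability \<open>lam q / L\<close>, a departure with probability \<open>\<mu> q i / L\<close>, and otherwise has no effect.
\<close>

locale feedback_chain = bounded_rates +
  fixes L :: real and N K :: nat and \<mu> :: "real \<Rightarrow> nat \<Rightarrow> nat"
  assumes L: "0 < L" "Bl + real K \<le> L"
    and \<mu>_measurable: "\<And>i. (\<lambda>q. \<mu> q i) \<in> borel \<rightarrow>\<^sub>M count_space UNIV"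
    and \<mu>: "\<And>q i. \<mu> q i \<le> min i K"
begin

definition noise :: "real measure" where
  "noise = density lborel (exponential_density L)"

text \<open>
  The coordinates with even index are the gaps between potential jumps. Those with odd index
  provide the marks: \<open>exp (- L * y)\<close> is uniformly distributed on the unit interval if \<open>y\<close> is
  exponentially distributed with rate \<open>L\<close>.
\<close>

definition driver :: "(nat \<Rightarrow> real) measure" where
  "driver = (\<Pi>\<^sub>M n\<in>UNIV. noise)"

lemma sets_noise[simp, measurable_cong]: "sets noise = sets borel"
  by (simp add: noise_def)

lemma space_noise[simp]: "space noise = UNIV"
  by (simp add: noise_def)

lemma sets_driver[measurable_cong]: "sets driver = sets (\<Pi>\<^sub>M n\<in>UNIV. borel)"
  unfolding driver_def by (rule sets_PiM_cong) auto

lemma space_driver[simp]: "space driver = UNIV"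
  by (auto simp: driver_def space_PiM)

lemma prob_space_noise: "prob_space noise"
  unfolding noise_def by (rule prob_space_exponential_density[OF L(1)])

lemma noise_le:
  assumes "0 \<le> a"
  shows "measure noise {x. x \<le> a} = 1 - exp (- L * a)"
proof -
  interpret prob_space noise by (rule prob_space_noise)
  have "distributed noise lborel (\<lambda>x. x) (exponential_density L)"
    by (simp add: distributed_def noise_def distr_id2 exponential_density_nonneg[OF L(1)] sets_eq_imp_space_eq)
  from exponential_distributedD_le[OF this assms L(1)] show ?thesis by (simp add: mult.commute)
qed

lemma noise_mark:
  assumes a: "0 \<le> a" "a \<le> 1"
  shows "measure noise {y. exp (- L * y) < a} = a"
proof (cases "a = 0")
  case True
  then have "{y. exp (- L * y) < a} = {}" by (auto simp: not_less)
  then show ?thesis using True by (simp only: measure_empty)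
next
  case False
  interpret prob_space noise by (rule prob_space_noise)
  \<comment> \<open>The mark falls below \<open>a\<close> when the noise exceeds \<open>c\<close>.\<close>
  define c where "c = - ln a / L"
  have le_sets: "{y. y \<le> c} \<in> events" by simp
  have a0: "0 < a" using False a by simp
  have c: "0 \<le> c" using a0 a L by (simp add: c_def divide_nonpos_pos ln_le_zero_iff)
  have "exp (- L * y) < a \<longleftrightarrow> c < y" for y
  proof -
    have "exp (- L * y) < a \<longleftrightarrow> - L * y < ln a"
      by (metis a0 exp_less_cancel_iff exp_ln)
    also have "\<dots> \<longleftrightarrow> c < y" using L by (auto simp: c_def field_simps)
    finally show ?thesis .
  qed
  then have "{y. exp (- L * y) < a} = {y. c < y}" by (rule Collect_cong)
  also have "{y. c < y} = space noise - {y. y \<le> c}" by auto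
  finally have "measure noise {y. exp (- L * y) < a} = 1 - measure noise {y. y \<le> c}"
    by (simp only: prob_compl[OF le_sets])
  also have "\<dots> = exp (- L * c)" by (simp add: noise_le[OF c])
  also have "\<dots> = a" using L a0 by (simp add: c_def)
  finally show ?thesis .
qed

lemma noise_integral:
  assumes [measurable]: "g \<in> borel_measurable borel"
  shows "(\<integral>x. g x \<partial>noise) = (LBINT x:{0..}. L * exp (- L * x) * g x)"
proof -
  have "(\<integral>x. g x \<partial>noise) = (LBINT x. exponential_density L x *\<^sub>R g x)"
    unfolding noise_def by (subst integral_density) (auto simp: exponential_density_nonneg[OF L(1)])
  also have "\<dots> = (LBINT x:{0..}. L * exp (- L * x) * g x)"
    unfolding set_lebesgue_integral_def
    by (intro Bochner_Integration.integral_cong) (auto simp: exponential_density_def indicator_def mult.commute)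
  finally show ?thesis .
qed

lemma noise_pos: "AE x in noise. 0 < x"
proof -
  have "AE x in lborel. x \<noteq> (0::real)" by (rule AE_lborel_singleton)
  then show ?thesis
    unfolding noise_def by (subst AE_density) (auto simp: exponential_density_def elim!: eventually_mono)
qed

lemma prob_space_driver: "prob_space driver"
  unfolding driver_def by (rule prob_space_PiM) (rule prob_space_noise)

lemma measure_UNIV[simp]: "measure noise UNIV = 1" "measure driver UNIV = 1"
  using prob_space.prob_space[OF prob_space_noise] prob_space.prob_space[OF prob_space_driver] by auto

text \<open>
  The driver is self-similar: it consists of one gap, one mark and an independent copy of itself.
  Together with \<open>state_unfold\<close> this is the first-jump analysis from which all distributional
  properties of the chain are derived.
\<close>

lemma driver_unfold:
  fixes \<Phi> :: "(nat \<Rightarrow> real) \<Rightarrow> real"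
  assumes [measurable]: "\<Phi> \<in> borel_measurable driver" and B: "\<And>\<omega>. \<bar>\<Phi> \<omega>\<bar> \<le> B"
  shows "(\<integral>\<omega>. \<Phi> \<omega> \<partial>driver) = (\<integral>x. \<integral>y. \<integral>\<omega>. \<Phi> (case_nat x (case_nat y \<omega>)) \<partial>driver \<partial>noise \<partial>noise)"
proof -
  interpret noise: prob_space noise by (rule prob_space_noise)
  interpret driver: prob_space driver by (rule prob_space_driver)
  interpret sq: sequence_space noise by unfold_locales
  interpret nd: pair_prob_space noise driver ..
  have one: "(\<integral>\<omega>. f \<omega> \<partial>driver) = (\<integral>x. \<integral>\<omega>. f (case_nat x \<omega>) \<partial>driver \<partial>noise)"
    if f[measurable]: "f \<in> borel_measurable driver" and fB: "\<And>\<omega>. \<bar>f \<omega>\<bar> \<le> B" for f :: "(nat \<Rightarrow> real) \<Rightarrow> real"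
  proof -
    have cm[measurable]: "(\<lambda>(x, \<omega>). case_nat x \<omega>) \<in> noise \<Otimes>\<^sub>M driver \<rightarrow>\<^sub>M driver"
      unfolding driver_def by measurable
    have "(\<integral>\<omega>. f \<omega> \<partial>driver) = (\<integral>\<omega>. f \<omega> \<partial>distr (noise \<Otimes>\<^sub>M driver) driver (\<lambda>(x, \<omega>). case_nat x \<omega>))"
      using sq.PiM_iter by (simp add: driver_def)
    also have "\<dots> = (\<integral>z. f (case z of (x, \<omega>) \<Rightarrow> case_nat x \<omega>) \<partial>(noise \<Otimes>\<^sub>M driver))"
      by (rule integral_distr[OF cm f])
    also have "\<dots> = (\<integral>x. \<integral>\<omega>. f (case_nat x \<omega>) \<partial>driver \<partial>noise)"
    proof (subst nd.integral_fst'[symmetric])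
      show "integrable (noise \<Otimes>\<^sub>M driver) (\<lambda>z. f (case z of (x, \<omega>) \<Rightarrow> case_nat x \<omega>))"
        by (rule nd.P.integrable_const_bound[where B=B]) (use fB measurable_compose[OF cm f] in auto)
    qed simp
    finally show ?thesis .
  qed
  have cx: "(\<lambda>\<omega>. \<Phi> (case_nat x \<omega>)) \<in> borel_measurable driver" for x
  proof -
    have "(\<lambda>\<omega>. case_nat x \<omega>) \<in> driver \<rightarrow>\<^sub>M driver" unfolding driver_def by measurable
    then show ?thesis by (rule measurable_compose) fact
  qed
  show ?thesis
    by (subst one[OF assms]) (rule Bochner_Integration.integral_cong[OF refl], rule one[OF cx B])
qed

text \<open>
  Gaps are made positive at every sample point, since a path has to start in its initial state
  surely and not just almost surely.
\<close>

definition gap :: "real \<Rightarrow> real" where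
  "gap x = (if 0 < x then x else 1)"

definition step :: "real \<Rightarrow> nat \<Rightarrow> real \<Rightarrow> nat" where
  "step q i y = (if i < N \<and> exp (- L * y) < lam q / L then Suc i
     else if 1 - real (\<mu> q i) / L \<le> exp (- L * y) then i - 1 else i)"

text \<open>
  The path with at most \<open>n\<close> potential jumps. Having finitely many of them, it is right-continuous with left limits
  at every sample point.
\<close>

primrec path :: "nat \<Rightarrow> real \<Rightarrow> nat \<Rightarrow> (nat \<Rightarrow> real) \<Rightarrow> real \<Rightarrow> nat" where
  "path 0 t i \<omega> s = i"
| "path (Suc n) t i \<omega> s = (if s < t + gap (\<omega> 0) then i
     else path n (t + gap (\<omega> 0)) (step (t + gap (\<omega> 0)) i (\<omega> 1)) (\<lambda>k. \<omega> (Suc (Suc k))) s)"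

definition clock :: "nat \<Rightarrow> (nat \<Rightarrow> real) \<Rightarrow> real" where
  "clock n \<omega> = (\<Sum>k<n. gap (\<omega> (2 * k)))"

text \<open>
  Here \<open>clock n \<omega>\<close> is the waiting time for the \<open>n\<close>-th potential jump, and the path gets as many
  potential jumps as it takes to pass \<open>T\<close>. If the clock never passes \<open>T\<close>, which happens with probability
  zero by \<open>clock_unbounded\<close>, the number is arbitrary but finite.
\<close>

definition state :: "real \<Rightarrow> nat \<Rightarrow> (nat \<Rightarrow> real) \<Rightarrow> real \<Rightarrow> nat" where
  "state t i \<omega> s = path (LEAST n. T < t + clock n \<omega>) t i \<omega> s"

lemma gap_pos: "0 < gap x"
  by (simp add: gap_def)

lemma step_le: "i \<le> N \<Longrightarrow> step q i y \<le> N"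
  by (auto simp: step_def)

lemma path_le: "i \<le> N \<Longrightarrow> path n t i \<omega> s \<le> N"
  by (induction n arbitrary: t i \<omega>) (auto simp: step_le)

lemma path_start: "path n t i \<omega> t = i"
  using gap_pos[of "\<omega> 0"] by (cases n) auto

lemma path_right_continuous: "continuous (at_right s) (path n t i \<omega>)"
proof (induction n arbitrary: t i \<omega>)
  case 0
  have "path 0 t i \<omega> = (\<lambda>s. i)" by (rule ext) simp
  then show ?case by (auto intro: tendsto_const)
next
  case (Suc n)
  define \<tau> where "\<tau> = t + gap (\<omega> 0)"
  show ?case
  proof (cases "s < \<tau>")
    case True
    then have ev: "\<forall>\<^sub>F q in at_right s. q < \<tau>" by (intro order_tendstoD(2)[OF tendsto_ident_at])
    have "\<forall>\<^sub>F q in at_right s. path (Suc n) t i \<omega> q = path (Suc n) t i \<omega> s"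
      using ev by eventually_elim (use True in \<open>simp add: \<tau>_def\<close>)
    then show ?thesis unfolding continuous_within by (rule tendsto_eventually)
  next
    case False
    let ?g = "path n \<tau> (step \<tau> i (\<omega> 1)) (\<lambda>k. \<omega> (Suc (Suc k)))"
    have "(?g \<longlongrightarrow> ?g s) (at_right s)" using Suc unfolding continuous_within .
    moreover have "\<forall>\<^sub>F q in at_right s. ?g q = path (Suc n) t i \<omega> q"
      unfolding eventually_at_right_field using False by (intro exI[of _ "s + 1"]) (auto simp: \<tau>_def)
    ultimately have "(path (Suc n) t i \<omega> \<longlongrightarrow> ?g s) (at_right s)"
      by (rule Lim_transform_eventually)
    moreover have "?g s = path (Suc n) t i \<omega> s" using False by (simp add: \<tau>_def)
    ultimately show ?thesis unfolding continuous_within by simp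
  qed
qed

lemma path_left_limit: "\<exists>l. (path n t i \<omega> \<longlongrightarrow> l) (at_left s)"
proof (induction n arbitrary: t i \<omega>)
  case 0
  have "path 0 t i \<omega> = (\<lambda>s. i)" by (rule ext) simp
  then show ?case by (auto intro: tendsto_const)
next
  case (Suc n)
  define \<tau> where "\<tau> = t + gap (\<omega> 0)"
  show ?case
  proof (cases "s \<le> \<tau>")
    case True
    have "\<forall>\<^sub>F q in at_left s. path (Suc n) t i \<omega> q = i"
      unfolding eventually_at_left_field using True by (intro exI[of _ "s - 1"]) (auto simp: \<tau>_def)
    then show ?thesis by (intro exI) (rule tendsto_eventually)
  next
    case False
    let ?g = "path n \<tau> (step \<tau> i (\<omega> 1)) (\<lambda>k. \<omega> (Suc (Suc k)))"
    obtain l where l: "(?g \<longlongrightarrow> l) (at_left s)" using Suc by blast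
    have "\<forall>\<^sub>F q in at_left s. \<tau> < q" using False by (intro order_tendstoD(1)[OF tendsto_ident_at]) auto
    then have "\<forall>\<^sub>F q in at_left s. ?g q = path (Suc n) t i \<omega> q"
      by eventually_elim (simp add: \<tau>_def)
    with l have "(path (Suc n) t i \<omega> \<longlongrightarrow> l) (at_left s)" by (rule Lim_transform_eventually)
    then show ?thesis ..
  qed
qed

lemma clock_Suc: "clock (Suc n) \<omega> = gap (\<omega> 0) + clock n (\<lambda>k. \<omega> (Suc (Suc k)))"
  unfolding clock_def by (subst sum.lessThan_Suc_shift) simp

lemma state_unfold:
  assumes t: "t \<le> T" and ex: "\<exists>n. T < t + gap x + clock n \<omega>"
  shows "state t i (case_nat x (case_nat y \<omega>)) s =
    (if s < t + gap x then i else state (t + gap x) (step (t + gap x) i y) \<omega> s)"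
proof -
  let ?\<omega> = "case_nat x (case_nat y \<omega>)"
  have sh: "(\<lambda>k. ?\<omega> (Suc (Suc k))) = \<omega>" by simp
  have c: "T < t + clock (Suc n) ?\<omega> \<longleftrightarrow> T < t + gap x + clock n \<omega>" for n
    unfolding clock_Suc sh by (simp add: add.assoc)
  obtain n where "T < t + gap x + clock n \<omega>" using ex by blast
  then have "T < t + clock (Suc n) ?\<omega>" unfolding c .
  then have "(LEAST n. T < t + clock n ?\<omega>) = Suc (LEAST n. T < t + clock (Suc n) ?\<omega>)"
    by (rule Least_Suc) (use t in \<open>simp add: clock_def\<close>)
  then show ?thesis unfolding state_def c by simp
qed

lemma borel_measurable_gap[measurable]: "gap \<in> borel_measurable borel"
  unfolding gap_def by measurable

lemma measurable_step[measurable (raw)]: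
  assumes [measurable]: "q \<in> borel_measurable Z" "k \<in> Z \<rightarrow>\<^sub>M count_space UNIV" "y \<in> borel_measurable Z"
  shows "(\<lambda>z. step (q z) (k z) (y z)) \<in> Z \<rightarrow>\<^sub>M count_space UNIV"
proof (rule measurable_compose_countable[where f="\<lambda>i z. step (q z) i (y z)" and g=k])
  note [measurable] = \<mu>_measurable
  show "(\<lambda>z. step (q z) i (y z)) \<in> Z \<rightarrow>\<^sub>M count_space UNIV" for i
    unfolding step_def by measurable
qed measurable

lemma measurable_path:
  assumes "t \<in> borel_measurable Z" "k \<in> Z \<rightarrow>\<^sub>M count_space UNIV"
    "w \<in> Z \<rightarrow>\<^sub>M (\<Pi>\<^sub>M n\<in>UNIV. borel)" and s[measurable]: "s \<in> borel_measurable Z"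
  shows "(\<lambda>z. path n (t z) (k z) (w z) (s z)) \<in> Z \<rightarrow>\<^sub>M count_space UNIV"
  using assms(1-3)
proof (induction n arbitrary: t k w)
  case (Suc n)
  note [measurable] = Suc.prems
  have wi[measurable]: "(\<lambda>z. w z i) \<in> borel_measurable Z" for i
    by (rule measurable_compose[OF Suc.prems(3)]) measurable
  have wsh: "(\<lambda>z k. w z (Suc (Suc k))) \<in> Z \<rightarrow>\<^sub>M (\<Pi>\<^sub>M n\<in>UNIV. borel)"
    by (rule measurable_abs_UNIV) (rule wi)
  have [measurable]: "(\<lambda>z. path n (t z + gap (w z 0)) (step (t z + gap (w z 0)) (k z) (w z 1)) (\<lambda>k. w z (Suc (Suc k))) (s z))
      \<in> Z \<rightarrow>\<^sub>M count_space UNIV"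
    by (rule Suc.IH[OF _ _ wsh]) measurable
  show ?case unfolding path.simps by measurable
qed simp

lemma measurable_state:
  assumes [measurable]: "t \<in> borel_measurable Z" "k \<in> Z \<rightarrow>\<^sub>M count_space UNIV"
    and w: "w \<in> Z \<rightarrow>\<^sub>M (\<Pi>\<^sub>M n\<in>UNIV. borel)" and [measurable]: "s \<in> borel_measurable Z"
  shows "(\<lambda>z. state (t z) (k z) (w z) (s z)) \<in> Z \<rightarrow>\<^sub>M count_space UNIV"
proof -
  have wi[measurable]: "(\<lambda>z. w z i) \<in> borel_measurable Z" for i
    by (rule measurable_compose[OF w]) measurable
  have "(\<lambda>z. LEAST n. T < t z + clock n (w z)) \<in> Z \<rightarrow>\<^sub>M count_space UNIV"
    unfolding clock_def by measurable
  then show ?thesis unfolding state_def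
    by (rule measurable_compose_countable[where f="\<lambda>n z. path n (t z) (k z) (w z) (s z)", rotated])
       (rule measurable_path[OF _ _ w], measurable)
qed

text \<open>
  Thinning: a potential jump changes the mean of \<open>\<phi>\<close> by the generator divided by the rate of the
  potential jumps. The two mark regions are disjoint because \<open>lam q + \<mu> q i \<le> L\<close>.
\<close>

lemma integral_step:
  assumes i: "i \<le> N"
  shows "(\<integral>y. \<phi> (step q i y) \<partial>noise) = \<phi> i + generator lam N q (\<mu> q i) \<phi> i / L"
proof -
  interpret noise: prob_space noise by (rule prob_space_noise)
  define A where "A = (if i < N then {y. exp (- L * y) < lam q / L} else {})"
  define B where "B = {y. exp (- L * y) < 1 - real (\<mu> q i) / L}"
  have lam1: "lam q / L \<le> 1 - real (\<mu> q i) / L"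
  proof -
    have "lam q + real (\<mu> q i) \<le> L" using lam(2)[of q] \<mu>[of q i] L by auto
    then show ?thesis using L by (simp add: field_simps)
  qed
  have l0: "0 \<le> lam q / L" "0 \<le> real (\<mu> q i) / L" using lam(1)[of q] L by auto
  have AB: "A \<subseteq> B" using lam1 by (auto simp: A_def B_def)
  have Am[measurable]: "A \<in> sets noise" "B \<in> sets noise" by (auto simp: A_def B_def)
  have "\<phi> (step q i y) = \<phi> i + (indicator A y * (\<phi> (Suc i) - \<phi> i) + (1 - indicator B y) * (\<phi> (i - 1) - \<phi> i))" for y
    using AB lam1 unfolding step_def by (auto simp: A_def B_def indicator_def not_less)
  moreover have [simp]: "integrable noise (indicat_real A)" "integrable noise (indicat_real B)"
    by (intro integrable_real_indicator Am; simp add: less_top[symmetric])+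
  moreover have [simp]: "(\<integral>y. indicat_real A y \<partial>noise) = measure noise A" "(\<integral>y. indicat_real B y \<partial>noise) = measure noise B"
    by simp_all
  ultimately have "(\<integral>y. \<phi> (step q i y) \<partial>noise)
      = \<phi> i + (measure noise A * (\<phi> (Suc i) - \<phi> i) + (1 - measure noise B) * (\<phi> (i - 1) - \<phi> i))"
    by simp
  also have "measure noise A = (if i < N then lam q / L else 0)"
  proof -
    have "lam q / L \<le> 1" using l0 lam1 by linarith
    from noise_mark[OF l0(1) this] show ?thesis by (simp add: A_def)
  qed
  also have "measure noise B = 1 - real (\<mu> q i) / L"
    unfolding B_def using l0 lam1 by (intro noise_mark) auto
  also have "\<phi> i + ((if i < N then lam q / L else 0) * (\<phi> (Suc i) - \<phi> i) + (1 - (1 - real (\<mu> q i) / L)) * (\<phi> (i - 1) - \<phi> i))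
     = \<phi> i + generator lam N q (\<mu> q i) \<phi> i / L"
    using \<mu>[of q i] by (subst generator_eq[OF i]) (auto simp: algebra_simps add_divide_distrib diff_divide_distrib)
  finally show ?thesis .
qed

text \<open>
  Let \<open>q t\<close> be the probability that the clock started at \<open>t\<close> never passes \<open>T\<close>. Then the first gap has
  to be at most \<open>T - t\<close>, and \<open>q\<close> at the end of this gap is again bounded by the supremum of \<open>q\<close>, so
  the supremum vanishes by contraction.
\<close>

lemma clock_unbounded: "AE \<omega> in driver. \<exists>n. T < clock n \<omega>"
proof -
  interpret noise: prob_space noise by (rule prob_space_noise)
  interpret driver: prob_space driver by (rule prob_space_driver)
  define Q where "Q t \<omega> = (if \<forall>n. t + clock n \<omega> \<le> T then 1 else 0 :: real)" for t \<omega>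
  have Qm: "(\<lambda>z. Q (t z) (w z)) \<in> borel_measurable Z"
    if [measurable]: "t \<in> borel_measurable Z" and w: "w \<in> Z \<rightarrow>\<^sub>M driver" for t w and Z :: "'z measure"
  proof -
    have wi[measurable]: "(\<lambda>z. w z i) \<in> borel_measurable Z" for i
      by (rule measurable_compose[OF w]) measurable
    show ?thesis unfolding Q_def clock_def by measurable
  qed
  have Qint: "integrable driver (Q t)" for t
    by (rule driver.integrable_const_bound[where B=1]) (simp add: Q_def, rule Qm, auto)
  define q where "q t = (\<integral>\<omega>. Q t \<omega> \<partial>driver)" for t
  have q1: "0 \<le> q t" "q t \<le> 1" for t
  proof -
    show "0 \<le> q t" unfolding q_def by (rule Bochner_Integration.integral_nonneg) (simp add: Q_def)
    have "q t \<le> (\<integral>\<omega>. 1 \<partial>driver)"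
      unfolding q_def by (rule integral_mono[OF Qint]) (auto simp: Q_def)
    then show "q t \<le> 1" by (simp add: driver.prob_space)
  qed
  have "q 0 \<le> 0"
  proof (rule contraction_nonpos[where f=q and x=0 and X="{0..T}" and \<theta>="1 - exp (- L * T)" and B=1])
    fix m t assume m: "0 \<le> m" and le: "\<And>t. t \<in> {0..T} \<Longrightarrow> q t \<le> m" and t: "t \<in> {0..T}"
    have "q t = (\<integral>x. \<integral>y. \<integral>\<omega>. Q t (case_nat x (case_nat y \<omega>)) \<partial>driver \<partial>noise \<partial>noise)"
      unfolding q_def by (rule driver_unfold[where B=1]) (rule Qm, auto simp: Q_def)
    also have "\<dots> \<le> (\<integral>x. indicator {x. x \<le> T - t} x * m \<partial>noise)"
    proof (rule integral_mono_AE')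
      show "AE x in noise. (\<integral>y. \<integral>\<omega>. Q t (case_nat x (case_nat y \<omega>)) \<partial>driver \<partial>noise) \<le> indicat_real {x. x \<le> T - t} x * m"
        using noise_pos
      proof eventually_elim
        fix x :: real assume x: "0 < x"
        have sub: "Q t (case_nat x (case_nat y \<omega>)) \<le> (if x \<le> T - t then Q (t + x) \<omega> else 0)" for y \<omega>
        proof -
          let ?\<omega> = "case_nat x (case_nat y \<omega>)"
          have sh: "(\<lambda>k. ?\<omega> (Suc (Suc k))) = \<omega>" by simp
          have c: "clock (Suc n) ?\<omega> = x + clock n \<omega>" for n
            unfolding clock_Suc sh using x by (simp add: gap_def)
          show ?thesis
          proof (cases "\<forall>n. t + clock n ?\<omega> \<le> T")
            case True
            then have "t + clock (Suc n) ?\<omega> \<le> T" for n by blast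
            then have "t + x + clock n \<omega> \<le> T" for n unfolding c by (simp add: add.assoc)
            then have all: "t + x + clock n \<omega> \<le> T" for n by blast
            moreover have "x \<le> T - t" using all[of 0] by (simp add: clock_def)
            ultimately have "\<forall>n. t + x + clock n \<omega> \<le> T" "x \<le> T - t" by auto
            then show ?thesis by (simp add: Q_def)
          next
            case False
            then have "Q t ?\<omega> = 0" unfolding Q_def by (rule if_not_P)
            moreover have "0 \<le> (if x \<le> T - t then Q (t + x) \<omega> else 0)" by (simp add: Q_def)
            ultimately show ?thesis by linarith
          qed
        qed
        have inner: "(\<integral>\<omega>. Q t (case_nat x (case_nat y \<omega>)) \<partial>driver) \<le> indicat_real {x. x \<le> T - t} x * m" for y
        proof -
          have "(\<integral>\<omega>. Q t (case_nat x (case_nat y \<omega>)) \<partial>driver) \<le> (\<integral>\<omega>. (if x \<le> T - t then Q (t + x) \<omega> else 0) \<partial>driver)"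

          proof (rule integral_mono')
            show "integrable driver (\<lambda>\<omega>. if x \<le> T - t then Q (t + x) \<omega> else 0)"
              using Qint[of "t + x"] by (cases "x \<le> T - t") simp_all
            show "Q t (case_nat x (case_nat y \<omega>)) \<le> (if x \<le> T - t then Q (t + x) \<omega> else 0)" for \<omega>
              by (rule sub)
          qed (simp add: Q_def)
          also have "\<dots> \<le> indicat_real {x. x \<le> T - t} x * m"
            using le[of "t + x"] t x by (cases "x \<le> T - t") (auto simp: q_def)
          finally show ?thesis .
        qed
        have "(\<integral>y. \<integral>\<omega>. Q t (case_nat x (case_nat y \<omega>)) \<partial>driver \<partial>noise) \<le> (\<integral>y. indicat_real {x. x \<le> T - t} x * m \<partial>noise)"
          by (rule integral_mono') (use inner m in \<open>auto simp: noise.integrable_const\<close>)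
        then show "(\<integral>y. \<integral>\<omega>. Q t (case_nat x (case_nat y \<omega>)) \<partial>driver \<partial>noise) \<le> indicat_real {x. x \<le> T - t} x * m"
          by (simp add: noise.prob_space)
      qed
    qed (use m in \<open>auto simp: less_top[symmetric]\<close>)
    also have "\<dots> = (1 - exp (- L * (T - t))) * m"
      using noise_le[of "T - t"] t by simp
    also have "\<dots> \<le> (1 - exp (- L * T)) * m"
      using t L m by (intro mult_right_mono) auto
    finally show "q t \<le> (1 - exp (- L * T)) * m" .
  qed (use T L q1 in auto)
  then have "q 0 = 0" using q1[of 0] by simp
  then have "AE \<omega> in driver. Q 0 \<omega> = 0"
    unfolding q_def by (subst (asm) integral_nonneg_eq_0_iff_AE[OF Qint]) (auto simp: Q_def)
  then show ?thesis
    by eventually_elim (auto simp: Q_def not_le split: if_splits)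
qed

end

section \<open>The martingale property of the driven chain\<close>

lemma set_integral_abs_le:
  fixes g :: "real \<Rightarrow> real"
  assumes g: "g \<in> borel_measurable borel" and B: "\<And>q. q \<in> {a..b} \<Longrightarrow> \<bar>g q\<bar> \<le> B" and ab: "a \<le> b"
  shows "\<bar>LBINT q:{a..b}. g q\<bar> \<le> B * (b - a)"
proof -
  have int: "set_integrable lborel {a..b} g" by (rule bounded_borel_set_integrable[OF g B])
  have c: "set_integrable lborel {a..b} (\<lambda>q. c)" for c :: real
    by (rule borel_integrable_atLeastAtMost') (intro continuous_intros)
  have cI: "(LBINT q:{a..b}. c) = c * (b - a)" for c :: real
    unfolding set_lebesgue_integral_def using ab by simp
  have "(LBINT q:{a..b}. g q) \<le> B * (b - a)"
    using set_integral_mono[OF int c[of B]] B cI by (simp add: abs_le_iff)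
  moreover have "- B * (b - a) \<le> (LBINT q:{a..b}. g q)"
    unfolding cI[symmetric] by (rule set_integral_mono[OF c int]) (use B in \<open>force simp: abs_le_iff\<close>)
  ultimately show ?thesis by (simp add: abs_le_iff)
qed

context feedback_chain
begin

definition drift :: "(nat \<Rightarrow> real) \<Rightarrow> real \<Rightarrow> nat \<Rightarrow> real" where
  "drift f q i = generator lam N q (\<mu> q i) f i"

text \<open>
  For \<open>t \<le> r\<close> this is the increment over \<open>{r..s}\<close> of the process that has to be a martingale. The
  maximum extends it to starting times \<open>t > r\<close>, as a first jump after \<open>r\<close> leads to such a start.
\<close>

definition deviation :: "(nat \<Rightarrow> real) \<Rightarrow> real \<Rightarrow> real \<Rightarrow> real \<Rightarrow> nat \<Rightarrow> (nat \<Rightarrow> real) \<Rightarrow> real" where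
  "deviation f r s t i \<omega> = f (state t i \<omega> s) - f (state t i \<omega> (max r t))
     - (LBINT q:{max r t..s}. drift f q (state t i \<omega> q))"

text \<open>
  The path passes through prescribed states at prescribed times. Constraints before the starting
  time \<open>t\<close> are ignored, so that a restart at the first jump keeps the same set \<open>C\<close>.
\<close>

definition follows :: "(real \<times> nat) set \<Rightarrow> real \<Rightarrow> nat \<Rightarrow> (nat \<Rightarrow> real) \<Rightarrow> bool" where
  "follows C t i \<omega> \<longleftrightarrow> (\<forall>(x, j)\<in>C. t \<le> x \<longrightarrow> state t i \<omega> x = j)"

lemma state_le: "i \<le> N \<Longrightarrow> state t i \<omega> s \<le> N"
  unfolding state_def by (rule path_le)

lemma state_start: "state t i \<omega> t = i"
  unfolding state_def by (rule path_start)

lemma drift_measurable: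
  assumes [measurable]: "q \<in> borel_measurable Z" "k \<in> Z \<rightarrow>\<^sub>M count_space UNIV"
  shows "(\<lambda>z. drift f (q z) (k z)) \<in> borel_measurable Z"
  unfolding drift_def
proof (rule borel_measurable_generator)
  show "(\<lambda>z. \<mu> (q z) (k z)) \<in> Z \<rightarrow>\<^sub>M count_space UNIV"
    by (rule measurable_compose_countable[where f="\<lambda>i z. \<mu> (q z) i" and g=k])
       (rule measurable_compose[OF _ \<mu>_measurable], measurable)
qed measurable

lemma drift_bounded:
  assumes "i \<le> N" "\<And>j. \<bar>f j\<bar> \<le> B"
  shows "\<bar>drift f q i\<bar> \<le> (Bl + real K) * (2 * B)"
  unfolding drift_def by (rule generator_bounded[OF assms(1) \<mu> assms(2)])

lemma path_drift_measurable:
  "(\<lambda>q. drift f q (state t i \<omega> q)) \<in> borel_measurable borel"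
  by (rule drift_measurable) (auto intro!: measurable_state measurable_const simp: space_PiM)

lemma deviation_measurable:
  assumes [measurable]: "t \<in> borel_measurable Z" "k \<in> Z \<rightarrow>\<^sub>M count_space UNIV"
    and w: "w \<in> Z \<rightarrow>\<^sub>M (\<Pi>\<^sub>M n\<in>UNIV. borel)"
  shows "(\<lambda>z. deviation f r s (t z) (k z) (w z)) \<in> borel_measurable Z"
proof -
  have w': "(\<lambda>x. w (fst x)) \<in> Z \<Otimes>\<^sub>M lborel \<rightarrow>\<^sub>M (\<Pi>\<^sub>M n\<in>UNIV. borel)"
    by (rule measurable_compose[OF measurable_fst w])
  have st: "(\<lambda>x. state (t (fst x)) (k (fst x)) (w (fst x)) (snd x)) \<in> Z \<Otimes>\<^sub>M lborel \<rightarrow>\<^sub>M count_space UNIV"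
    by (rule measurable_state[OF _ _ w']) measurable
  have [measurable]: "(\<lambda>x. drift f (snd x) (state (t (fst x)) (k (fst x)) (w (fst x)) (snd x))) \<in> borel_measurable (Z \<Otimes>\<^sub>M lborel)"
    by (rule drift_measurable[OF _ st]) measurable
  have "(\<lambda>z. LBINT q:{max r (t z)..s}. drift f q (state (t z) (k z) (w z) q)) \<in> borel_measurable Z"
    unfolding set_lebesgue_integral_def
  proof (rule lborel.borel_measurable_lebesgue_integral)
    have "(\<lambda>x. indicat_real {max r (t (fst x))..s} (snd x)) \<in> borel_measurable (Z \<Otimes>\<^sub>M lborel)"
      unfolding indicator_def atLeastAtMost_iff by measurable
    then show "(\<lambda>(z, q). indicat_real {max r (t z)..s} q *\<^sub>R drift f q (state (t z) (k z) (w z) q)) \<in> borel_measurable (Z \<Otimes>\<^sub>M lborel)"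
      unfolding split_beta' by measurable
  qed
  moreover have "(\<lambda>z. f (state (t z) (k z) (w z) s)) \<in> borel_measurable Z"
    "(\<lambda>z. f (state (t z) (k z) (w z) (max r (t z)))) \<in> borel_measurable Z"
    by (rule measurable_compose[OF measurable_state[OF _ _ w]]; measurable)+
  ultimately show ?thesis unfolding deviation_def by measurable
qed

lemma follows_measurable:
  assumes C: "finite C" and [measurable]: "t \<in> borel_measurable Z" "k \<in> Z \<rightarrow>\<^sub>M count_space UNIV"
    and w: "w \<in> Z \<rightarrow>\<^sub>M (\<Pi>\<^sub>M n\<in>UNIV. borel)"
  shows "Measurable.pred Z (\<lambda>z. follows C (t z) (k z) (w z))"
  unfolding follows_def
proof (rule pred_intros_finite(3)[OF C])
  fix c assume "c \<in> C"
  have [measurable]: "(\<lambda>z. state (t z) (k z) (w z) (fst c)) \<in> Z \<rightarrow>\<^sub>M count_space UNIV"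
    by (rule measurable_state[OF _ _ w]) measurable
  show "Measurable.pred Z (\<lambda>z. case c of (x, j) \<Rightarrow> t z \<le> x \<longrightarrow> state (t z) (k z) (w z) x = j)"
    unfolding split_beta' by measurable
qed

lemma deviation_bounded:
  assumes i: "i \<le> N" and f: "\<And>j. \<bar>f j\<bar> \<le> B" and t: "0 \<le> t" "t \<le> s" "r \<le> s" "s \<le> T"
  shows "\<bar>deviation f r s t i \<omega>\<bar> \<le> 2 * B + (Bl + real K) * (2 * B) * T"
proof -
  have "0 \<le> (Bl + real K) * (2 * B)"
    using order_trans[OF lam(1)[of 0] lam(2)] f[of 0] by (intro mult_nonneg_nonneg) auto
  then have "(Bl + real K) * (2 * B) * (s - max r t) \<le> (Bl + real K) * (2 * B) * T"
    using t by (intro mult_left_mono) auto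
  moreover have "\<bar>LBINT q:{max r t..s}. drift f q (state t i \<omega> q)\<bar> \<le> (Bl + real K) * (2 * B) * (s - max r t)"
    by (rule set_integral_abs_le[OF path_drift_measurable]) (use t in \<open>auto intro!: drift_bounded state_le i f\<close>)
  ultimately show ?thesis
    unfolding deviation_def using f[of "state t i \<omega> s"] f[of "state t i \<omega> (max r t)"] by linarith
qed

text \<open>
  What the martingale increment over \<open>{a..s}\<close> collects up to the first potential jump at time \<open>t + x\<close>:
  the change \<open>d\<close> of the function at this jump, if the jump falls into the interval, minus the
  compensator of state \<open>i\<close> before the jump. The strict bounds make the decomposition below an
  identity of paths rather than one up to null sets.
\<close>

definition first_jump_term :: "(nat \<Rightarrow> real) \<Rightarrow> real \<Rightarrow> real \<Rightarrow> real \<Rightarrow> nat \<Rightarrow> real \<Rightarrow> real \<Rightarrow> real" where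
  "first_jump_term f a s t i x d =
     (if a < t + x \<and> t + x \<le> s then d else 0) - (LBINT q:{a..s}. if q < t + x then drift f q i else 0)"

text \<open>
  The increment, restricted to the event that the path follows \<open>C\<close>, splits into the same quantity for
  the path restarted at the first potential jump and the contribution of the time before. If the jump
  occurs after \<open>r\<close>, all constraints have been met or violated before; if it occurs until \<open>r\<close>, only the
  restarted path contributes.
\<close>

lemma deviation_first_jump:
  assumes i: "i \<le> N" and f: "\<And>j. \<bar>f j\<bar> \<le> B" and t: "0 \<le> t" "t \<le> s" "r \<le> s" "s \<le> T"
    and C: "\<And>x j. (x, j) \<in> C \<Longrightarrow> x \<le> r" and x: "0 < x" and ex: "\<exists>n. T < clock n \<omega>"
  shows "of_bool (follows C t i (case_nat x (case_nat y \<omega>))) * deviation f r s t i (case_nat x (case_nat y \<omega>))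
    = (if t + x \<le> s then of_bool (\<forall>(z, j)\<in>C. t \<le> z \<and> z < t + x \<longrightarrow> j = i)
          * (of_bool (follows C (t + x) (step (t + x) i y) \<omega>) * deviation f r s (t + x) (step (t + x) i y) \<omega>) else 0)
      + of_bool (\<forall>(z, j)\<in>C. t \<le> z \<longrightarrow> j = i) * first_jump_term f (max r t) s t i x (f (step (t + x) i y) - f i)"
proof -
  let ?\<omega> = "case_nat x (case_nat y \<omega>)"
  define \<tau> where "\<tau> = t + x"
  define k where "k = step \<tau> i y"
  have gap: "gap x = x" using x by (simp add: gap_def)
  obtain n where "T < clock n \<omega>" using ex by blast
  then have "T < \<tau> + clock n \<omega>" using t x unfolding \<tau>_def by linarith
  then have "\<exists>n. T < \<tau> + clock n \<omega>" ..
  then have st: "state t i ?\<omega> q = (if q < \<tau> then i else state \<tau> k \<omega> q)" for q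
    using state_unfold[of t x \<omega> i y q] t by (simp add: gap \<tau>_def k_def)
  have kN: "k \<le> N" unfolding k_def by (rule step_le[OF i])
  have t\<tau>: "t < \<tau>" using x by (simp add: \<tau>_def)
  consider "s < \<tau>" | "\<tau> \<le> s" "r < \<tau>" | "\<tau> \<le> r" by linarith
  then show ?thesis
  proof cases
    case 1
    have "follows C t i ?\<omega> \<longleftrightarrow> (\<forall>(z, j)\<in>C. t \<le> z \<longrightarrow> j = i)"
      unfolding follows_def st using 1 C t by fastforce
    moreover have "deviation f r s t i ?\<omega> = - (LBINT q:{max r t..s}. if q < \<tau> then drift f q i else 0)"
    proof -
      have "(LBINT q:{max r t..s}. drift f q (state t i ?\<omega> q)) = (LBINT q:{max r t..s}. if q < \<tau> then drift f q i else 0)"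
        using 1 by (intro set_lebesgue_integral_cong) (auto simp: st)
      then show ?thesis using 1 t unfolding deviation_def st by auto
    qed
    ultimately show ?thesis using 1 unfolding first_jump_term_def \<tau>_def[symmetric] k_def[symmetric] by simp
  next
    case 2
    have f1: "follows C t i ?\<omega> \<longleftrightarrow> (\<forall>(z, j)\<in>C. t \<le> z \<longrightarrow> j = i)"
      unfolding follows_def st using 2 C by fastforce
    have f2: "follows C \<tau> k \<omega>" unfolding follows_def using 2 C by fastforce
    have f3: "(\<forall>(z, j)\<in>C. t \<le> z \<and> z < \<tau> \<longrightarrow> j = i) \<longleftrightarrow> (\<forall>(z, j)\<in>C. t \<le> z \<longrightarrow> j = i)"
      using 2 C by fastforce
    have a: "max r t < \<tau>" using 2 t\<tau> by simp
    have dm: "(\<lambda>q. drift f q i) \<in> borel_measurable borel" by (rule drift_measurable) auto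
    have "(LBINT q:{max r t..s}. drift f q (state t i ?\<omega> q))
      = (LBINT q:{max r t..s}. (if q < \<tau> then drift f q i else 0) + (if \<tau> \<le> q then drift f q (state \<tau> k \<omega> q) else 0))"
      by (intro set_lebesgue_integral_cong) (auto simp: st)
    also have "\<dots> = (LBINT q:{max r t..s}. if q < \<tau> then drift f q i else 0)
       + (LBINT q:{max r t..s}. if \<tau> \<le> q then drift f q (state \<tau> k \<omega> q) else 0)"
    proof (rule set_integral_add)
      have B0: "0 \<le> (Bl + real K) * (2 * B)"
        using order_trans[OF lam(1)[of 0] lam(2)] f[of 0] by (intro mult_nonneg_nonneg) auto
      show "set_integrable lborel {max r t..s} (\<lambda>q. if q < \<tau> then drift f q i else 0)"
        by (rule bounded_borel_set_integrable[where B="(Bl + real K) * (2 * B)"])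
           (use dm B0 drift_bounded[OF i f] in auto)
      show "set_integrable lborel {max r t..s} (\<lambda>q. if \<tau> \<le> q then drift f q (state \<tau> k \<omega> q) else 0)"
        by (rule bounded_borel_set_integrable[where B="(Bl + real K) * (2 * B)"])
           (use path_drift_measurable[of f \<tau> k \<omega>] B0 drift_bounded[OF state_le[OF kN] f] in auto)
    qed
    also have "(LBINT q:{max r t..s}. if \<tau> \<le> q then drift f q (state \<tau> k \<omega> q) else 0)
       = (LBINT q:{\<tau>..s}. drift f q (state \<tau> k \<omega> q))"
      unfolding set_lebesgue_integral_def
      by (intro Bochner_Integration.integral_cong) (use a in \<open>auto simp: indicator_def\<close>)
    finally have "deviation f r s t i ?\<omega> = deviation f r s \<tau> k \<omega>
       + first_jump_term f (max r t) s t i x (f k - f i)"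
      unfolding deviation_def first_jump_term_def \<tau>_def[symmetric] st
      using 2 a by (simp add: state_start max_absorb2)
    then show ?thesis using 2 f1 f2 f3 unfolding \<tau>_def[symmetric] k_def[symmetric] by (simp add: algebra_simps)
  next
    case 3
    have a: "max r t = r" "max r \<tau> = r" using 3 t\<tau> by auto
    have "follows C t i ?\<omega> \<longleftrightarrow> (\<forall>(z, j)\<in>C. t \<le> z \<and> z < \<tau> \<longrightarrow> j = i) \<and> follows C \<tau> k \<omega>"
      unfolding follows_def st using t\<tau> by (fastforce simp: not_less)
    moreover have "deviation f r s t i ?\<omega> = deviation f r s \<tau> k \<omega>"
    proof -
      have "(LBINT q:{r..s}. drift f q (state t i ?\<omega> q)) = (LBINT q:{r..s}. drift f q (state \<tau> k \<omega> q))"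
        using 3 by (intro set_lebesgue_integral_cong) (auto simp: st)
      then show ?thesis unfolding deviation_def a using 3 t by (simp add: st)
    qed
    moreover have "first_jump_term f (max r t) s t i x d = 0" for d
    proof -
      have "(LBINT q:{r..s}. if q < \<tau> then drift f q i else 0) = (LBINT q:{r..s}. 0)"
        using 3 by (intro set_lebesgue_integral_cong) auto
      then show ?thesis using 3 unfolding first_jump_term_def \<tau>_def[symmetric] a by simp
    qed
    ultimately show ?thesis using 3 t unfolding \<tau>_def[symmetric] k_def[symmetric] by auto
  qed
qed

lemma first_jump_term_measurable:
  assumes [measurable]: "d \<in> borel_measurable borel"
  shows "(\<lambda>x. first_jump_term f a s t i x (d x)) \<in> borel_measurable borel"
proof -
  have [measurable]: "(\<lambda>q. drift f q i) \<in> borel_measurable borel" by (rule drift_measurable) auto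
  have "(\<lambda>x. LBINT q:{a..s}. if q < t + x then drift f q i else 0) \<in> borel_measurable borel"
    unfolding set_lebesgue_integral_def
    by (rule lborel.borel_measurable_lebesgue_integral) measurable
  then show ?thesis unfolding first_jump_term_def by measurable
qed

lemma first_jump_term_bounded:
  assumes i: "i \<le> N" and f: "\<And>j. \<bar>f j\<bar> \<le> B" and as: "a \<le> s" and d: "\<bar>d\<bar> \<le> D"
  shows "\<bar>first_jump_term f a s t i x d\<bar> \<le> D + (Bl + real K) * (2 * B) * (s - a)"
proof -
  have [measurable]: "(\<lambda>q. drift f q i) \<in> borel_measurable borel" by (rule drift_measurable) auto
  have B0: "0 \<le> (Bl + real K) * (2 * B)"
    using order_trans[OF lam(1)[of 0] lam(2)] f[of 0] by (intro mult_nonneg_nonneg) auto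
  have "\<bar>LBINT q:{a..s}. if q < t + x then drift f q i else 0\<bar> \<le> (Bl + real K) * (2 * B) * (s - a)"
    by (rule set_integral_abs_le) (use as B0 drift_bounded[OF i f] in auto)
  then show ?thesis unfolding first_jump_term_def using d by auto
qed

text \<open>
  The first potential jump has the density \<open>L * exp (- L * (q - t))\<close> and a mean effect \<open>drift f q i / L\<close>,
  while the compensator is collected at the rate \<open>drift f q i\<close> with the survival probability
  \<open>exp (- L * (q - t))\<close>. Both amount to the integral of \<open>exp (- L * (q - t)) * drift f q i\<close> over \<open>{a..s}\<close>.
\<close>

lemma first_jump_term_mean_zero:
  assumes i: "i \<le> N" and f: "\<And>j. \<bar>f j\<bar> \<le> B" and ta: "t \<le> a" "a \<le> s"
  shows "(\<integral>x. first_jump_term f a s t i x (drift f (t + x) i / L) \<partial>noise) = 0"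
proof -
  interpret noise: prob_space noise by (rule prob_space_noise)
  have dm[measurable]: "(\<lambda>q. drift f q i) \<in> borel_measurable borel" by (rule drift_measurable) auto
  have B0: "0 \<le> (Bl + real K) * (2 * B)"
    using order_trans[OF lam(1)[of 0] lam(2)] f[of 0] by (intro mult_nonneg_nonneg) auto
  have db: "\<bar>drift f q i\<bar> \<le> (Bl + real K) * (2 * B)" for q by (rule drift_bounded[OF i f])
  have gm: "(\<lambda>(q, x). if q < t + x then drift f q i else 0) \<in> borel_measurable (borel \<Otimes>\<^sub>M noise)" by measurable
  have gB: "\<bar>if q < t + x then drift f q i else 0\<bar> \<le> (Bl + real K) * (2 * B)" for q x using db B0 by auto
  have i2: "integrable noise (\<lambda>x. LBINT q:{a..s}. if q < t + x then drift f q i else 0)"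
    by (rule bounded_Fubini_integrable[OF prob_space_noise gm gB])
  have "(\<integral>x. (LBINT q:{a..s}. if q < t + x then drift f q i else 0) \<partial>noise)
      = (LBINT q:{a..s}. (\<integral>x. (if q < t + x then drift f q i else 0) \<partial>noise))"
    by (rule bounded_Fubini_eq[OF prob_space_noise gm gB])
  also have "\<dots> = (LBINT q:{a..s}. exp (- L * (q - t)) * drift f q i)"
  proof (rule set_lebesgue_integral_cong, simp, safe)
    fix q assume q: "q \<in> {a..s}"
    have "(\<integral>x. (if q < t + x then drift f q i else 0) \<partial>noise) = (\<integral>x. (1 - indicator {x. x \<le> q - t} x) * drift f q i \<partial>noise)"
      by (intro Bochner_Integration.integral_cong) (auto simp: indicator_def)
    also have "\<dots> = (1 - measure noise {x. x \<le> q - t}) * drift f q i"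
      by (simp add: less_top[symmetric])
    also have "\<dots> = exp (- L * (q - t)) * drift f q i" using q ta by (subst noise_le) auto
    finally show "(\<integral>x. (if q < t + x then drift f q i else 0) \<partial>noise) = exp (- L * (q - t)) * drift f q i" .
  qed
  finally have 2: "(\<integral>x. (LBINT q:{a..s}. if q < t + x then drift f q i else 0) \<partial>noise)
      = (LBINT q:{a..s}. exp (- L * (q - t)) * drift f q i)" .
  define h where "h x = (if a < t + x \<and> t + x \<le> s then drift f (t + x) i / L else 0)" for x
  have hm[measurable]: "h \<in> borel_measurable borel"
    unfolding h_def using measurable_compose[OF _ dm, of "\<lambda>x. t + x" borel] by measurable
  have i1: "integrable noise h"
    by (rule noise.integrable_const_bound[where B="(Bl + real K) * (2 * B) / L"])
       (use db B0 L in \<open>auto simp: h_def divide_right_mono\<close>)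
  have "(\<integral>x. h x \<partial>noise) = (LBINT x:{0..}. L * exp (- L * x) * h x)" by (rule noise_integral[OF hm])
  also have "\<dots> = (LBINT x. (\<lambda>q. if a < q \<and> q \<le> s then exp (- L * (q - t)) * drift f q i else 0) (t + 1 * x))"
    unfolding set_lebesgue_integral_def
    by (intro Bochner_Integration.integral_cong) (use ta L in \<open>auto simp: h_def indicator_def\<close>)
  also have "\<dots> = (LBINT q. if a < q \<and> q \<le> s then exp (- L * (q - t)) * drift f q i else 0)"
    by (subst lborel_integral_real_affine[where c=1 and t=t]) auto
  also have "\<dots> = (LBINT q:{a..s}. exp (- L * (q - t)) * drift f q i)"
    unfolding set_lebesgue_integral_def
  proof (rule integral_cong_AE)
    show "AE q in lborel. (if a < q \<and> q \<le> s then exp (- L * (q - t)) * drift f q i else 0)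
       = indicat_real {a..s} q *\<^sub>R (exp (- L * (q - t)) * drift f q i)"
      using AE_lborel_singleton[of a] by eventually_elim auto
  qed measurable
  finally have 1: "(\<integral>x. h x \<partial>noise) = (LBINT q:{a..s}. exp (- L * (q - t)) * drift f q i)" .
  have "(\<integral>x. first_jump_term f a s t i x (drift f (t + x) i / L) \<partial>noise)
     = (\<integral>x. h x \<partial>noise) - (\<integral>x. (LBINT q:{a..s}. if q < t + x then drift f q i else 0) \<partial>noise)"
    unfolding first_jump_term_def h_def[symmetric] by (rule Bochner_Integration.integral_diff[OF i1 i2])
  then show ?thesis using 1 2 by simp
qed

text \<open>
  First-jump analysis turns the mean \<open>W t i\<close> into an average of \<open>W\<close> at the first potential jump,
  with the kernel restricted to jumps before \<open>s\<close>; the contribution before the jump has mean zero. Hence \<open>W\<close>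
  vanishes by contraction, for all starting points at once.
\<close>

lemma deviation_mean_zero:
  assumes f: "\<And>j. \<bar>f j\<bar> \<le> B" and rs: "r \<le> s" "s \<le> T"
    and C: "finite C" "\<And>x j. (x, j) \<in> C \<Longrightarrow> x \<le> r"
    and i: "i \<le> N" and t: "t \<in> {0..s}"
  shows "(\<integral>\<omega>. of_bool (follows C t i \<omega>) * deviation f r s t i \<omega> \<partial>driver) = 0"
proof -
  interpret noise: prob_space noise by (rule prob_space_noise)
  interpret driver: prob_space driver by (rule prob_space_driver)
  define \<Psi> where "\<Psi> t i \<omega> = of_bool (follows C t i \<omega>) * deviation f r s t i \<omega>" for t i \<omega>
  define W where "W t i = (\<integral>\<omega>. \<Psi> t i \<omega> \<partial>driver)" for t i
  define Bd where "Bd = 2 * B + (Bl + real K) * (2 * B) * T"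
  have \<Psi>m: "(\<lambda>z. \<Psi> (t z) (k z) (w z)) \<in> borel_measurable Z"
    if "t \<in> borel_measurable Z" "k \<in> Z \<rightarrow>\<^sub>M count_space UNIV" "w \<in> Z \<rightarrow>\<^sub>M driver" for t k w and Z :: "'z measure"
  proof -
    have w: "w \<in> Z \<rightarrow>\<^sub>M (\<Pi>\<^sub>M n\<in>UNIV. borel)" using that(3) by (simp cong: measurable_cong_sets add: sets_driver)
    note [measurable] = follows_measurable[OF C(1) that(1,2) w] deviation_measurable[OF that(1,2) w]
    show ?thesis unfolding \<Psi>_def of_bool_def by measurable
  qed
  have \<Psi>B: "\<bar>\<Psi> t i \<omega>\<bar> \<le> Bd" if "i \<le> N" "t \<in> {0..s}" for t i \<omega>
  proof -
    have "\<bar>deviation f r s t i \<omega>\<bar> \<le> Bd"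
      unfolding Bd_def using deviation_bounded[OF that(1) f, where t=t and s=s and r=r and \<omega>=\<omega>] that rs by auto
    then show ?thesis by (auto simp: \<Psi>_def)
  qed
  have \<Psi>int: "integrable driver (\<Psi> t i)" if "i \<le> N" "t \<in> {0..s}" for t i
    by (rule driver.integrable_const_bound[where B=Bd]) (use \<Psi>B[OF that] in \<open>auto intro!: \<Psi>m\<close>)
  have abs_mean: "\<bar>\<integral>z. g z \<partial>M\<bar> \<le> c" if M: "prob_space M" and g: "integrable M g" and b: "AE z in M. \<bar>g z\<bar> \<le> c"
    for g :: "'z \<Rightarrow> real" and c M
  proof -
    interpret M: prob_space M by fact
    have "\<bar>\<integral>z. g z \<partial>M\<bar> \<le> (\<integral>z. \<bar>g z\<bar> \<partial>M)" by (rule integral_abs_bound)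
    also have "\<dots> \<le> (\<integral>z. c \<partial>M)" using g b by (intro integral_mono_AE) auto
    finally show ?thesis by (simp add: M.prob_space)
  qed
  have "(\<lambda>(t, i). \<bar>W t i\<bar>) (t, i) \<le> 0"
  proof (rule contraction_nonpos[where f="\<lambda>(t, i). \<bar>W t i\<bar>" and X="{0..s} \<times> {..N}" and \<theta>="1 - exp (- L * T)" and B=Bd])
    fix x assume "x \<in> {0..s} \<times> {..N}"
    then obtain t i where x: "x = (t, i)" "i \<le> N" "t \<in> {0..s}" by auto
    have "\<bar>W t i\<bar> \<le> Bd"
      unfolding W_def using \<Psi>B[OF x(2,3)] by (intro abs_mean[OF prob_space_driver \<Psi>int[OF x(2,3)]]) auto
    then show "(\<lambda>(t, i). \<bar>W t i\<bar>) x \<le> Bd" by (simp add: x)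
  next
    fix m z assume m: "0 \<le> m" and le0: "\<And>y. y \<in> {0..s} \<times> {..N} \<Longrightarrow> (case y of (t, i) \<Rightarrow> \<bar>W t i\<bar>) \<le> m"
      and "z \<in> {0..s} \<times> {..N}"
    then obtain t i where z: "z = (t, i)" and i: "i \<le> N" and t: "t \<in> {0..s}" by auto
    have le: "\<bar>W t i\<bar> \<le> m" if "i \<le> N" "t \<in> {0..s}" for t i using le0[of "(t, i)"] that by auto
    define c where "c = (of_bool (\<forall>(z, j)\<in>C. t \<le> z \<longrightarrow> j = i) :: real)"
    define c1 where "c1 x = (of_bool (\<forall>(z, j)\<in>C. t \<le> z \<and> z < t + x \<longrightarrow> j = i) :: real)" for x
    define a where "a = max r t"
    have a: "t \<le> a" "a \<le> s" using t rs by (auto simp: a_def)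
    define b where "b x y = first_jump_term f a s t i x (f (step (t + x) i y) - f i)" for x y
    define \<beta> where "\<beta> x = first_jump_term f a s t i x (drift f (t + x) i / L)" for x
    define H where "H x = (\<integral>y. \<integral>\<omega>. \<Psi> t i (case_nat x (case_nat y \<omega>)) \<partial>driver \<partial>noise)" for x
    define h where "h x = (if t + x \<le> s then c1 x * (\<integral>y. W (t + x) (step (t + x) i y) \<partial>noise) else 0)" for x
    have Wstep: "integrable noise (\<lambda>y. W \<tau> (step \<tau> i y))" "\<bar>\<integral>y. W \<tau> (step \<tau> i y) \<partial>noise\<bar> \<le> m"
      if "\<tau> \<in> {0..s}" for \<tau>
    proof -
      have sm: "(\<lambda>y. step \<tau> i y) \<in> noise \<rightarrow>\<^sub>M count_space UNIV"
        by measurable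
      have Wm: "(\<lambda>y. W \<tau> (step \<tau> i y)) \<in> borel_measurable noise"
        by (rule measurable_compose[OF sm]) simp
      have Wb: "\<bar>W \<tau> (step \<tau> i y)\<bar> \<le> m" for y
        by (rule le[OF step_le[OF i] that])
      show int: "integrable noise (\<lambda>y. W \<tau> (step \<tau> i y))"
        by (rule noise.integrable_const_bound[where B=m, OF _ Wm]) (use Wb in auto)
      show "\<bar>\<integral>y. W \<tau> (step \<tau> i y) \<partial>noise\<bar> \<le> m"
        by (rule abs_mean[OF prob_space_noise int]) (use Wb in auto)
    qed
    have bint: "integrable noise (\<lambda>y. b x y)" and bval: "(\<integral>y. b x y \<partial>noise) = \<beta> x" for x
    proof -
      have sm: "(\<lambda>y. step (t + x) i y) \<in> noise \<rightarrow>\<^sub>M count_space UNIV" by measurable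
      have fm: "(\<lambda>y. f (step (t + x) i y)) \<in> borel_measurable noise"
        by (rule measurable_compose[OF sm]) simp
      have fint: "integrable noise (\<lambda>y. f (step (t + x) i y))"
        by (rule noise.integrable_const_bound[where B=B, OF _ fm]) (use f in auto)
      have "(\<integral>y. f (step (t + x) i y) - f i \<partial>noise) = drift f (t + x) i / L"
        using fint integral_step[OF i, of f "t + x"] by (simp add: drift_def)
      note mean = this
      have "(\<integral>y. b x y \<partial>noise) = \<beta> x \<and> integrable noise (\<lambda>y. b x y)"
      proof (cases "a < t + x \<and> t + x \<le> s")
        case True
        show ?thesis unfolding b_def \<beta>_def first_jump_term_def if_P[OF True] using fint mean by simp
      next
        case False
        show ?thesis unfolding b_def \<beta>_def first_jump_term_def if_not_P[OF False] by simp
      qed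
      then show "(\<integral>y. b x y \<partial>noise) = \<beta> x" "integrable noise (\<lambda>y. b x y)" by auto
    qed
    \<comment> \<open>Given the first gap \<open>x\<close>, the mean is the restarted part \<open>h\<close> plus the part \<open>\<beta>\<close> before the jump.\<close>
    have Hh: "AE x in noise. H x = h x + c * \<beta> x"
      using noise_pos
    proof eventually_elim
      fix x :: real assume x: "0 < x"
      have inner: "(\<integral>\<omega>. \<Psi> t i (case_nat x (case_nat y \<omega>)) \<partial>driver)
         = (if t + x \<le> s then c1 x * W (t + x) (step (t + x) i y) else 0) + c * b x y" for y
      proof -
        have "(\<integral>\<omega>. \<Psi> t i (case_nat x (case_nat y \<omega>)) \<partial>driver)
          = (\<integral>\<omega>. (if t + x \<le> s then c1 x * \<Psi> (t + x) (step (t + x) i y) \<omega> else 0) + c * b x y \<partial>driver)"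
        proof (rule integral_cong_AE)
          have cm: "(\<lambda>\<omega>. case_nat x (case_nat y \<omega>)) \<in> driver \<rightarrow>\<^sub>M driver"
            unfolding driver_def by measurable
          show "(\<lambda>\<omega>. \<Psi> t i (case_nat x (case_nat y \<omega>))) \<in> borel_measurable driver"
            by (rule \<Psi>m[OF _ _ cm]) auto
          have "(\<lambda>\<omega>. \<Psi> (t + x) (step (t + x) i y) \<omega>) \<in> borel_measurable driver"
            by (rule \<Psi>m) auto
          then show "(\<lambda>\<omega>. (if t + x \<le> s then c1 x * \<Psi> (t + x) (step (t + x) i y) \<omega> else 0) + c * b x y) \<in> borel_measurable driver"
            by (cases "t + x \<le> s") simp_all
          show "AE \<omega> in driver. \<Psi> t i (case_nat x (case_nat y \<omega>))
             = (if t + x \<le> s then c1 x * \<Psi> (t + x) (step (t + x) i y) \<omega> else 0) + c * b x y"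
            using clock_unbounded
          proof eventually_elim
            fix \<omega> assume ex: "\<exists>n. T < clock n \<omega>"
            show "\<Psi> t i (case_nat x (case_nat y \<omega>))
             = (if t + x \<le> s then c1 x * \<Psi> (t + x) (step (t + x) i y) \<omega> else 0) + c * b x y"
              unfolding \<Psi>_def c1_def c_def b_def a_def
              by (rule deviation_first_jump[OF i f _ _ rs C(2) x ex]) (use t in auto)
          qed
        qed
        also have "\<dots> = (if t + x \<le> s then c1 x * W (t + x) (step (t + x) i y) else 0) + c * b x y"
        proof (cases "t + x \<le> s")
          case True
          have "integrable driver (\<Psi> (t + x) (step (t + x) i y))"
            by (rule \<Psi>int[OF step_le[OF i]]) (use True x t in auto)
          then show ?thesis using True by (simp add: W_def)
        qed simp
        finally show ?thesis .
      qed
      show "H x = h x + c * \<beta> x"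
      proof (cases "t + x \<le> s")
        case True
        then show ?thesis unfolding H_def inner h_def using Wstep(1)[of "t + x"] bint[of x] bval[of x] x t by simp
      next
        case False
        then show ?thesis unfolding H_def inner h_def using bint[of x] bval[of x] by simp
      qed
    qed
    have pm: "(\<lambda>p. case_nat (fst (fst p)) (case_nat (snd (fst p)) (snd p))) \<in> (noise \<Otimes>\<^sub>M noise) \<Otimes>\<^sub>M driver \<rightarrow>\<^sub>M driver"
      unfolding driver_def by measurable
    have "(\<lambda>p. \<Psi> t i (case_nat (fst (fst p)) (case_nat (snd (fst p)) (snd p)))) \<in> borel_measurable ((noise \<Otimes>\<^sub>M noise) \<Otimes>\<^sub>M driver)"
      by (rule \<Psi>m[OF _ _ pm]) auto
    then have "(\<lambda>p. \<integral>\<omega>. \<Psi> t i (case_nat (fst p) (case_nat (snd p) \<omega>)) \<partial>driver) \<in> borel_measurable (noise \<Otimes>\<^sub>M noise)"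
      by (intro driver.borel_measurable_lebesgue_integral) (simp add: split_beta')
    then have Hm: "H \<in> borel_measurable noise"
      unfolding H_def by (intro noise.borel_measurable_lebesgue_integral) (simp add: split_beta')
    have \<beta>m: "\<beta> \<in> borel_measurable noise"
    proof -
      have [measurable]: "(\<lambda>x. drift f (t + x) i) \<in> borel_measurable borel" by (rule drift_measurable) auto
      have "\<beta> \<in> borel_measurable borel" unfolding \<beta>_def by (rule first_jump_term_measurable) measurable
      then show ?thesis by simp
    qed
    have \<beta>int: "integrable noise \<beta>"
    proof (rule noise.integrable_const_bound[OF _ \<beta>m])
      show "AE x in noise. norm (\<beta> x) \<le> (Bl + real K) * (2 * B) / L + (Bl + real K) * (2 * B) * (s - a)"
        unfolding \<beta>_def real_norm_def
        by (intro AE_I2 first_jump_term_bounded[OF i f a(2)]) (use drift_bounded[OF i f] L in \<open>auto simp: divide_right_mono\<close>)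
    qed
    have HB: "\<bar>H x\<bar> \<le> Bd" for x
    proof -
      have cm: "(\<lambda>\<omega>. case_nat x (case_nat y \<omega>)) \<in> driver \<rightarrow>\<^sub>M driver" for y unfolding driver_def by measurable
      have 1: "integrable driver (\<lambda>\<omega>. \<Psi> t i (case_nat x (case_nat y \<omega>)))" for y
        by (rule driver.integrable_const_bound[where B=Bd]) (use \<Psi>B[OF i t] in \<open>auto intro!: \<Psi>m[OF _ _ cm]\<close>)
      have 2: "\<bar>\<integral>\<omega>. \<Psi> t i (case_nat x (case_nat y \<omega>)) \<partial>driver\<bar> \<le> Bd" for y
        by (rule abs_mean[OF prob_space_driver 1]) (use \<Psi>B[OF i t] in auto)
      have pm: "(\<lambda>p. case_nat x (case_nat (fst p) (snd p))) \<in> noise \<Otimes>\<^sub>M driver \<rightarrow>\<^sub>M driver"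
        unfolding driver_def by measurable
      have "(\<lambda>p. \<Psi> t i (case_nat x (case_nat (fst p) (snd p)))) \<in> borel_measurable (noise \<Otimes>\<^sub>M driver)"
        by (rule \<Psi>m[OF _ _ pm]) auto
      then have 3: "(\<lambda>y. \<integral>\<omega>. \<Psi> t i (case_nat x (case_nat y \<omega>)) \<partial>driver) \<in> borel_measurable noise"
        by (intro driver.borel_measurable_lebesgue_integral) (simp add: split_beta')
      show ?thesis unfolding H_def
        by (rule abs_mean[OF prob_space_noise noise.integrable_const_bound[where B=Bd, OF _ 3]]) (use 2 in auto)
    qed
    have Hint: "integrable noise H"
      by (rule noise.integrable_const_bound[OF _ Hm]) (use HB in auto)
    have diff: "integrable noise (\<lambda>x. H x - c * \<beta> x)" using Hint \<beta>int by auto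
    have "W t i = (\<integral>x. H x \<partial>noise)"
      unfolding W_def H_def by (rule driver_unfold[OF _ \<Psi>B[OF i t]]) (auto intro!: \<Psi>m)
    also have "\<dots> = (\<integral>x. H x \<partial>noise) - c * (\<integral>x. \<beta> x \<partial>noise)"
      unfolding \<beta>_def first_jump_term_mean_zero[OF i f a] by simp
    also have "\<dots> = (\<integral>x. H x - c * \<beta> x \<partial>noise)"
      using Hint \<beta>int by simp
    finally have Weq: "W t i = (\<integral>x. H x - c * \<beta> x \<partial>noise)" .
    have "\<bar>W t i\<bar> \<le> (\<integral>x. \<bar>H x - c * \<beta> x\<bar> \<partial>noise)" unfolding Weq by (rule integral_abs_bound)
    also have "\<dots> \<le> (\<integral>x. indicator {x. x \<le> s - t} x * m \<partial>noise)"
    proof (rule integral_mono_AE)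
      show "AE x in noise. \<bar>H x - c * \<beta> x\<bar> \<le> indicat_real {x. x \<le> s - t} x * m"
        using Hh noise_pos
      proof eventually_elim
        fix x assume "H x = h x + c * \<beta> x" and x: "0 < x"
        then have "H x - c * \<beta> x = h x" by simp
        moreover have "\<bar>h x\<bar> \<le> indicat_real {x. x \<le> s - t} x * m"
        proof (cases "t + x \<le> s")
          case True
          then have "\<bar>\<integral>y. W (t + x) (step (t + x) i y) \<partial>noise\<bar> \<le> m" using Wstep(2)[of "t + x"] x t by auto
          then show ?thesis using True m by (auto simp: h_def c1_def)
        qed (simp add: h_def)
        ultimately show "\<bar>H x - c * \<beta> x\<bar> \<le> indicat_real {x. x \<le> s - t} x * m" by simp
      qed
    qed (use diff in \<open>auto simp: less_top[symmetric]\<close>)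
    also have "\<dots> = (1 - exp (- L * (s - t))) * m"
      using noise_le[of "s - t"] t by simp
    also have "\<dots> \<le> (1 - exp (- L * T)) * m"
      using t rs L m by (intro mult_right_mono) auto
    finally show "(\<lambda>(t, i). \<bar>W t i\<bar>) z \<le> (1 - exp (- L * T)) * m" by (simp add: z)
  qed (use i t in auto)
  then show ?thesis by (simp add: W_def \<Psi>_def)
qed

end

text \<open>
  Dynkin's argument: the sets over which the integral of \<open>D\<close> vanishes are closed under complements and countable
  disjoint unions.
\<close>

lemma set_integral_zero_generated:
  fixes D :: "'a \<Rightarrow> real"
  assumes G: "Int_stable G" "G \<subseteq> sets M" and D: "integrable M D"
    and zero: "\<And>A. A \<in> G \<Longrightarrow> (LINT x:A|M. D x) = 0" "(\<integral>x. D x \<partial>M) = 0"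
    and A: "A \<in> sigma_sets (space M) G"
  shows "(LINT x:A|M. D x) = 0"
proof -
  have sub: "sigma_sets (space M) G \<subseteq> sets M" by (rule sets.sigma_sets_subset[OF G(2)])
  have setint: "set_integrable M A D" if "A \<in> sets M" for A
    unfolding set_integrable_def using integrable_mult_indicator[OF that D] .
  have "G \<subseteq> Pow (space M)" using G(2) sets.sets_into_space by blast
  from G(1) this A show ?thesis
  proof (induction rule: sigma_sets_induct_disjoint)
    case (basic A)
    then show ?case by (rule zero)
  next
    case empty
    show ?case by (simp add: set_lebesgue_integral_def)
  next
    case (compl A)
    then have A: "A \<in> sets M" using sub by auto
    have "(LINT x:space M - A|M. D x) = (\<integral>x. D x - indicator A x *\<^sub>R D x \<partial>M)"
      unfolding set_lebesgue_integral_def by (intro Bochner_Integration.integral_cong) (auto simp: indicator_def)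
    also have "\<dots> = (\<integral>x. D x \<partial>M) - (LINT x:A|M. D x)"
      using setint[OF A] D unfolding set_lebesgue_integral_def set_integrable_def by simp
    finally show ?case using compl zero by simp
  next
    case (union A)
    then have A: "A i \<in> sets M" for i using sub by auto
    have "(LINT x:(\<Union>i. A i)|M. D x) = (\<Sum>i. (LINT x:A i|M. D x))"
    proof (rule lebesgue_integral_countable_add[OF A])
      show "A i \<inter> A j = {}" if "i \<noteq> j" for i j using union(1) that by (auto simp: disjoint_family_on_def)
      show "set_integrable M (\<Union>i. A i) D" using A by (intro setint) auto
    qed
    then show ?case using union by simp
  qed
qed

context feedback_chain
begin

text \<open>
  A generator, stable under intersections, of the natural filtration of the chain.
\<close>

definition histories :: "real \<Rightarrow> nat \<Rightarrow> real \<Rightarrow> (nat \<Rightarrow> real) set set" where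
  "histories t i s = {{\<omega>. follows C t i \<omega>} | C. finite C \<and> C \<subseteq> {t..s} \<times> UNIV}"

lemma Int_stable_histories: "Int_stable (histories t i s)"
proof (rule Int_stableI)
  fix a b assume "a \<in> histories t i s" "b \<in> histories t i s"
  then obtain C C' where C: "a = {\<omega>. follows C t i \<omega>}" "finite C" "C \<subseteq> {t..s} \<times> UNIV"
    "b = {\<omega>. follows C' t i \<omega>}" "finite C'" "C' \<subseteq> {t..s} \<times> UNIV" unfolding histories_def by blast
  then have "a \<inter> b = {\<omega>. follows (C \<union> C') t i \<omega>}"
    by (simp add: C(1,4) follows_def ball_Un Collect_conj_eq)
  with C show "a \<inter> b \<in> histories t i s" unfolding histories_def by blast
qed

lemma histories_sets: "histories t i s \<subseteq> sets driver"
proof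
  fix A assume "A \<in> histories t i s"
  then obtain C where C: "A = {\<omega>. follows C t i \<omega>}" "finite C" unfolding histories_def by blast
  have "Measurable.pred driver (\<lambda>\<omega>. follows C t i \<omega>)"
    by (rule follows_measurable[OF C(2)]) (auto simp: measurable_ident_sets sets_driver)
  then show "A \<in> sets driver" unfolding pred_def C(1) by simp
qed

definition history :: "real \<Rightarrow> nat \<Rightarrow> real \<Rightarrow> (nat \<Rightarrow> real) measure" where
  "history t i s = sigma UNIV (histories t i s)"

lemma sets_history: "sets (history t i s) = sigma_sets UNIV (histories t i s)"
  unfolding history_def by (rule sets_measure_of) simp

lemma space_history[simp]: "space (history t i s) = UNIV"
  unfolding history_def by (rule space_measure_of) simp

lemma state_adapted:
  assumes "s \<in> {t..s'}"
  shows "(\<lambda>\<omega>. state t i \<omega> s) \<in> history t i s' \<rightarrow>\<^sub>M count_space UNIV"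
proof (subst measurable_count_space_eq_countable)
  have "(\<lambda>\<omega>. state t i \<omega> s) -` {j} \<inter> space (history t i s') \<in> sets (history t i s')" for j
  proof -
    have "(\<lambda>\<omega>. state t i \<omega> s) -` {j} \<inter> space (history t i s') = {\<omega>. follows {(s, j)} t i \<omega>}"
      using assms by (auto simp: follows_def)
    also have "\<dots> \<in> histories t i s'"
      unfolding histories_def using assms by (intro CollectI exI[of _ "{(s, j)}"]) auto
    finally show ?thesis unfolding sets_history by (rule sigma_sets.Basic)
  qed
  then show "(\<lambda>\<omega>. state t i \<omega> s) \<in> space (history t i s') \<rightarrow> UNIV \<and>
     (\<forall>a\<in>UNIV. (\<lambda>\<omega>. state t i \<omega> s) -` {a} \<inter> space (history t i s') \<in> sets (history t i s'))" by auto
qed simp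

lemma state_right_continuous: "continuous (at_right s) (state t i \<omega>)"
  using path_right_continuous unfolding state_def[abs_def] .

lemma state_left_limit: "\<exists>l. (state t i \<omega> \<longlongrightarrow> l) (at_left s)"
  using path_left_limit unfolding state_def[abs_def] .

text \<open>
  By \<open>deviation_mean_zero\<close> the increment integrates to zero over every history up to time \<open>r\<close>,
  hence over every event of the generated sigma-algebra. The function \<open>f\<close> is replaced by a bounded one
  that agrees with it on the states up to \<open>N\<close>.
\<close>

lemma feedback_martingale:
  fixes f :: "nat \<Rightarrow> real"
  assumes i: "i \<le> N" and t: "0 \<le> t" "t \<le> r" "r \<le> s" "s \<le> T"
  shows "AE \<omega> in driver. real_cond_exp driver (history t i r)
     (\<lambda>\<omega>. f (state t i \<omega> s) - f (state t i \<omega> r)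
        - (LBINT q:{r..s}. generator lam N q (\<mu> q (state t i \<omega> q)) f (state t i \<omega> q))) \<omega> = 0"
proof -
  interpret driver: prob_space driver by (rule prob_space_driver)
  have subal: "subalgebra driver (history t i r)"
    unfolding subalgebra_def using sets.sigma_sets_subset[OF histories_sets, of t i r] by (simp add: sets_history)
  then have "finite_measure_subalgebra driver (history t i r)" by unfold_locales
  then interpret sa: finite_measure_subalgebra driver "history t i r" .
  define g where "g j = f (min j N)" for j
  define B where "B = (\<Sum>j\<le>N. \<bar>f j\<bar>)"
  have gB: "\<bar>g j\<bar> \<le> B" for j unfolding g_def B_def by (rule member_le_sum) auto
  define D where "D = deviation g r s t i"
  have gen: "generator lam N q u f k = generator lam N q u g k" if "k \<le> N" for q u k
    unfolding generator_def using that by (intro sum.cong) (auto simp: g_def min_def)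
  have D: "(\<lambda>\<omega>. f (state t i \<omega> s) - f (state t i \<omega> r)
        - (LBINT q:{r..s}. generator lam N q (\<mu> q (state t i \<omega> q)) f (state t i \<omega> q))) = D"
  proof (rule ext)
    fix \<omega>
    have "(LBINT q:{r..s}. generator lam N q (\<mu> q (state t i \<omega> q)) f (state t i \<omega> q))
       = (LBINT q:{r..s}. drift g q (state t i \<omega> q))"
      unfolding drift_def gen[OF state_le[OF i]] ..
    then show "f (state t i \<omega> s) - f (state t i \<omega> r)
        - (LBINT q:{r..s}. generator lam N q (\<mu> q (state t i \<omega> q)) f (state t i \<omega> q)) = D \<omega>"
      unfolding D_def deviation_def using t state_le[OF i] by (simp add: g_def max_absorb1 min_absorb1)
  qed
  have Dm: "D \<in> borel_measurable driver"
    unfolding D_def by (rule deviation_measurable) (auto simp: measurable_ident_sets sets_driver)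
  have DB: "\<bar>D \<omega>\<bar> \<le> 2 * B + (Bl + real K) * (2 * B) * T" for \<omega>
    unfolding D_def by (rule deviation_bounded[OF i gB]) (use t in auto)
  have Dint: "integrable driver D"
    by (rule driver.integrable_const_bound[OF _ Dm]) (use DB in auto)
  have zero: "(LINT \<omega>:{\<omega>. follows C t i \<omega>}|driver. D \<omega>) = 0" if "finite C" "C \<subseteq> {t..r} \<times> UNIV" for C
  proof -
    have "(LINT \<omega>:{\<omega>. follows C t i \<omega>}|driver. D \<omega>) = (\<integral>\<omega>. of_bool (follows C t i \<omega>) * deviation g r s t i \<omega> \<partial>driver)"
      unfolding set_lebesgue_integral_def D_def by (intro Bochner_Integration.integral_cong) (auto simp: indicator_def)
    also have "\<dots> = 0"
      by (rule deviation_mean_zero[OF gB t(3,4) that(1) _ i]) (use that t in auto)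
    finally show ?thesis .
  qed
  have total: "(\<integral>\<omega>. D \<omega> \<partial>driver) = 0"
    using zero[of "{}"] unfolding follows_def set_lebesgue_integral_def by simp
  have "AE \<omega> in driver. real_cond_exp driver (history t i r) D \<omega> = 0"
  proof (rule sa.real_cond_exp_charact)
    fix A assume "A \<in> sets (history t i r)"
    then have A: "A \<in> sigma_sets (space driver) (histories t i r)" by (simp add: sets_history)
    have "(LINT \<omega>:A|driver. D \<omega>) = 0"
      by (rule set_integral_zero_generated[OF Int_stable_histories histories_sets Dint _ total A])
         (auto simp: histories_def zero)
    then show "(LINT \<omega>:A|driver. D \<omega>) = (LINT \<omega>:A|driver. 0)" by simp
  qed (use Dint in auto)
  then show ?thesis unfolding D .
qed

lemma feedback_controlled_system:
  assumes i: "i \<le> N" and t: "t \<in> {0..T}"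
  shows "controlled_system T lam N K t i driver (history t i)
     (\<lambda>s \<omega>. state t i \<omega> s) (\<lambda>s \<omega>. \<mu> s (state t i \<omega> s))"
  unfolding controlled_system_def
proof (intro conjI ballI allI impI)
  show "prob_space driver" by (rule prob_space_driver)
  show "filtration (space driver) (history t i)"
  proof
    fix a b :: real assume "a \<le> b"
    then have "histories t i a \<subseteq> histories t i b" unfolding histories_def by fastforce
    then show "sets (history t i a) \<subseteq> sets (history t i b)"
      unfolding sets_history by (rule sigma_sets_mono')
  qed simp
  show "subalgebra driver (history t i s)" for s
    unfolding subalgebra_def using sets.sigma_sets_subset[OF histories_sets, of t i s] by (simp add: sets_history)
  show "(\<lambda>\<omega>. state t i \<omega> s) \<in> history t i s \<rightarrow>\<^sub>M count_space UNIV" if "s \<in> {t..T}" for s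
    using that by (intro state_adapted) auto
  show "(\<lambda>(r, \<omega>). \<mu> r (state t i \<omega> r)) \<in> restrict_space borel {t..s} \<Otimes>\<^sub>M history t i s \<rightarrow>\<^sub>M count_space UNIV"
    if s: "s \<in> {t..T}" for s
  proof -
    have "(\<lambda>(r, \<omega>). state t i \<omega> r) \<in> restrict_space borel {t..s} \<Otimes>\<^sub>M history t i s \<rightarrow>\<^sub>M count_space UNIV"
      by (rule right_continuous_jointly_measurable)
         (use s in \<open>auto intro!: state_adapted state_right_continuous\<close>)
    then have "(\<lambda>x. state t i (snd x) (fst x)) \<in> restrict_space borel {t..s} \<Otimes>\<^sub>M history t i s \<rightarrow>\<^sub>M count_space UNIV"
      by (simp add: split_beta')
    moreover have "(\<lambda>x. \<mu> (fst x) j) \<in> restrict_space borel {t..s} \<Otimes>\<^sub>M history t i s \<rightarrow>\<^sub>M count_space UNIV" for j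
      by (rule measurable_compose[OF measurable_fst measurable_restrict_space1[OF \<mu>_measurable]])
    ultimately have "(\<lambda>x. \<mu> (fst x) (state t i (snd x) (fst x))) \<in> restrict_space borel {t..s} \<Otimes>\<^sub>M history t i s \<rightarrow>\<^sub>M count_space UNIV"
      by (rule measurable_compose_countable[where f="\<lambda>j x. \<mu> (fst x) j", rotated])
    then show ?thesis by (simp add: split_beta')
  qed
  show "state t i \<omega> t = i" for \<omega> by (rule state_start)
  show "state t i \<omega> s \<in> {0..N}" for s \<omega> using state_le[OF i] by simp
  show "\<mu> s (state t i \<omega> s) \<in> feasible_actions K (state t i \<omega> s)" for s \<omega>
    using \<mu> by (simp add: feasible_actions_def)
  show "continuous (at_right s) (\<lambda>r. state t i \<omega> r)" for s \<omega> by (rule state_right_continuous)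
  show "\<exists>l. ((\<lambda>r. state t i \<omega> r) \<longlongrightarrow> l) (at_left s)" for s \<omega> by (rule state_left_limit)
  show "AE \<omega> in driver. real_cond_exp driver (history t i r)
     (\<lambda>\<omega>. f (state t i \<omega> s) - f (state t i \<omega> r)
        - (LBINT q:{r..s}. generator lam N q (\<mu> q (state t i \<omega> q)) f (state t i \<omega> q))) \<omega> = 0"
    if "t \<le> r \<and> r \<le> s \<and> s \<le> T" for f :: "nat \<Rightarrow> real" and r s
    using that t by (intro feedback_martingale[OF i]) auto
qed

end

section \<open>The value function and the activation threshold\<close>

context bounded_rates
begin

text \<open>
  The infimum is attained by the feedback rule that serves at full capacity exactly where the
  increment of \<open>v\<close> exceeds the current cost \<open>e s\<close> of a service.
\<close>

lemma value_function_eq_hjb_solution: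
  assumes v: "hjb_solution N K L v" and L: "0 < L" "Bl + real K \<le> L" and t: "t \<in> {0..T}" and i: "i \<le> N"
  shows "value_function T lam e p N K t i = v t i"
proof -
  define \<mu> where "\<mu> s j = (if v s j - v s (j - 1) > e s then min j K else 0)" for s j
  interpret feedback_chain T p Bl Be lam e L N K \<mu>
  proof
    note [measurable] = hjb_solution_measurable[OF v]
    show "(\<lambda>q. \<mu> q j) \<in> borel \<rightarrow>\<^sub>M count_space UNIV" for j unfolding \<mu>_def by measurable
  qed (use L in \<open>auto simp: \<mu>_def\<close>)
  note sys = feedback_controlled_system[OF i t]
  have cost: "cost_to_go T lam e p N t driver (\<lambda>s \<omega>. state t i \<omega> s) (\<lambda>s \<omega>. \<mu> s (state t i \<omega> s)) = v t i"
    by (rule cost_to_go_feedback[OF sys t v L]) (simp add: \<mu>_def)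
  show ?thesis
    unfolding value_function_def
  proof (rule cInf_eq_minimum)
    show "v t i \<in> {cost_to_go T lam e p N t M I u | (M :: (nat \<Rightarrow> real) measure) F I u.
            controlled_system T lam N K t i M F I u}"
      using sys cost[symmetric] by blast
  next
    fix x assume "x \<in> {cost_to_go T lam e p N t M I u | (M :: (nat \<Rightarrow> real) measure) F I u.
            controlled_system T lam N K t i M F I u}"
    then show "v t i \<le> x" using cost_to_go_ge_hjb_solution[OF _ t v L] by blast
  qed
qed

end

lemma generator_cong: "lam q = lam' q \<Longrightarrow> generator lam N q u f i = generator lam' N q u f i"
  by (simp add: generator_def jump_rate_def cong: if_cong)

lemma controlled_system_cong:
  assumes t: "0 \<le> t" and eq: "\<And>q. q \<in> {0..T} \<Longrightarrow> lam q = lam' q"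
    and sys: "controlled_system T lam N K t i M F I u"
  shows "controlled_system T lam' N K t i M F I u"
proof -
  have "(\<lambda>\<omega>. f (I s \<omega>) - f (I r \<omega>) - (LBINT q:{r..s}. generator lam' N q (u q \<omega>) f (I q \<omega>)))
      = (\<lambda>\<omega>. f (I s \<omega>) - f (I r \<omega>) - (LBINT q:{r..s}. generator lam N q (u q \<omega>) f (I q \<omega>)))"
    if "t \<le> r \<and> r \<le> s \<and> s \<le> T" for f :: "nat \<Rightarrow> real" and r s
  proof (rule ext)
    fix \<omega>
    have "(LBINT q:{r..s}. generator lam' N q (u q \<omega>) f (I q \<omega>)) = (LBINT q:{r..s}. generator lam N q (u q \<omega>) f (I q \<omega>))"
      using that t by (intro set_lebesgue_integral_cong) (auto intro!: generator_cong eq[symmetric])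
    then show "f (I s \<omega>) - f (I r \<omega>) - (LBINT q:{r..s}. generator lam' N q (u q \<omega>) f (I q \<omega>))
      = f (I s \<omega>) - f (I r \<omega>) - (LBINT q:{r..s}. generator lam N q (u q \<omega>) f (I q \<omega>))" by simp
  qed
  then show ?thesis using sys unfolding controlled_system_def by simp
qed

lemma value_function_cong:
  assumes t: "0 \<le> t" and eq: "\<And>q. q \<in> {0..T} \<Longrightarrow> lam q = lam' q" "\<And>q. q \<in> {0..T} \<Longrightarrow> e q = e' q"
  shows "value_function T lam e p N K t i = value_function T lam' e' p N K t i"
proof -
  have sys: "controlled_system T lam N K t i M F I u \<longleftrightarrow> controlled_system T lam' N K t i M F I u"
    for M :: "(nat \<Rightarrow> real) measure" and F I u
    using controlled_system_cong[where lam=lam and lam'=lam', OF t eq(1)]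
      controlled_system_cong[where lam=lam' and lam'=lam, OF t eq(1)[symmetric]] by blast
  have cost: "cost_to_go T lam e p N t M I u = cost_to_go T lam' e' p N t M I u"
    for M :: "(nat \<Rightarrow> real) measure" and I u
  proof -
    have "(LBINT s:{t..T}. cost_rate lam e p N s (I s \<omega>) (u s \<omega>)) = (LBINT s:{t..T}. cost_rate lam' e' p N s (I s \<omega>) (u s \<omega>))" for \<omega>
      using t eq by (intro set_lebesgue_integral_cong) (auto simp: cost_rate_def)
    then show ?thesis unfolding cost_to_go_def by simp
  qed
  show ?thesis unfolding value_function_def sys cost ..
qed

text \<open>
  A regular coefficient is continuous on \<open>{0..T}\<close> off a finite set, and changing a Borel function at finitely
  many points keeps it Borel.
\<close>

lemma regular_coefficient_bounded_borel:
  assumes "regular_coefficient T f"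
  obtains g B where "g \<in> borel_measurable borel" "\<And>q. 0 \<le> g q" "\<And>q. g q \<le> B" "\<And>q. q \<in> {0..T} \<Longrightarrow> f q = g q"
proof -
  have pos: "\<And>q. q \<in> {0..T} \<Longrightarrow> 0 < f q" and bd: "bounded (f ` {0..T})"
    and "\<exists>S. finite S \<and> f C1_differentiable_on ({0..T} - S)"
    using assms unfolding regular_coefficient_def by auto
  then obtain S where S: "finite S" "f C1_differentiable_on ({0..T} - S)" by blast
  obtain B where "\<forall>y\<in>f ` {0..T}. norm y \<le> B" using bd unfolding bounded_iff by blast
  then have B: "\<bar>f q\<bar> \<le> B" if "q \<in> {0..T}" for q using that by auto
  define g where "g q = (if q \<in> {0..T} then f q else 0)" for q
  have "{0..T} - S \<in> sets borel" using S(1) by (intro sets.Diff) (auto simp: finite_imp_closed)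
  then have "(\<lambda>q. indicator ({0..T} - S) q *\<^sub>R f q) \<in> borel_measurable borel"
    using C1_differentiable_imp_continuous_on[OF S(2)] by (rule borel_measurable_continuous_on_indicator)
  then have gm: "g \<in> borel_measurable borel"
    by (rule measurable_discrete_difference[where X=S]) (use S(1) in \<open>auto simp: g_def countable_finite\<close>)
  show thesis
  proof (rule that[of g "\<bar>B\<bar>"])
    show "0 \<le> g q" "g q \<le> \<bar>B\<bar>" "q \<in> {0..T} \<Longrightarrow> f q = g q" for q
      using pos[of q] B[of q] by (auto simp: g_def)
  qed (rule gm)
qed

text \<open>
  A state that is active in the primed system and at most \<open>N\<close> is active in the other one. A minimum above \<open>N\<close>,
  including the default \<open>N' + 1\<close> of an empty active set, is at least the default \<open>N + 1\<close>.
\<close>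

lemma i_min_mono:
  assumes N: "N \<le> N'"
    and le: "\<And>i. 1 \<le> i \<Longrightarrow> i \<le> N \<Longrightarrow> marginal_value T lam e p N' K' t i \<le> marginal_value T lam e p N K t i"
  shows "i_min T lam e p N K t \<le> i_min T lam e p N' K' t"
proof -
  let ?A = "active_states T lam e p N K t" and ?A' = "active_states T lam e p N' K' t"
  have fin: "finite ?A" "finite ?A'" by (auto simp: active_states_def)
  have upper: "i_min T lam e p N K t \<le> Suc N"
  proof (cases "?A = {}")
    case False
    then have "Min ?A \<le> N" using Min_in[OF fin(1)] by (simp add: active_states_def)
    then show ?thesis using False by (simp add: i_min_def)
  qed (simp add: i_min_def)
  show ?thesis
  proof (cases "i_min T lam e p N' K' t \<le> N")
    case False
    with upper show ?thesis by linarith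
  next
    case True
    then have ne: "?A' \<noteq> {}" using N by (auto simp: i_min_def)
    then have m: "i_min T lam e p N' K' t \<in> ?A'" using Min_in[OF fin(2)] by (simp add: i_min_def)
    then have "i_min T lam e p N' K' t \<in> ?A"
      using le[of "i_min T lam e p N' K' t"] True unfolding active_states_def by auto
    from Min_le[OF fin(1) this] this show ?thesis by (auto simp: i_min_def[of T lam e p N K t])
  qed
qed

theorem theorem3:
  fixes T p :: real and lam e :: "real \<Rightarrow> real"
  assumes "0 < T" and "0 < p"
    and "regular_coefficient T lam" and "regular_coefficient T e"
  shows "\<forall>t\<in>{0..T}.
      (\<forall>K\<ge>1. \<forall>N\<ge>1. i_min T lam e p (N + 1) K t \<ge> i_min T lam e p N K t) \<and>
      (\<forall>N\<ge>1. \<forall>K\<ge>1. i_min T lam e p N (K + 1) t \<ge> i_min T lam e p N K t)"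
proof -
  obtain lam' Bl where lam': "lam' \<in> borel_measurable borel" "\<And>q. 0 \<le> lam' q" "\<And>q. lam' q \<le> Bl"
    "\<And>q. q \<in> {0..T} \<Longrightarrow> lam q = lam' q" using regular_coefficient_bounded_borel[OF assms(3)] by blast
  obtain e' Be where e': "e' \<in> borel_measurable borel" "\<And>q. 0 \<le> e' q" "\<And>q. e' q \<le> Be"
    "\<And>q. q \<in> {0..T} \<Longrightarrow> e q = e' q" using regular_coefficient_bounded_borel[OF assms(4)] by blast
  interpret bounded_rates T p Bl Be lam' e'
    by unfold_locales (use assms lam' e' in auto)
  have marg: "marginal_value T lam e p N K t i = marginals N (v t) i"
    if "hjb_solution N K L v" "0 < L" "Bl + real K \<le> L" "t \<in> {0..T}" "1 \<le> i" "i \<le> N" for N K L v t i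
  proof -
    have "value_function T lam e p N K t j = v t j" if "j \<le> N" for j
      using value_function_cong[of t T lam lam' e e' p N K j] \<open>t \<in> {0..T}\<close> lam'(4) e'(4)
        value_function_eq_hjb_solution[OF \<open>hjb_solution N K L v\<close> \<open>0 < L\<close> \<open>Bl + real K \<le> L\<close> \<open>t \<in> {0..T}\<close> that]
      by simp
    then show ?thesis using that unfolding marginal_value_def marginals_def by simp
  qed
  have Bl: "0 \<le> Bl" using order_trans[OF lam'(2)[of 0] lam'(3)] .
  show ?thesis
  proof (intro ballI conjI allI impI)
    fix t K N assume t: "t \<in> {0..T}"
    \<comment> \<open>One rate that dominates the systems with \<open>K\<close> and with \<open>K + 1\<close> servers.\<close>
    define L where "L = Bl + real K + 1"
    have L: "0 < L" "Bl + real K \<le> L" "Bl + real (Suc K) \<le> L" using Bl by (auto simp: L_def)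
    obtain v where v: "hjb_solution N K L v" using hjb_solution_exists[OF L(1,2)] by blast
    {
      obtain v' where v': "hjb_solution (Suc N) K L v'" using hjb_solution_exists[OF L(1,2)] by blast
      show "i_min T lam e p N K t \<le> i_min T lam e p (N + 1) K t"
        by (rule i_min_mono)
           (use marginals_antimono_units[OF v v' L(1,2) _ t] marg[OF v L(1,2) t] marg[OF v' L(1,2) t] in auto)
    next
      obtain v' where v': "hjb_solution N (Suc K) L v'" using hjb_solution_exists[OF L(1,3)] by blast
      show "i_min T lam e p N K t \<le> i_min T lam e p N (K + 1) t"
        by (rule i_min_mono)
           (use marginals_antimono_servers[OF v v' L(1,3) _ t] marg[OF v L(1,2) t] marg[OF v' L(1,3) t] in auto)
    }
  qed
qed

end
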